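(* Let $\alpha>-1/2$ and let $S,\Sigma$ be measurable subsets of $\mathbb{R}^+$ whose Lebesgue measures satisfy $0<|S|<+\infty$ and $0<|\Sigma|<+\infty$. Then $(S,\Sigma)$ is a strong annihilating pair for the Fourier-Bessel transform: there exists a constant $C$ such that for every $f\in L^2_\alpha(\mathbb{R}^+)$, $$\|f\|_{L^2_\alpha}\le C\Big(\|f\|_{L^2_\alpha(\mathbb{R}^+\setminus S)}+\|\mathcal{F}_\alpha(f)\|_{L^2_\alpha(\mathbb{R}^+\setminus\Sigma)}\Big).$$
   Context: Fix $\alpha>-1/2$. Let $d\mu_\alpha(x)=(2\pi)^{\alpha+1}x^{2\alpha+1}\,dx$ on $\mathbb{R}^+=[0,\infty)$, and $L^2_\alpha(\mathbb{R}^+)=L^2(\mathbb{R}^+,\mu_\alpha)$; for $A\subset\mathbb{R}^+$, $\|g\|_{L^2_\alpha(A)}=(\int_A|g|^2d\mu_\alpha)^{1/2}$. The normalized Bessel function is $j_\alpha(x)=J_\alpha(x)/x^\alpha=2^{-\alpha}\sum_{n\ge0}\frac{(-1)^n}{n!\Gamma(n+\alpha+1)}(x/2)^{2n}$. For $f\in L^1_\alpha(\mathbb{R}^+)$ the Fourier-Bessel transform is $\mathcal{F}_\alpha(f)(y)=\int_0^\infty f(x)j_\alpha(2\pi xy)\,d\mu_\alpha(x)$; it extends to a unitary operator on $L^2_\alpha(\mathbb{R}^+)$. $|A|$ denotes Lebesgue measure. *)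

theory Defs
  imports "HOL-Analysis.Analysis"
begin

text \<open>Normalized Bessel function j_alpha(x) = J_alpha(x)/x^alpha, via its power series.\<close>
definition bessel_j :: "real \<Rightarrow> real \<Rightarrow> real" where
  "bessel_j a x = 2 powr (-a) *
     (\<Sum>n. (-1)^n / (fact n * Gamma (real n + a + 1)) * (x/2)^(2*n))"

definition mu :: "real \<Rightarrow> real measure" where
  "mu a = density (restrict_space lebesgue {0..})
            (\<lambda>x. ennreal ((2*pi) powr (a+1) * x powr (2*a+1)))"

definition memL2 :: "real measure \<Rightarrow> (real \<Rightarrow> complex) \<Rightarrow> bool" where
  "memL2 M f \<longleftrightarrow> f \<in> borel_measurable M \<and> (\<integral>\<^sup>+x. ennreal ((norm (f x))^2) \<partial>M) < \<infinity>"

definition L2norm_on :: "real measure \<Rightarrow> real set \<Rightarrow> (real \<Rightarrow> complex) \<Rightarrow> real" where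
  "L2norm_on M A f = sqrt (enn2real (\<integral>\<^sup>+x\<in>A. ennreal ((norm (f x))^2) \<partial>M))"

definition FB1 :: "real \<Rightarrow> (real \<Rightarrow> complex) \<Rightarrow> real \<Rightarrow> complex" where
  "FB1 a f y = (\<integral>x. f x * complex_of_real (bessel_j a (2*pi*x*y)) \<partial>(mu a))"

text \<open>Unitary L^2 extension: g is the L^2 Fourier-Bessel transform of f iff g is the
  L^2_alpha-limit of the transforms of the truncations f * 1_[0,n] (which lie in L^1_alpha \<inter> L^2_alpha).\<close>
definition FB2 :: "real \<Rightarrow> (real \<Rightarrow> complex) \<Rightarrow> (real \<Rightarrow> complex) \<Rightarrow> bool" where
  "FB2 a f g \<longleftrightarrow> memL2 (mu a) g \<and>
     ((\<lambda>n::nat. \<integral>\<^sup>+y. ennreal ((norm (FB1 a (\<lambda>x. indicator {0..real n} x * f x) y - g y))^2) \<partial>(mu a))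
        \<longlonglongrightarrow> 0)"

end

theory Submission
  imports Defs
begin

text \<open>
  Multiplication by the square root of the density of \<open>mu a\<close> turns the Fourier--Bessel transform into
  the integral operator \<open>hankel a\<close> on \<open>L\<^sup>2({0..})\<close> with kernel \<open>hankel_kernel a (x * y)\<close>. An energy
  estimate for the Bessel equation shows that this kernel is bounded, so that the operator
  compressed to sets of finite Lebesgue measure is Hilbert--Schmidt. Gaussians are mapped to
  Gaussians; comparing their inner products gives the isometry on their span, and by density on
  all of \<open>L\<^sup>2\<close>.

  If some nonzero \<open>u\<close> lived on \<open>S\<close> with transform on \<open>\<Sigma>\<close>, then adjoining dilates of \<open>u\<close> by factors
  close to \<open>1\<close> (after Amrein and Berthier) would give arbitrarily many independent functions of this
  kind on sets of almost the same measure, contradicting the Hilbert--Schmidt bound on their number.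
  The quantitative estimate follows by compactness: the operator is a small perturbation of a finite
  rank one, so almost extremal sequences converge to such a \<open>u\<close>.
\<close>

section \<open>Hilbert space lemmas\<close>

text \<open>The hypotheses use Lebesgue measure while the transform lives on \<open>mu a\<close>,
  and a set of finite Lebesgue measure can have infinite \<open>mu a\<close> measure. This mismatch
  is the reason for moving the weight into the functions: with a bounded kernel, Lebesgue measure is
  the natural one on both sides. For the Fourier transform, Amrein and Berthier take translates,
  which leave the support of the transform alone. The present kernel has no such symmetry. It
  depends on the product \<open>x * y\<close> only, so dilations are available instead, and they act
  on the two supports in opposite directions. Hence both sets have to be enlarged, and linear
  independence is read off the supports on the function side. The kernel is real, so a real Hilbert
  space suffices; complex functions are split into real and imaginary parts at the end, at the price
  of a factor 2. The final compactness argument is by contradiction, so no explicit constant comes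
  out.\<close>

definition orthonormal :: "'a::real_inner set \<Rightarrow> bool" where
  "orthonormal B \<longleftrightarrow> pairwise orthogonal B \<and> (\<forall>b\<in>B. norm b = 1)"

lemma orthonormal_inner:
  "orthonormal B \<Longrightarrow> b \<in> B \<Longrightarrow> c \<in> B \<Longrightarrow> inner b c = (if b = c then 1 else 0)"
  by (auto simp: orthonormal_def pairwise_def orthogonal_def norm_eq_1)

lemma orthonormal_coefficient:
  assumes "finite B" "orthonormal B" "b \<in> B"
  shows "inner b (\<Sum>c\<in>B. k c *\<^sub>R c) = k b"
proof -
  have "inner b (\<Sum>c\<in>B. k c *\<^sub>R c) = (\<Sum>c\<in>B. k c * inner b c)"
    by (simp add: inner_sum_right)
  also have "\<dots> = (\<Sum>c\<in>B. if b = c then k c else 0)"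
    by (intro sum.cong refl) (simp add: orthonormal_inner[OF assms(2,3)])
  finally show ?thesis using assms by simp
qed

lemma bessel_inequality:
  assumes B: "finite B" "orthonormal B"
  shows "(norm (x - (\<Sum>b\<in>B. inner b x *\<^sub>R b)))\<^sup>2 = (norm x)\<^sup>2 - (\<Sum>b\<in>B. (inner b x)\<^sup>2)"
    and "(\<Sum>b\<in>B. (inner b x)\<^sup>2) \<le> (norm x)\<^sup>2"
proof -
  define p where "p = (\<Sum>b\<in>B. inner b x *\<^sub>R b)"
  have bp: "inner b p = inner b x" if "b \<in> B" for b
    unfolding p_def by (rule orthonormal_coefficient[OF B that])
  have "inner x p = (\<Sum>b\<in>B. (inner b x)\<^sup>2)"
    by (simp add: p_def inner_sum_right power2_eq_square inner_commute)
  moreover have "inner p p = (\<Sum>b\<in>B. (inner b x)\<^sup>2)"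
  proof -
    have "inner p p = (\<Sum>b\<in>B. inner b x * inner b p)" by (subst (1) p_def) (simp add: inner_sum_left)
    thus ?thesis by (simp add: bp power2_eq_square)
  qed
  ultimately show e: "(norm (x - (\<Sum>b\<in>B. inner b x *\<^sub>R b)))\<^sup>2 = (norm x)\<^sup>2 - (\<Sum>b\<in>B. (inner b x)\<^sup>2)"
    unfolding p_def[symmetric] by (simp add: power2_norm_eq_inner inner_diff_left inner_diff_right inner_commute)
  have "0 \<le> (norm (x - (\<Sum>b\<in>B. inner b x *\<^sub>R b)))\<^sup>2" by simp
  thus "(\<Sum>b\<in>B. (inner b x)\<^sup>2) \<le> (norm x)\<^sup>2" unfolding e by simp
qed

text \<open>Gram-Schmidt gives an orthogonal spanning family not known to be free of 0, so 0 is
  dropped before normalising. Different orthogonal nonzero vectors cannot have the same unit vector,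
  so normalising loses no element and the dimension can be counted with orthonormal vectors.\<close>

lemma orthonormal_in_span:
  fixes B :: "'a::real_inner set"
  assumes "finite B" "independent B"
  obtains C where "finite C" "orthonormal C" "card B \<le> card C" "C \<subseteq> span B"
proof -
  obtain C where C: "finite C" "span C = span B" "pairwise orthogonal C"
    using basis_orthogonal[OF assms(1)] by blast
  define D where "D = C - {0}"
  define N where "N = (\<lambda>x::'a. x /\<^sub>R norm x) ` D"
  have "B \<subseteq> span D" using C(2) span_superset[of B] by (auto simp: D_def span_delete_0)
  hence "card B \<le> card D"
    using independent_span_bound[of D B] assms C(1) by (auto simp: D_def)
  have orth: "orthogonal x y" if "x \<in> D" "y \<in> D" "x \<noteq> y" for x y
    using C(3) that by (auto simp: pairwise_def D_def)
  have inj: "inj_on (\<lambda>x::'a. x /\<^sub>R norm x) D"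
  proof (rule inj_onI, rule ccontr)
    fix x y assume xy: "x \<in> D" "y \<in> D" "x /\<^sub>R norm x = y /\<^sub>R norm y" "x \<noteq> y"
    have "norm (x /\<^sub>R norm x) = 1" using xy(1) by (simp add: D_def)
    hence "inner (x /\<^sub>R norm x) (x /\<^sub>R norm x) = 1" unfolding norm_eq_1 .
    hence one: "inner (x /\<^sub>R norm x) (y /\<^sub>R norm y) = 1" unfolding xy(3) .
    have zero: "inner (x /\<^sub>R norm x) (y /\<^sub>R norm y) = 0"
      using orth[OF xy(1,2,4)] by (simp add: orthogonal_def)
    have "(1::real) = 0" by (rule trans[OF one[symmetric] zero])
    thus False by simp
  qed
  show ?thesis
  proof
    show "finite N" using C(1) by (simp add: N_def D_def)
    show "card B \<le> card N" unfolding N_def card_image[OF inj] by fact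
    show "orthonormal N" unfolding orthonormal_def
    proof
      show "\<forall>b\<in>N. norm b = 1" by (auto simp: N_def D_def)
      show "pairwise orthogonal N"
        unfolding N_def pairwise_def using orth by (auto simp: orthogonal_def)
    qed
    show "N \<subseteq> span B"
      using C(2) unfolding N_def D_def by (auto intro!: span_scale simp: span_base)
  qed
qed

text \<open>This is the form in which compactness of a Hilbert-Schmidt operator is used. If no
  \<open>B\<close> worked, orthonormal families could be extended greedily by unit vectors on which
  \<open>T\<close> has norm at least \<open>e\<close>, and \<open>n\<close> of them would push the
  sum above \<open>K\<close> as soon as \<open>n * e^2 > K\<close>.\<close>

lemma small_on_finite_codimension:
  fixes T :: "'a::real_inner \<Rightarrow> 'b::real_normed_vector"
  assumes T: "linear T" and V: "subspace V"
    and HS: "\<And>B. finite B \<Longrightarrow> orthonormal B \<Longrightarrow> B \<subseteq> V \<Longrightarrow> (\<Sum>b\<in>B. (norm (T b))\<^sup>2) \<le> K"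
    and e: "e > 0"
  obtains B where "finite B" "orthonormal B" "B \<subseteq> V"
    "\<And>v. v \<in> V \<Longrightarrow> (\<And>b. b \<in> B \<Longrightarrow> inner b v = 0) \<Longrightarrow> norm (T v) \<le> e * norm v"
proof (rule ccontr)
  note basis = that
  assume no: "\<not> thesis"
  have step: "\<exists>v\<in>V. (\<forall>b\<in>B. inner b v = 0) \<and> norm (T v) > e * norm v"
    if "finite B" "orthonormal B" "B \<subseteq> V" for B
    using that basis[of B] no by (meson not_le)
  have "\<exists>B. finite B \<and> orthonormal B \<and> B \<subseteq> V \<and> card B = n \<and> (\<forall>b\<in>B. norm (T b) \<ge> e)" for n
  proof (induction n)
    case 0
    show ?case by (intro exI[of _ "{}"]) (auto simp: orthonormal_def)
  next
    case (Suc n)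
    then obtain B where B: "finite B" "orthonormal B" "B \<subseteq> V" "card B = n" "\<forall>b\<in>B. norm (T b) \<ge> e"
      by blast
    obtain v where v: "v \<in> V" "\<And>b. b \<in> B \<Longrightarrow> inner b v = 0" "norm (T v) > e * norm v"
      using step[OF B(1-3)] by blast
    have "v \<noteq> 0" using v(3) linear_0[OF T] by auto
    define u where "u = v /\<^sub>R norm v"
    have u: "u \<in> V" "\<And>b. b \<in> B \<Longrightarrow> inner b u = 0" "norm u = 1"
      using v \<open>v \<noteq> 0\<close> V by (auto simp: u_def subspace_scale)
    have "norm (T u) = norm (T v) / norm v"
      by (simp add: u_def linear_scale[OF T] divide_inverse mult.commute)
    hence Tu: "norm (T u) \<ge> e" using v(3) \<open>v \<noteq> 0\<close> by (simp add: pos_le_divide_eq)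
    have "u \<notin> B" using u by (metis norm_eq_zero inner_eq_zero_iff zero_neq_one)
    moreover have "orthonormal (insert u B)"
      using B(2) u unfolding orthonormal_def
      by (auto intro!: pairwise_orthogonal_insert simp: orthogonal_def inner_commute)
    ultimately show ?case using B u Tu by (intro exI[of _ "insert u B"]) auto
  qed
  moreover obtain n :: nat where n: "real n * e\<^sup>2 > K"
    using reals_Archimedean3[of "e\<^sup>2"] e by auto
  ultimately obtain B where B: "finite B" "orthonormal B" "B \<subseteq> V" "card B = n" "\<forall>b\<in>B. norm (T b) \<ge> e"
    by blast
  have "real n * e\<^sup>2 = (\<Sum>b\<in>B. e\<^sup>2)" using B by simp
  also have "\<dots> \<le> (\<Sum>b\<in>B. (norm (T b))\<^sup>2)" using B e by (intro sum_mono power_mono) auto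
  also have "\<dots> \<le> K" by (rule HS[OF B(1-3)])
  finally show False using n by simp
qed

lemma bounded_family_convergent_subseq:
  fixes c :: "'i \<Rightarrow> nat \<Rightarrow> real"
  assumes "finite B" "\<And>b. b \<in> B \<Longrightarrow> bounded (range (c b))"
  shows "\<exists>r. strict_mono r \<and> (\<forall>b\<in>B. convergent (c b \<circ> r))"
  using assms
proof (induction B rule: finite_induct)
  case empty
  show ?case by (intro exI[of _ id]) (auto simp: strict_mono_def)
next
  case (insert b B)
  then obtain r where r: "strict_mono r" "\<forall>b\<in>B. convergent (c b \<circ> r)" by blast
  have "bounded (range (c b \<circ> r))"
    by (rule bounded_subset[of "range (c b)"]) (use insert.prems in auto)
  then obtain l s where s: "strict_mono s" "(c b \<circ> r \<circ> s) \<longlonglongrightarrow> l"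
    using bounded_imp_convergent_subsequence by blast
  have "convergent (c b' \<circ> (r \<circ> s))" if "b' \<in> insert b B" for b'
    using that s r(2) convergent_subseq_convergent[of "c b' \<circ> r" s]
    by (auto simp: convergent_def o_assoc)
  thus ?case using strict_mono_o[OF r(1) s(1)] by blast
qed

text \<open>Otherwise there are unit vectors in \<open>V\<close> on which \<open>F - T\<close> tends
  to 0. Off a finite-dimensional space \<open>T\<close> halves norms while \<open>F\<close>
  preserves them, so along a subsequence whose finitely many coordinates converge the vectors form a
  Cauchy sequence. The limit is a unit vector of \<open>V\<close> on which \<open>F\<close> and
  \<open>T\<close> agree.\<close>

lemma coercive_of_weakly_annihilating:
  fixes F T :: "'a::{real_inner, complete_space} \<Rightarrow> 'b::real_normed_vector"
  assumes F: "bounded_linear F" "\<And>x. norm (F x) = norm x" and T: "bounded_linear T"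
    and V: "subspace V" "closed V"
    and HS: "\<And>B. finite B \<Longrightarrow> orthonormal B \<Longrightarrow> B \<subseteq> V \<Longrightarrow> (\<Sum>b\<in>B. (norm (T b))\<^sup>2) \<le> K"
    and weak: "\<And>u. u \<in> V \<Longrightarrow> F u = T u \<Longrightarrow> u = 0"
  obtains C where "C \<ge> 0" "\<And>u. u \<in> V \<Longrightarrow> norm u \<le> C * norm (F u - T u)"
proof (rule ccontr)
  note bound = that
  assume no: "\<not> thesis"
  interpret F: bounded_linear F by fact
  interpret T: bounded_linear T by fact
  have "\<exists>u. u \<in> V \<and> norm u = 1 \<and> norm (F u - T u) \<le> 1 / real (Suc n)" for n
  proof -
    obtain u where u: "u \<in> V" "norm u > real (Suc n) * norm (F u - T u)"
      using no bound[of "real (Suc n)"] by (force simp: not_le)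
    hence u0: "norm u > 0" by (smt (verit) mult_nonneg_nonneg norm_ge_zero of_nat_0_le_iff)
    have "F (u /\<^sub>R norm u) - T (u /\<^sub>R norm u) = (F u - T u) /\<^sub>R norm u"
      by (simp add: F.scaleR T.scaleR scaleR_diff_right)
    hence "norm (F (u /\<^sub>R norm u) - T (u /\<^sub>R norm u)) = norm (F u - T u) / norm u"
      using u0 by (simp add: divide_inverse mult.commute)
    also have "\<dots> \<le> 1 / real (Suc n)" using u u0 by (simp add: field_simps)
    finally show ?thesis using u u0 V(1)
      by (intro exI[of _ "u /\<^sub>R norm u"]) (auto simp: subspace_scale)
  qed
  then obtain u where u: "\<And>n. u n \<in> V" "\<And>n. norm (u n) = 1"
    "\<And>n. norm (F (u n) - T (u n)) \<le> 1 / real (Suc n)" by metis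
  \<comment> \<open>A factor below 1 is what matters: in \<open>est\<close> the term
    \<open>T (z - p z)\<close> is then absorbed into \<open>norm z\<close>, which produces the
    leading 2 there.\<close>
  have "\<exists>B. finite B \<and> orthonormal B \<and> B \<subseteq> V \<and>
      (\<forall>v\<in>V. (\<forall>b\<in>B. inner b v = 0) \<longrightarrow> norm (T v) \<le> 1/2 * norm v)"
    by (rule small_on_finite_codimension[OF T.linear V(1), of K "1/2"]) (use HS in auto)
  then obtain B where B: "finite B" "orthonormal B" "B \<subseteq> V" and
    small: "\<And>v. v \<in> V \<Longrightarrow> (\<And>b. b \<in> B \<Longrightarrow> inner b v = 0) \<Longrightarrow> norm (T v) \<le> 1/2 * norm v"
    by metis
  have "bounded (range (\<lambda>n. inner b (u n)))" if "b \<in> B" for b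
  proof -
    have "\<bar>inner b (u n)\<bar> \<le> 1" for n
      using Cauchy_Schwarz_ineq2[of b "u n"] that B(2) u(2) by (simp add: orthonormal_def)
    thus ?thesis unfolding bounded_iff by (intro exI[of _ 1]) auto
  qed
  then obtain r where r: "strict_mono r" "\<And>b. b \<in> B \<Longrightarrow> convergent ((\<lambda>n. inner b (u n)) \<circ> r)"
    using bounded_family_convergent_subseq[OF B(1), of "\<lambda>b n. inner b (u n)"] by blast
  define p where "p = (\<lambda>x. \<Sum>b\<in>B. inner b x *\<^sub>R b)"
  have pV: "p x \<in> V" for x
    unfolding p_def using B(3) V(1) by (intro subspace_sum subspace_scale) auto
  have pdiff: "p (x - y) = p x - p y" for x y
    by (simp add: p_def inner_diff_right scaleR_diff_left sum_subtractf)
  have "convergent (\<lambda>n. p (u (r n)))"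
    unfolding p_def
  proof (intro convergent_sum)
    fix b assume "b \<in> B"
    then obtain l where "(\<lambda>n. inner b (u (r n))) \<longlonglongrightarrow> l"
      using r(2) by (auto simp: convergent_def o_def)
    from tendsto_scaleR[OF this tendsto_const[of b]]
    show "convergent (\<lambda>n. inner b (u (r n)) *\<^sub>R b)" by (auto simp: convergent_def)
  qed
  hence pC: "Cauchy (\<lambda>n. p (u (r n)))" by (rule convergent_Cauchy)
  obtain M where M: "M > 0" "\<And>x. norm (T x) \<le> norm x * M" using T.pos_bounded by blast
  have est: "norm (x - y) \<le> 2 * (norm (p x - p y) * M + (norm (F x - T x) + norm (F y - T y)))"
    if xy: "x \<in> V" "y \<in> V" for x y
  proof -
    define z where "z = x - y"
    have z: "z \<in> V" using xy V(1) by (simp add: z_def subspace_diff)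
    have "inner b (z - p z) = 0" if "b \<in> B" for b
      using orthonormal_coefficient[OF B(1,2) that] by (simp add: inner_diff_right p_def)
    hence "norm (T (z - p z)) \<le> 1/2 * norm (z - p z)"
      using z pV V(1) by (intro small) (auto simp: subspace_diff)
    also have "norm (z - p z) \<le> norm z"
    proof -
      have "0 \<le> (\<Sum>b\<in>B. (inner b z)\<^sup>2)" by (intro sum_nonneg) auto
      hence "(norm (z - p z))\<^sup>2 \<le> (norm z)\<^sup>2" using bessel_inequality(1)[OF B(1,2), of z] by (simp add: p_def)
      thus ?thesis by (rule power2_le_imp_le) simp
    qed
    finally have 1: "norm (T (z - p z)) \<le> 1/2 * norm z" by simp
    have "F z = (F x - T x) - (F y - T y) + (T (z - p z) + T (p z))"
      by (simp add: z_def F.diff T.diff)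
    hence "norm z = norm ((F x - T x) - (F y - T y) + (T (z - p z) + T (p z)))" using F(2)[of z] by simp
    also have "\<dots> \<le> norm ((F x - T x) - (F y - T y)) + norm (T (z - p z) + T (p z))"
      by (rule norm_triangle_ineq)
    also have "\<dots> \<le> (norm (F x - T x) + norm (F y - T y)) + (norm (T (z - p z)) + norm (T (p z)))"
      by (intro add_mono norm_triangle_ineq norm_triangle_ineq4)
    also have "\<dots> \<le> (norm (F x - T x) + norm (F y - T y)) + (1/2 * norm z + norm (p z) * M)"
      using 1 M(2)[of "p z"] by simp
    finally show ?thesis by (simp add: z_def pdiff)
  qed
  have "Cauchy (\<lambda>n. u (r n))"
  proof (rule metric_CauchyI)
    fix e :: real assume e: "e > 0"
    \<comment> \<open>The tolerances add up to \<open>2 * (e/4 + e/8 + e/8) = e\<close> in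
      \<open>est\<close>.\<close>
    obtain N1 where N1: "\<forall>m\<ge>N1. \<forall>n\<ge>N1. norm (p (u (r m)) - p (u (r n))) < e / (4 * M)"
      using CauchyD[OF pC, of "e / (4 * M)"] e M(1) by auto
    obtain N2 :: nat where N2: "real N2 > 8 / e" using reals_Archimedean2 by blast
    have d: "norm (F (u (r n)) - T (u (r n))) < e / 8" if "n \<ge> N2" for n
    proof -
      have "norm (F (u (r n)) - T (u (r n))) \<le> 1 / real (Suc (r n))" by (rule u(3))
      also have "\<dots> < e / 8"
      proof -
        have "real N2 \<le> real (Suc (r n))" using seq_suble[OF r(1), of n] that by simp
        hence "real (Suc (r n)) > 8 / e" using N2 by simp
        thus ?thesis using e by (simp add: field_simps)
      qed
      finally show ?thesis .
    qed
    have "dist (u (r m)) (u (r n)) < e" if "m \<ge> max N1 N2" "n \<ge> max N1 N2" for m n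
    proof -
      have "norm (p (u (r m)) - p (u (r n))) * M < e / (4 * M) * M"
        using N1 that M(1) by (intro mult_strict_right_mono) auto
      also have "\<dots> = e / 4" using M(1) by simp
      finally show ?thesis using est[OF u(1) u(1), of "r m" "r n"] d[of m] d[of n] that
        by (simp add: dist_norm)
    qed
    thus "\<exists>N. \<forall>m\<ge>N. \<forall>n\<ge>N. dist (u (r m)) (u (r n)) < e" by blast
  qed
  then obtain w where w: "(\<lambda>n. u (r n)) \<longlonglongrightarrow> w" by (auto simp: Cauchy_convergent_iff convergent_def)
  have "w \<in> V" using closed_sequentially[OF V(2) _ w] u(1) by blast
  have "norm w = 1" using LIMSEQ_unique[OF tendsto_norm[OF w]] u(2) by auto
  have "(\<lambda>n. F (u (r n)) - T (u (r n))) \<longlonglongrightarrow> F w - T w"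
    by (intro tendsto_diff F.tendsto T.tendsto w)
  moreover have "(\<lambda>n. F (u (r n)) - T (u (r n))) \<longlonglongrightarrow> 0"
  proof (rule Lim_null_comparison)
    show "\<forall>\<^sub>F n in sequentially. norm (F (u (r n)) - T (u (r n))) \<le> 1 / real (Suc (r n))"
      using u(3) by simp
    show "(\<lambda>n. 1 / real (Suc (r n))) \<longlonglongrightarrow> 0"
      using LIMSEQ_subseq_LIMSEQ[OF LIMSEQ_Suc[OF lim_1_over_n] r(1)] by (simp add: o_def)
  qed
  ultimately have "F w = T w" using LIMSEQ_unique by fastforce
  thus False using weak[OF \<open>w \<in> V\<close>] \<open>norm w = 1\<close> by auto
qed

section \<open>Decay of the Bessel function\<close>

text \<open>The coefficients with respect to powers of \<open>x^2\<close>. In that variable the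
  singular Bessel equation becomes a recurrence between consecutive coefficients.\<close>

definition bessel_coeff :: "real \<Rightarrow> nat \<Rightarrow> real" where
  "bessel_coeff a n = 2 powr (-a) * (-1)^n / (fact n * Gamma (real n + a + 1) * 4 ^ n)"

lemma bessel_coeff_Suc:
  assumes "a > -1"
  shows "(real n + 1) * (real n + a + 1) * bessel_coeff a (Suc n) = - bessel_coeff a n / 4"
proof -
  have pos: "real n + a + 1 > 0" using assms by simp
  have "Gamma (real (Suc n) + a + 1) = (real n + a + 1) * Gamma (real n + a + 1)"
  proof -
    have "real n + a + 1 \<notin> \<int>\<^sub>\<le>\<^sub>0" using pos by (auto elim!: nonpos_Ints_cases)
    from Gamma_plus1[OF this] show ?thesis by (simp add: add_ac)
  qed
  moreover have "Gamma (real n + a + 1) > 0" using pos by (intro Gamma_real_pos)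
  ultimately show ?thesis using pos unfolding bessel_coeff_def
    by (simp add: divide_simps)
qed

lemma summable_norm_bessel:
  assumes "a > -1"
  shows "summable (\<lambda>n. norm (bessel_coeff a n * z ^ n))"
proof -
  obtain N :: nat where N: "real N \<ge> \<bar>z\<bar> + 1 + \<bar>a\<bar>" using real_arch_simple by blast
  have "norm (norm (bessel_coeff a (Suc n) * z ^ Suc n)) \<le> (1/2) * norm (norm (bessel_coeff a n * z ^ n))"
    if n: "n \<ge> N" for n
  proof -
    define D where "D = 4 * ((real n + 1) * (real n + a + 1))"
    have nn: "real n \<ge> \<bar>z\<bar> + 1 + \<bar>a\<bar>" using N n by linarith
    have "1 * (\<bar>z\<bar> + 2) \<le> (real n + 1) * (real n + a + 1)"
      using nn by (intro mult_mono) auto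
    hence D: "D > 0" "\<bar>z\<bar> / D \<le> 1/2" unfolding D_def by (auto simp: divide_simps)
    have "bessel_coeff a (Suc n) = - bessel_coeff a n / D"
      using bessel_coeff_Suc[OF assms, of n] D unfolding D_def by (simp add: field_simps)
    hence "norm (bessel_coeff a (Suc n) * z ^ Suc n) = (\<bar>z\<bar> / D) * norm (bessel_coeff a n * z ^ n)"
      using D by (simp add: abs_mult power_abs)
    also have "\<dots> \<le> (1/2) * norm (bessel_coeff a n * z ^ n)"
      using D by (intro mult_right_mono) auto
    finally show ?thesis by simp
  qed
  thus ?thesis by (intro summable_ratio_test[of "1/2" N]) auto
qed

lemma summable_bessel: "a > -1 \<Longrightarrow> summable (\<lambda>n. bessel_coeff a n * z ^ n)"
  by (rule summable_norm_cancel[OF summable_norm_bessel])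

lemma bessel_j_series:
  "bessel_j a x = (\<Sum>n. bessel_coeff a n * (x\<^sup>2) ^ n)" if "a > -1"
proof -
  have e: "bessel_coeff a n * (x\<^sup>2) ^ n =
      2 powr (-a) * ((-1)^n / (fact n * Gamma (real n + a + 1)) * (x/2)^(2*n))" for n
    by (simp add: bessel_coeff_def power_divide power_mult)
  have "summable (\<lambda>n. 2 powr (-a) * ((-1)^n / (fact n * Gamma (real n + a + 1)) * (x/2)^(2*n)))"
    using summable_bessel[OF that, of "x\<^sup>2"] unfolding e .
  hence "summable (\<lambda>n. ((-1)^n / (fact n * Gamma (real n + a + 1)) * (x/2)^(2*n)))"
    by (subst (asm) summable_cmult_iff) auto
  thus ?thesis unfolding bessel_j_def e by (intro suminf_mult[symmetric])
qed

text \<open>With \<open>z = x^2\<close> the series is an entire function \<open>B\<close>, and the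
  recurrence \<open>bessel_coeff_Suc\<close> says \<open>z * B'' + (a + 1) * B' = - B / 4\<close>.
  The chain rule turns this into the Bessel equation for the normalized function.\<close>

lemma bessel_j_ode:
  assumes a: "a > -1"
  obtains j' j'' where
    "\<And>x. (bessel_j a has_real_derivative j' x) (at x)"
    "\<And>x. (j' has_real_derivative j'' x) (at x)"
    "\<And>x. x \<noteq> 0 \<Longrightarrow> j'' x = - ((2 * a + 1) / x) * j' x - bessel_j a x"
proof -
  define c where "c = bessel_coeff a"
  define B B1 B2 where "B = (\<lambda>z. \<Sum>n. c n * z ^ n)" and "B1 = (\<lambda>z. \<Sum>n. diffs c n * z ^ n)"
    and "B2 = (\<lambda>z. \<Sum>n. diffs (diffs c) n * z ^ n)"
  have s: "summable (\<lambda>n. c n * z ^ n)" for z :: real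
    using summable_bessel[OF a] by (simp add: c_def)
  have s1: "summable (\<lambda>n. diffs c n * z ^ n)" for z :: real
    by (rule termdiff_converges_all[OF s])
  have s2: "summable (\<lambda>n. diffs (diffs c) n * z ^ n)" for z :: real
    by (rule termdiff_converges_all[OF s1])
  have dB: "(B has_real_derivative B1 z) (at z)" for z
    unfolding B_def B1_def by (rule termdiffs_strong_converges_everywhere[OF s])
  have dB1: "(B1 has_real_derivative B2 z) (at z)" for z
    unfolding B1_def B2_def by (rule termdiffs_strong_converges_everywhere[OF s1])
  have ode: "z * B2 z + (a + 1) * B1 z = - B z / 4" for z
  proof -
    \<comment> \<open>Multiplication by \<open>z\<close> shifts the series of \<open>B2\<close> by
      one index; the missing term at index 0 vanishes because of the factor
      \<open>real n\<close>.\<close>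
    have "(\<lambda>n. real n * diffs c n * z ^ n) sums (z * B2 z)"
    proof -
      have "(\<lambda>n. z * (diffs (diffs c) n * z ^ n)) sums (z * B2 z)"
        unfolding B2_def by (intro sums_mult summable_sums s2)
      hence "(\<lambda>n. real (Suc n) * diffs c (Suc n) * z ^ Suc n) sums (z * B2 z)"
        by (simp add: diffs_def[of "diffs c"] algebra_simps)
      thus ?thesis by (subst (asm) sums_Suc_iff) simp
    qed
    moreover have "(\<lambda>n. (a + 1) * (diffs c n * z ^ n)) sums ((a + 1) * B1 z)"
      unfolding B1_def by (intro sums_mult summable_sums s1)
    ultimately have "(\<lambda>n. real n * diffs c n * z ^ n + (a + 1) * (diffs c n * z ^ n)) sums
        (z * B2 z + (a + 1) * B1 z)" by (rule sums_add)
    moreover have "real n * diffs c n * z ^ n + (a + 1) * (diffs c n * z ^ n) = (c n * z ^ n) * (-1/4)" for n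
    proof -
      have "(real n + a + 1) * diffs c n = - c n / 4"
        using bessel_coeff_Suc[OF a, of n] by (simp add: diffs_def c_def mult_ac add_ac)
      moreover have "real n * diffs c n * z ^ n + (a + 1) * (diffs c n * z ^ n) =
          ((real n + a + 1) * diffs c n) * z ^ n" by (simp add: algebra_simps)
      ultimately show ?thesis by simp
    qed
    moreover have "(\<lambda>n. (c n * z ^ n) * (-1/4)) sums (B z * (-1/4))"
      unfolding B_def by (intro sums_mult2 summable_sums s)
    ultimately show ?thesis using sums_unique2 by fastforce
  qed
  have jB: "bessel_j a = (\<lambda>x. B (x\<^sup>2))"
    using bessel_j_series[OF a] by (auto simp: B_def c_def)
  show ?thesis
  proof
    have sq: "((\<lambda>x::real. x\<^sup>2) has_real_derivative 2 * x) (at x)" for x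
      by (auto intro!: derivative_eq_intros)
    show "(bessel_j a has_real_derivative B1 (x\<^sup>2) * (2 * x)) (at x)" for x
      unfolding jB by (rule DERIV_chain2[OF dB sq])
    have "((\<lambda>x. B1 (x\<^sup>2)) has_real_derivative B2 (x\<^sup>2) * (2 * x)) (at x)" for x
      by (rule DERIV_chain2[OF dB1 sq])
    moreover have "((\<lambda>x::real. 2 * x) has_real_derivative 2) (at x)" for x
      by (auto intro!: derivative_eq_intros)
    ultimately show "((\<lambda>x. B1 (x\<^sup>2) * (2 * x)) has_real_derivative
        B2 (x\<^sup>2) * (2 * x) * (2 * x) + 2 * B1 (x\<^sup>2)) (at x)" for x
      by (rule DERIV_mult)
    fix x :: real assume "x \<noteq> 0"
    have o4: "4 * (x\<^sup>2 * B2 (x\<^sup>2) + (a + 1) * B1 (x\<^sup>2)) = - B (x\<^sup>2)"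
      using ode[of "x\<^sup>2"] by simp
    show "B2 (x\<^sup>2) * (2 * x) * (2 * x) + 2 * B1 (x\<^sup>2) = - ((2 * a + 1) / x) * (B1 (x\<^sup>2) * (2 * x)) - bessel_j a x"
    proof -
      have e: "- ((2 * a + 1) / x) * (B1 (x\<^sup>2) * (2 * x)) = - (4 * a + 2) * B1 (x\<^sup>2)"
        using \<open>x \<noteq> 0\<close> by (simp add: field_simps)
      show ?thesis unfolding jB e using o4 by (simp add: algebra_simps power2_eq_square)
    qed
  qed
qed

lemma continuous_on_bessel_j:
  assumes "a > -1" shows "continuous_on A (bessel_j a)"
proof -
  obtain j' where "\<And>x. (bessel_j a has_real_derivative j' x) (at x)"
    using bessel_j_ode[OF assms] by metis
  thus ?thesis by (intro continuous_at_imp_continuous_on ballI DERIV_isCont)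
qed

text \<open>The function \<open>w\<close> is \<open>sqrt x * J_a(x)\<close>. Removing the
  first-order term of the Bessel equation gives \<open>w'' = (q / x^2 - 1) * w\<close> with
  \<open>q = a^2 - 1/4\<close>, a perturbation of the harmonic oscillator that is integrable at
  infinity. Its energy therefore stays bounded on \<open>{1..}\<close>, and the rest is a compact
  interval.\<close>

lemma bessel_j_decay:
  assumes a: "a > -1/2"
  obtains C where "\<And>x. x \<ge> 0 \<Longrightarrow> \<bar>x powr (a + 1/2) * bessel_j a x\<bar> \<le> C"
proof -
  have a1: "a > -1" using a by simp
  obtain j' j'' where j: "\<And>x. (bessel_j a has_real_derivative j' x) (at x)"
    "\<And>x. (j' has_real_derivative j'' x) (at x)"
    "\<And>x. x \<noteq> 0 \<Longrightarrow> j'' x = - ((2 * a + 1) / x) * j' x - bessel_j a x"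
    by (rule bessel_j_ode[OF a1]) (use that in blast)
  define p where "p = a + 1/2"
  define q where "q = p * (p - 1)"
  define w where "w = (\<lambda>x. x powr p * bessel_j a x)"
  define w' where "w' = (\<lambda>x. p * x powr (p - 1) * bessel_j a x + x powr p * j' x)"
  have dw: "(w has_real_derivative w' x) (at x)" if "x > 0" for x
    unfolding w_def w'_def using that
    by (auto intro!: derivative_eq_intros j simp: algebra_simps)
  have dw': "(w' has_real_derivative (q / x\<^sup>2 - 1) * w x) (at x)" if "x > 0" for x
  proof -
    have e: "x powr (p - 1) = x powr p / x" "x powr (p - 2) = x powr p / x\<^sup>2"
      "x powr (p - 1 - 1) = x powr p / x\<^sup>2"
      using that by (simp_all add: powr_diff power2_eq_square)
    have j2: "j'' x = - (2 * p / x) * j' x - bessel_j a x"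
      using j(3)[of x] that by (simp add: p_def)
    have "((\<lambda>x. p * x powr (p - 1) * bessel_j a x) has_real_derivative
        p * ((p - 1) * x powr (p - 1 - 1)) * bessel_j a x + p * x powr (p - 1) * j' x) (at x)"
      using that by (auto intro!: derivative_eq_intros j)
    moreover have "((\<lambda>x. x powr p * j' x) has_real_derivative
        (p * x powr (p - 1)) * j' x + x powr p * j'' x) (at x)"
      using that by (auto intro!: derivative_eq_intros j)
    ultimately have "(w' has_real_derivative
        (p * ((p - 1) * x powr (p - 1 - 1)) * bessel_j a x + p * x powr (p - 1) * j' x) +
        ((p * x powr (p - 1)) * j' x + x powr p * j'' x)) (at x)"
      unfolding w'_def by (rule DERIV_add)
    moreover have "(p * ((p - 1) * x powr (p - 1 - 1)) * bessel_j a x + p * x powr (p - 1) * j' x) +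
        ((p * x powr (p - 1)) * j' x + x powr p * j'' x) = (q / x\<^sup>2 - 1) * w x"
      unfolding e j2 q_def w_def by (simp add: algebra_simps)
    ultimately show ?thesis by simp
  qed
  \<comment> \<open>The derivative of \<open>w^2 + w'^2\<close> is
    \<open>2 * q * w * w' / x^2\<close>, at most \<bar>q\<bar> / x^2 times the energy itself. The
    exponential is the integrating factor for that inequality and is at least 1.\<close>
  define E where "E = (\<lambda>x. ((w x)\<^sup>2 + (w' x)\<^sup>2) * exp (\<bar>q\<bar> / x))"
  have E1: "E x \<le> E 1" if "x \<ge> 1" for x
  proof (rule DERIV_nonpos_imp_nonincreasing[OF that])
    fix t :: real assume t: "1 \<le> t" "t \<le> x"
    define D where "D = (2 * w t * w' t * (q / t\<^sup>2) - \<bar>q\<bar> / t\<^sup>2 * ((w t)\<^sup>2 + (w' t)\<^sup>2)) * exp (\<bar>q\<bar> / t)"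
    have "((\<lambda>x. (w x)\<^sup>2 + (w' x)\<^sup>2) has_real_derivative
        2 * w t * w' t + 2 * w' t * ((q / t\<^sup>2 - 1) * w t)) (at t)"
      using t by (auto intro!: derivative_eq_intros dw dw')
    moreover have "((\<lambda>x. exp (\<bar>q\<bar> / x)) has_real_derivative exp (\<bar>q\<bar> / t) * (- \<bar>q\<bar> / t\<^sup>2)) (at t)"
      using t by (auto intro!: derivative_eq_intros simp: power2_eq_square)
    ultimately have "(E has_real_derivative
        (2 * w t * w' t + 2 * w' t * ((q / t\<^sup>2 - 1) * w t)) * exp (\<bar>q\<bar> / t) +
        (exp (\<bar>q\<bar> / t) * (- \<bar>q\<bar> / t\<^sup>2)) * ((w t)\<^sup>2 + (w' t)\<^sup>2)) (at t)"
      unfolding E_def by (rule DERIV_mult)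
    moreover have "(2 * w t * w' t + 2 * w' t * ((q / t\<^sup>2 - 1) * w t)) * exp (\<bar>q\<bar> / t) +
        (exp (\<bar>q\<bar> / t) * (- \<bar>q\<bar> / t\<^sup>2)) * ((w t)\<^sup>2 + (w' t)\<^sup>2) = D"
      unfolding D_def by (simp add: algebra_simps add_divide_distrib)
    ultimately have "(E has_real_derivative D) (at t)" by simp
    moreover have "D \<le> 0"
    proof -
      have "2 * w t * w' t * q \<le> \<bar>2 * w t * w' t\<bar> * \<bar>q\<bar>" by (metis abs_ge_self abs_mult)
      also have "\<dots> \<le> ((w t)\<^sup>2 + (w' t)\<^sup>2) * \<bar>q\<bar>"
        using sum_squares_bound[of "\<bar>w t\<bar>" "\<bar>w' t\<bar>"] by (intro mult_right_mono) (auto simp: abs_mult)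
      finally have "2 * w t * w' t * q / t\<^sup>2 \<le> ((w t)\<^sup>2 + (w' t)\<^sup>2) * \<bar>q\<bar> / t\<^sup>2"
        by (intro divide_right_mono) auto
      thus ?thesis unfolding D_def by (intro mult_nonpos_nonneg) (auto simp: algebra_simps add_divide_distrib)
    qed
    ultimately show "\<exists>y. (E has_real_derivative y) (at t) \<and> y \<le> 0" by blast
  qed
  hence far: "\<bar>w x\<bar> \<le> sqrt (E 1)" if "x \<ge> 1" for x
  proof -
    have "(w x)\<^sup>2 * 1 \<le> E x" unfolding E_def using that by (intro mult_mono) auto
    also have "\<dots> \<le> E 1" by (rule E1[OF that])
    finally show ?thesis using real_le_rsqrt[of "\<bar>w x\<bar>" "E 1"] by simp
  qed
  \<comment> \<open>Continuity at 0 holds because the exponent \<open>p = a + 1/2\<close> is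
    positive.\<close>
  have "continuous_on {0..1} w"
    unfolding w_def p_def using a
    by (intro continuous_intros continuous_on_bessel_j a1 continuous_on_powr') auto
  hence "bounded (w ` {0..1})" using compact_continuous_image compact_imp_bounded by blast
  then obtain K where K: "\<forall>x\<in>{0..1}. \<bar>w x\<bar> \<le> K"
    by (auto simp: bounded_iff)
  show ?thesis
  proof (rule that[of "max K (sqrt (E 1))"])
    fix x :: real assume "x \<ge> 0"
    thus "\<bar>x powr (a + 1/2) * bessel_j a x\<bar> \<le> max K (sqrt (E 1))"
      using K far[of x] by (fold p_def, cases "x \<le> 1") (auto simp: w_def le_max_iff_disj)
  qed
qed

section \<open>The Hilbert space of the half-line\<close>

abbreviation halfline :: "real measure" where
  "halfline \<equiv> lebesgue_on {0..}"

definition sq_int :: "(real \<Rightarrow> real) \<Rightarrow> bool" where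
  "sq_int f \<longleftrightarrow> f \<in> borel_measurable halfline \<and> integrable halfline (\<lambda>x. (f x)\<^sup>2)"

lemma sq_int_measurable [measurable_dest]: "sq_int f \<Longrightarrow> f \<in> borel_measurable halfline"
  by (simp add: sq_int_def)

lemma sq_int_mult_integrable:
  assumes "sq_int f" "sq_int g"
  shows "integrable halfline (\<lambda>x. f x * g x)"
proof (rule Bochner_Integration.integrable_bound)
  show "integrable halfline (\<lambda>x. (f x)\<^sup>2 + (g x)\<^sup>2)"
    using assms by (auto simp: sq_int_def)
  show "(\<lambda>x. f x * g x) \<in> borel_measurable halfline"
    using assms by (auto simp: sq_int_def)
  have "\<bar>f x * g x\<bar> \<le> (f x)\<^sup>2 + (g x)\<^sup>2" for x
    using sum_squares_bound[of "\<bar>f x\<bar>" "\<bar>g x\<bar>"] zero_le_mult_iff[of "\<bar>f x\<bar>" "\<bar>g x\<bar>"]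
    unfolding abs_mult power2_abs by linarith
  thus "AE x in halfline. norm (f x * g x) \<le> norm ((f x)\<^sup>2 + (g x)\<^sup>2)" by simp
qed

lemma sq_int_zero: "sq_int (\<lambda>x. 0)"
  by (simp add: sq_int_def)

lemma sq_int_scale:
  assumes "sq_int f" shows "sq_int (\<lambda>x. c * f x)"
  using assms by (auto simp: sq_int_def power_mult_distrib)

lemma sq_int_add:
  assumes "sq_int f" "sq_int g" shows "sq_int (\<lambda>x. f x + g x)"
  using assms sq_int_mult_integrable[OF assms] unfolding sq_int_def power2_sum
  by (auto simp: mult.assoc)

lemma sq_int_uminus: "sq_int f \<Longrightarrow> sq_int (\<lambda>x. - f x)"
  using sq_int_scale[of f "-1"] by simp

lemma sq_int_diff: "sq_int f \<Longrightarrow> sq_int g \<Longrightarrow> sq_int (\<lambda>x. f x - g x)"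
  using sq_int_add[of f "\<lambda>x. - g x"] sq_int_uminus[of g] by simp

lemma sq_int_sum: "(\<And>i. i \<in> I \<Longrightarrow> sq_int (f i)) \<Longrightarrow> sq_int (\<lambda>x. \<Sum>i\<in>I. f i x)"
  by (induction I rule: infinite_finite_induct) (auto simp: sq_int_zero intro!: sq_int_add)

lemma sq_int_bound:
  assumes "sq_int f" "g \<in> borel_measurable halfline" "AE x in halfline. \<bar>g x\<bar> \<le> \<bar>f x\<bar>"
  shows "sq_int g"
proof -
  have "integrable halfline (\<lambda>x. (g x)\<^sup>2)"
  proof (rule Bochner_Integration.integrable_bound)
    show "integrable halfline (\<lambda>x. (f x)\<^sup>2)" using assms by (simp add: sq_int_def)
    show "AE x in halfline. norm ((g x)\<^sup>2) \<le> norm ((f x)\<^sup>2)"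
      using assms(3) by eventually_elim (simp add: abs_le_square_iff)
  qed (use assms in measurable)
  thus ?thesis using assms by (simp add: sq_int_def)
qed

lemma sq_int_indicator:
  assumes "sq_int f" "A \<in> sets lebesgue"
  shows "sq_int (\<lambda>x. indicator A x * f x)"
proof (rule sq_int_bound[OF assms(1)])
  have "indicator A \<in> borel_measurable halfline"
    using assms by (intro measurable_restrict_space1 borel_measurable_indicator)
  thus "(\<lambda>x. indicator A x * f x) \<in> borel_measurable halfline" using assms(1) by measurable
qed (auto simp: indicator_def)

lemma sq_int_cong_AE:
  assumes "sq_int f" "g \<in> borel_measurable halfline" "AE x in halfline. f x = g x"
  shows "sq_int g"
  by (rule sq_int_bound[OF assms(1,2)]) (use assms(3) in auto)

lemma sq_int_iff_nn:
  "sq_int f \<longleftrightarrow> f \<in> borel_measurable halfline \<and> (\<integral>\<^sup>+x. ennreal ((f x)\<^sup>2) \<partial>halfline) < \<infinity>"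
  by (auto simp: sq_int_def integrable_iff_bounded)

section \<open>Classes of square integrable functions as a complete inner product space\<close>

definition l2_rel :: "(real \<Rightarrow> real) \<Rightarrow> (real \<Rightarrow> real) \<Rightarrow> bool" where
  "l2_rel f g \<longleftrightarrow> sq_int f \<and> sq_int g \<and> (AE x in halfline. f x = g x)"

\<comment> \<open>A partial quotient: functions that are not square integrable represent no class,
  so every \<open>rep_l2 u\<close> is square integrable and facts about \<open>abs_l2 f\<close>
  carry the hypothesis \<open>sq_int f\<close>.\<close>
quotient_type l2 = "real \<Rightarrow> real" / partial: l2_rel
proof (rule part_equivpI)
  show "\<exists>f. l2_rel f f" using sq_int_zero by (auto simp: l2_rel_def)
  show "symp l2_rel" by (auto simp: symp_def l2_rel_def)
  show "transp l2_rel" unfolding transp_def l2_rel_def by (auto elim: AE_mp)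
qed

lift_definition l2_inner :: "l2 \<Rightarrow> l2 \<Rightarrow> real" is "\<lambda>f g. \<integral>x. f x * g x \<partial>halfline"
  unfolding l2_rel_def by (intro integral_cong_AE) (auto intro: AE_mp)

instantiation l2 :: real_inner
begin

lift_definition zero_l2 :: l2 is "\<lambda>x. 0"
  by (simp add: l2_rel_def sq_int_zero)
lift_definition plus_l2 :: "l2 \<Rightarrow> l2 \<Rightarrow> l2" is "\<lambda>f g x. f x + g x"
  unfolding l2_rel_def by (auto intro: sq_int_add)
lift_definition uminus_l2 :: "l2 \<Rightarrow> l2" is "\<lambda>f x. - f x"
  unfolding l2_rel_def by (auto intro: sq_int_uminus)
lift_definition minus_l2 :: "l2 \<Rightarrow> l2 \<Rightarrow> l2" is "\<lambda>f g x. f x - g x"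
  unfolding l2_rel_def by (auto intro: sq_int_diff)
lift_definition scaleR_l2 :: "real \<Rightarrow> l2 \<Rightarrow> l2" is "\<lambda>c f x. c * f x"
  unfolding l2_rel_def by (auto intro: sq_int_scale)
definition inner_l2 :: "l2 \<Rightarrow> l2 \<Rightarrow> real" where "inner_l2 = l2_inner"
definition norm_l2 :: "l2 \<Rightarrow> real" where "norm_l2 u = sqrt (l2_inner u u)"
definition dist_l2 :: "l2 \<Rightarrow> l2 \<Rightarrow> real" where "dist_l2 u v = norm (u - v)"
definition sgn_l2 :: "l2 \<Rightarrow> l2" where "sgn_l2 u = scaleR (inverse (norm u)) u"
definition uniformity_l2 :: "(l2 \<times> l2) filter" where
  "uniformity_l2 = (INF e\<in>{0 <..}. principal {(x, y). dist x y < e})"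
definition open_l2 :: "l2 set \<Rightarrow> bool" where
  "open_l2 U = (\<forall>x\<in>U. eventually (\<lambda>(x', y). x' = x \<longrightarrow> y \<in> U) uniformity)"

instance
proof
  fix u v w :: l2 and c d :: real and U :: "l2 set"
  show "dist u v = norm (u - v)" by (fact dist_l2_def)
  show "sgn u = scaleR (inverse (norm u)) u" by (fact sgn_l2_def)
  show "uniformity = (INF e\<in>{0 <..}. principal {(x, y::l2). dist x y < e})"
    by (fact uniformity_l2_def)
  show "open U = (\<forall>x\<in>U. eventually (\<lambda>(x', y). x' = x \<longrightarrow> y \<in> U) uniformity)"
    by (fact open_l2_def)
  show "norm u = sqrt (inner u u)" by (simp add: norm_l2_def inner_l2_def)
  show "u + v + w = u + (v + w)"
    by transfer (auto simp: l2_rel_def algebra_simps intro!: sq_int_add)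
  show "u + v = v + u"
    by transfer (auto simp: l2_rel_def algebra_simps intro!: sq_int_add)
  show "0 + u = u" by transfer (auto simp: l2_rel_def)
  show "- u + u = 0" by transfer (auto simp: l2_rel_def sq_int_zero)
  show "u - v = u + - v"
    by transfer (auto simp: l2_rel_def intro!: sq_int_diff)
  show "c *\<^sub>R (u + v) = c *\<^sub>R u + c *\<^sub>R v"
    by transfer (auto simp: l2_rel_def distrib_left intro!: sq_int_add sq_int_scale)
  show "(c + d) *\<^sub>R u = c *\<^sub>R u + d *\<^sub>R u"
    by transfer (auto simp: l2_rel_def distrib_right intro!: sq_int_add sq_int_scale)
  show "c *\<^sub>R d *\<^sub>R u = (c * d) *\<^sub>R u"
    by transfer (auto simp: l2_rel_def mult.assoc intro: sq_int_scale[of _ "_ * _", unfolded mult.assoc])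
  show "1 *\<^sub>R u = u" by transfer (auto simp: l2_rel_def)
  show "inner u v = inner v u" unfolding inner_l2_def by transfer (simp add: mult.commute)
  show "inner (u + v) w = inner u w + inner v w" unfolding inner_l2_def
    by transfer (auto simp: distrib_right l2_rel_def intro!: Bochner_Integration.integral_add sq_int_mult_integrable)
  show "inner (c *\<^sub>R u) v = c * inner u v" unfolding inner_l2_def
    by transfer (auto simp: mult.assoc)
  show "0 \<le> inner u u" unfolding inner_l2_def by transfer simp
  show "(inner u u = 0) = (u = 0)" unfolding inner_l2_def
  proof transfer
    fix f assume "l2_rel f f"
    hence f: "sq_int f" by (simp add: l2_rel_def)
    hence "((\<integral>x. f x * f x \<partial>halfline) = 0) = (AE x in halfline. f x * f x = 0)"
      by (intro integral_nonneg_eq_0_iff_AE sq_int_mult_integrable) auto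
    thus "((\<integral>x. f x * f x \<partial>halfline) = 0) = l2_rel f (\<lambda>x. 0)"
      using f by (simp add: l2_rel_def sq_int_zero)
  qed
qed

end

lemma sq_int_rep: "sq_int (rep_l2 u)"
  using Quotient3_rep_reflp[OF Quotient3_l2] by (simp add: l2_rel_def)

lemma abs_rep_l2 [simp]: "abs_l2 (rep_l2 u) = u"
  by (rule Quotient3_abs_rep[OF Quotient3_l2])

lemma l2_cases: obtains f where "sq_int f" "u = abs_l2 f"
  using sq_int_rep abs_rep_l2 by metis

lemma abs_l2_eq_iff: "sq_int f \<Longrightarrow> sq_int g \<Longrightarrow> abs_l2 f = abs_l2 g \<longleftrightarrow> (AE x in halfline. f x = g x)"
  using Quotient3_rel[OF Quotient3_l2, of f g] by (auto simp: l2_rel_def)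

lemma rep_abs_l2: "sq_int f \<Longrightarrow> AE x in halfline. rep_l2 (abs_l2 f) x = f x"
  using abs_l2_eq_iff[OF sq_int_rep, of f "abs_l2 f"] by simp

lemma l2_eqI: "AE x in halfline. rep_l2 u x = rep_l2 v x \<Longrightarrow> u = v"
  using abs_l2_eq_iff[OF sq_int_rep sq_int_rep, of u v] by simp

lemma abs_l2_add: "sq_int f \<Longrightarrow> sq_int g \<Longrightarrow> abs_l2 f + abs_l2 g = abs_l2 (\<lambda>x. f x + g x)"
  by (intro plus_l2.abs_eq) (auto simp: l2_rel_def)

lemma abs_l2_diff: "sq_int f \<Longrightarrow> sq_int g \<Longrightarrow> abs_l2 f - abs_l2 g = abs_l2 (\<lambda>x. f x - g x)"
  by (intro minus_l2.abs_eq) (auto simp: l2_rel_def)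

lemma abs_l2_scaleR: "sq_int f \<Longrightarrow> c *\<^sub>R abs_l2 f = abs_l2 (\<lambda>x. c * f x)"
  by (intro scaleR_l2.abs_eq) (auto simp: l2_rel_def)

lemma abs_l2_zero: "abs_l2 (\<lambda>x. 0) = 0"
  by (simp add: zero_l2_def)

lemma abs_l2_sum: "(\<And>i. i \<in> I \<Longrightarrow> sq_int (f i)) \<Longrightarrow> (\<Sum>i\<in>I. abs_l2 (f i)) = abs_l2 (\<lambda>x. \<Sum>i\<in>I. f i x)"
  by (induction I rule: infinite_finite_induct) (auto simp: abs_l2_zero abs_l2_add sq_int_sum)

lemma inner_abs_l2: "sq_int f \<Longrightarrow> sq_int g \<Longrightarrow> inner (abs_l2 f) (abs_l2 g) = (\<integral>x. f x * g x \<partial>halfline)"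
  unfolding inner_l2_def by (intro l2_inner.abs_eq) (auto simp: l2_rel_def)

lemma norm_abs_l2_sq: "sq_int f \<Longrightarrow> (norm (abs_l2 f))\<^sup>2 = (\<integral>x. (f x)\<^sup>2 \<partial>halfline)"
  by (simp add: power2_norm_eq_inner inner_abs_l2 power2_eq_square[of "f _"])

lemma nn_norm_abs_l2:
  assumes "sq_int f"
  shows "(\<integral>\<^sup>+x. ennreal ((f x)\<^sup>2) \<partial>halfline) = ennreal ((norm (abs_l2 f))\<^sup>2)"
  using assms by (subst nn_integral_eq_integral) (auto simp: norm_abs_l2_sq sq_int_def)

lemma rep_l2_zero: "AE x in halfline. rep_l2 0 x = 0"
  using rep_abs_l2[OF sq_int_zero] by (simp add: abs_l2_zero)

text \<open>Fatou's lemma turns a Cauchy condition and pointwise convergence into norm convergence.\<close>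

lemma l2_fatou:
  assumes f: "\<And>n. sq_int (f n)" and g: "g \<in> borel_measurable halfline"
    and lim: "AE x in halfline. (\<lambda>n. f n x) \<longlonglongrightarrow> g x"
    and cauchy: "\<And>n. n \<ge> N \<Longrightarrow> norm (abs_l2 (f n) - u) \<le> e"
  shows "sq_int g" "norm (abs_l2 g - u) \<le> e"
proof -
  define h where "h = rep_l2 u"
  have h: "sq_int h" "abs_l2 h = u" using sq_int_rep by (auto simp: h_def)
  have e: "e \<ge> 0" using cauchy[of N] norm_ge_zero order_trans by blast
  have [measurable]: "\<And>n. f n \<in> borel_measurable halfline" "h \<in> borel_measurable halfline"
    using f h by (auto simp: sq_int_def)
  note g [measurable]
  have "(\<integral>\<^sup>+x. ennreal ((g x - h x)\<^sup>2) \<partial>halfline) =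
      (\<integral>\<^sup>+x. liminf (\<lambda>n. ennreal ((f n x - h x)\<^sup>2)) \<partial>halfline)"
  proof (rule nn_integral_cong_AE, use lim in eventually_elim)
    fix x assume "(\<lambda>n. f n x) \<longlonglongrightarrow> g x"
    hence "(\<lambda>n. ennreal ((f n x - h x)\<^sup>2)) \<longlonglongrightarrow> ennreal ((g x - h x)\<^sup>2)"
      by (intro tendsto_intros)
    thus "ennreal ((g x - h x)\<^sup>2) = liminf (\<lambda>n. ennreal ((f n x - h x)\<^sup>2))"
      using lim_imp_Liminf trivial_limit_sequentially by metis
  qed
  also have "\<dots> \<le> liminf (\<lambda>n. \<integral>\<^sup>+x. ennreal ((f n x - h x)\<^sup>2) \<partial>halfline)"
    by (intro nn_integral_liminf) measurable
  also have "\<dots> \<le> limsup (\<lambda>n. \<integral>\<^sup>+x. ennreal ((f n x - h x)\<^sup>2) \<partial>halfline)"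
    by (intro Liminf_le_Limsup) simp
  also have "\<dots> \<le> ennreal (e\<^sup>2)"
  proof (rule Limsup_bounded, rule eventually_sequentiallyI)
    fix n assume "n \<ge> N"
    have "(\<integral>\<^sup>+x. ennreal ((f n x - h x)\<^sup>2) \<partial>halfline) = ennreal ((norm (abs_l2 (f n) - u))\<^sup>2)"
      using nn_norm_abs_l2[OF sq_int_diff[OF f h(1)]] abs_l2_diff[OF f h(1), of n] h(2) by simp
    also have "\<dots> \<le> ennreal (e\<^sup>2)"
      using cauchy[OF \<open>n \<ge> N\<close>] by (intro ennreal_leI power_mono) auto
    finally show "(\<integral>\<^sup>+x. ennreal ((f n x - h x)\<^sup>2) \<partial>halfline) \<le> ennreal (e\<^sup>2)" .
  qed
  finally have le: "(\<integral>\<^sup>+x. ennreal ((g x - h x)\<^sup>2) \<partial>halfline) \<le> ennreal (e\<^sup>2)" .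
  have "sq_int (\<lambda>x. g x - h x)"
    unfolding sq_int_iff_nn using le by (auto intro: le_less_trans)
  from sq_int_add[OF this h(1)] show G: "sq_int g" by simp
  have "ennreal ((norm (abs_l2 g - u))\<^sup>2) \<le> ennreal (e\<^sup>2)"
    using le nn_norm_abs_l2[OF sq_int_diff[OF G h(1)]] abs_l2_diff[OF G h(1)] h(2) by simp
  hence "(norm (abs_l2 g - u))\<^sup>2 \<le> e\<^sup>2" by simp
  thus "norm (abs_l2 g - u) \<le> e" using e power2_le_imp_le by blast
qed

text \<open>The half-line has infinite measure, so the increments need not be integrable. Their
  squares with weight \<open>2^n\<close> still have integrals at most \<open>2^n * 4^(-n)\<close>, a
  summable bound; hence the weighted squares are summable at almost every point, and this suffices
  for absolute summability of the increments.\<close>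

lemma l2_fast_cauchy_AE_convergent:
  assumes f: "\<And>n. sq_int (f n)" and fast: "\<And>n. norm (abs_l2 (f (Suc n)) - abs_l2 (f n)) \<le> (1/2) ^ n"
  shows "AE x in halfline. convergent (\<lambda>n. f n x)"
proof -
  have [measurable]: "\<And>n. f n \<in> borel_measurable halfline" using f by (auto simp: sq_int_def)
  have "(\<integral>\<^sup>+x. (\<Sum>n. ennreal (2 ^ n * (f (Suc n) x - f n x)\<^sup>2)) \<partial>halfline) =
      (\<Sum>n. \<integral>\<^sup>+x. ennreal (2 ^ n * (f (Suc n) x - f n x)\<^sup>2) \<partial>halfline)"
    by (intro nn_integral_suminf) measurable
  also have "\<dots> \<le> (\<Sum>n. ennreal ((1/2) ^ n))"
  proof (intro suminf_le allI)
    fix n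
    have "(\<integral>\<^sup>+x. ennreal (2 ^ n * (f (Suc n) x - f n x)\<^sup>2) \<partial>halfline) =
        ennreal (2 ^ n) * (\<integral>\<^sup>+x. ennreal ((f (Suc n) x - f n x)\<^sup>2) \<partial>halfline)"
      by (subst nn_integral_cmult[symmetric]) (auto simp: ennreal_mult)
    also have "\<dots> = ennreal (2 ^ n) * ennreal ((norm (abs_l2 (f (Suc n)) - abs_l2 (f n)))\<^sup>2)"
      using nn_norm_abs_l2[OF sq_int_diff[OF f f]] abs_l2_diff[OF f f] by simp
    also have "\<dots> = ennreal (2 ^ n * (norm (abs_l2 (f (Suc n)) - abs_l2 (f n)))\<^sup>2)"
      by (simp add: ennreal_mult)
    also have "\<dots> \<le> ennreal (2 ^ n * ((1/2) ^ n)\<^sup>2)"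
      using fast[of n] by (intro ennreal_leI mult_left_mono power_mono) auto
    also have "(2::real) ^ n * ((1/2) ^ n)\<^sup>2 = (1/2) ^ n"
      by (simp add: power2_eq_square power_one_over field_simps)
    finally show "(\<integral>\<^sup>+x. ennreal (2 ^ n * (f (Suc n) x - f n x)\<^sup>2) \<partial>halfline) \<le> ennreal ((1/2) ^ n)" .
  qed auto
  also have "\<dots> < \<infinity>"
    using summable_geometric[of "1/2::real"] by (subst suminf_ennreal2) auto
  finally have "AE x in halfline. (\<Sum>n. ennreal (2 ^ n * (f (Suc n) x - f n x)\<^sup>2)) \<noteq> \<infinity>"
    by (intro nn_integral_noteq_infinite) auto
  thus ?thesis
  proof eventually_elim
    fix x assume "(\<Sum>n. ennreal (2 ^ n * (f (Suc n) x - f n x)\<^sup>2)) \<noteq> \<infinity>"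
    hence s: "summable (\<lambda>n. 2 ^ n * (f (Suc n) x - f n x)\<^sup>2)"
      by (intro summable_suminf_not_top) (auto simp: top_ennreal_def)
    have "summable (\<lambda>n. norm (f (Suc n) x - f n x))"
    proof (rule summable_comparison_test')
      show "summable (\<lambda>n. (1/2::real) ^ n + 2 ^ n * (f (Suc n) x - f n x)\<^sup>2)"
        by (intro summable_add s summable_geometric) simp
      fix n
      define d where "d = \<bar>f (Suc n) x - f n x\<bar>"
      \<comment> \<open>Either \<open>d\<close> is at most the geometric term, or
        \<open>2^n * d > 1\<close> and \<open>d\<close> is dominated by its weighted square.\<close>
      have "d \<le> (1/2) ^ n + 2 ^ n * d\<^sup>2"
      proof (cases "2 ^ n * d \<le> 1")
        case True
        hence "d \<le> (1/2) ^ n" by (simp add: power_one_over field_simps)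
        moreover have "0 \<le> 2 ^ n * d\<^sup>2" by simp
        ultimately show ?thesis by linarith
      next
        case False
        hence "1 * d \<le> (2 ^ n * d) * d" by (intro mult_right_mono) (auto simp: d_def)
        thus ?thesis by (simp add: power2_eq_square mult.assoc add_increasing)
      qed
      thus "norm (norm (f (Suc n) x - f n x)) \<le> (1/2) ^ n + 2 ^ n * (f (Suc n) x - f n x)\<^sup>2"
        by (simp add: d_def)
    qed
    hence "summable (\<lambda>n. f (Suc n) x - f n x)" by (rule summable_norm_cancel)
    hence "convergent (\<lambda>n. \<Sum>i<n. f (Suc i) x - f i x)" by (simp add: summable_iff_convergent)
    hence "convergent (\<lambda>n. f n x - f 0 x)" using sum_lessThan_telescope[of "\<lambda>n. f n x"] by simp
    thus "convergent (\<lambda>n. f n x)" using convergent_diff_const_right_iff by blast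
  qed
qed

lemma Cauchy_fast_subseq:
  fixes X :: "nat \<Rightarrow> 'a::metric_space"
  assumes "Cauchy X"
  obtains r where "strict_mono r" "\<And>n. dist (X (r (Suc n))) (X (r n)) \<le> (1/2) ^ n"
proof -
  have "\<exists>r. \<forall>n. (\<forall>k\<ge>r n. \<forall>l\<ge>r n. dist (X k) (X l) < (1/2) ^ n) \<and> r n < r (Suc n)"
  proof (rule dependent_nat_choice)
    show "\<exists>m. \<forall>k\<ge>m. \<forall>l\<ge>m. dist (X k) (X l) < (1/2) ^ 0"
      using metric_CauchyD[OF assms, of 1] by auto
    fix m n
    obtain p where "\<forall>k\<ge>p. \<forall>l\<ge>p. dist (X k) (X l) < (1/2) ^ Suc n"
      using metric_CauchyD[OF assms, of "(1/2) ^ Suc n"] by auto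
    thus "\<exists>q. (\<forall>k\<ge>q. \<forall>l\<ge>q. dist (X k) (X l) < (1/2) ^ Suc n) \<and> m < q"
      by (intro exI[of _ "max p (Suc m)"]) auto
  qed
  then obtain r where r: "\<And>n k l. k \<ge> r n \<Longrightarrow> l \<ge> r n \<Longrightarrow> dist (X k) (X l) < (1/2) ^ n"
    "\<And>n. r n < r (Suc n)" by blast
  show ?thesis
  proof
    show "strict_mono r" using r(2) by (simp add: strict_mono_Suc_iff)
    show "dist (X (r (Suc n))) (X (r n)) \<le> (1/2) ^ n" for n
      using r(1)[of n "r (Suc n)" "r n"] r(2)[of n] by (simp add: less_imp_le)
  qed
qed

text \<open>Riesz-Fischer: a rapidly convergent subsequence has an almost everywhere limit, and
  Fatou, applied with a fixed late member \<open>X n\<close> in the role of \<open>u\<close>, bounds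
  the distance from that limit to \<open>X n\<close>. So the whole sequence converges, not just the
  subsequence.\<close>

instance l2 :: complete_space
proof
  fix X :: "nat \<Rightarrow> l2" assume X: "Cauchy X"
  obtain r where r: "strict_mono r" and fast: "\<And>n. dist (X (r (Suc n))) (X (r n)) \<le> (1/2) ^ n"
    using Cauchy_fast_subseq[OF X] by blast
  define f where "f = (\<lambda>n. rep_l2 (X (r n)))"
  have f: "sq_int (f n)" and absf: "abs_l2 (f n) = X (r n)" for n
    using sq_int_rep by (auto simp: f_def)
  have "AE x in halfline. convergent (\<lambda>n. f n x)"
    using fast by (intro l2_fast_cauchy_AE_convergent f) (simp add: absf dist_norm)
  hence lim: "AE x in halfline. (\<lambda>n. f n x) \<longlonglongrightarrow> lim (\<lambda>n. f n x)"
    by (simp add: convergent_LIMSEQ_iff)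
  define g where "g = (\<lambda>x. lim (\<lambda>n. f n x))"
  have [measurable]: "\<And>n. f n \<in> borel_measurable halfline" using f by (auto simp: sq_int_def)
  have g: "g \<in> borel_measurable halfline" unfolding g_def by measurable
  have "(\<lambda>n. X n) \<longlonglongrightarrow> abs_l2 g"
  proof (rule metric_LIMSEQ_I)
    fix e :: real assume "e > 0"
    then obtain N where N: "\<And>m n. m \<ge> N \<Longrightarrow> n \<ge> N \<Longrightarrow> dist (X m) (X n) < e / 2"
      using metric_CauchyD[OF X, of "e/2"] by auto
    have "dist (X n) (abs_l2 g) < e" if n: "n \<ge> N" for n
    proof -
      have "norm (abs_l2 g - X n) \<le> e / 2"
      proof (rule l2_fatou(2)[OF f g])
        show "AE x in halfline. (\<lambda>n. f n x) \<longlonglongrightarrow> g x" using lim by (simp add: g_def)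
        fix k assume "k \<ge> N"
        hence "r k \<ge> N" using seq_suble[OF r, of k] by linarith
        thus "norm (abs_l2 (f k) - X n) \<le> e / 2"
          using N[of "r k" n] n by (simp add: absf dist_norm)
      qed
      thus ?thesis using \<open>e > 0\<close> by (simp add: dist_norm norm_minus_commute)
    qed
    thus "\<exists>N. \<forall>n\<ge>N. dist (X n) (abs_l2 g) < e" by blast
  qed
  thus "convergent X" by (auto simp: convergent_def)
qed

section \<open>Gaussians under the Hankel transform\<close>

text \<open>In terms of the ordinary Bessel function this is
  \<open>2 * pi * sqrt t * J_a(2 * pi * t)\<close>, the kernel of the classical Hankel transform:
  the Fourier-Bessel kernel times the square roots of the density at both variables.\<close>

definition hankel_kernel :: "real \<Rightarrow> real \<Rightarrow> real" where
  "hankel_kernel a t = (2 * pi) powr (a + 1) * t powr (a + 1/2) * bessel_j a (2 * pi * t)"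

definition hankel :: "real \<Rightarrow> (real \<Rightarrow> real) \<Rightarrow> real \<Rightarrow> real" where
  "hankel a f y = (\<integral>x. f x * hankel_kernel a (x * y) \<partial>halfline)"

text \<open>Up to a constant factor, the Gaussian \<open>exp (- pi * t * x^2)\<close> multiplied by
  the square root of the density of \<open>mu a\<close>.\<close>

definition gauss :: "real \<Rightarrow> real \<Rightarrow> real \<Rightarrow> real" where
  "gauss a t x = x powr (a + 1/2) * exp (- (pi * t * x\<^sup>2))"

section \<open>Boundedness and continuity of the integral operator\<close>

lemma hankel_kernel_bounded:
  assumes "a > -1/2"
  obtains C where "C > 0" "\<And>t. t \<ge> 0 \<Longrightarrow> \<bar>hankel_kernel a t\<bar> \<le> C"
proof -
  obtain K where K: "\<And>x. x \<ge> 0 \<Longrightarrow> \<bar>x powr (a + 1/2) * bessel_j a x\<bar> \<le> K"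
    using bessel_j_decay[OF assms] by metis
  define L where "L = (2 * pi) powr (a + 1) / (2 * pi) powr (a + 1/2)"
  have L: "L > 0" by (simp add: L_def)
  have "K \<ge> 0" using K[of 0] by simp
  show ?thesis
  \<comment> \<open>The summand 1 makes the bound positive without further knowledge of
    \<open>K\<close>.\<close>
  proof (rule that[of "L * K + 1"])
    fix t :: real assume t: "t \<ge> 0"
    have "hankel_kernel a t = L * ((2 * pi * t) powr (a + 1/2) * bessel_j a (2 * pi * t))"
      using t by (simp add: hankel_kernel_def L_def powr_mult)
    hence "\<bar>hankel_kernel a t\<bar> = L * \<bar>(2 * pi * t) powr (a + 1/2) * bessel_j a (2 * pi * t)\<bar>"
      using L by (simp add: abs_mult)
    also have "\<dots> \<le> L * K" using L t by (intro mult_left_mono K) auto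
    finally show "\<bar>hankel_kernel a t\<bar> \<le> L * K + 1" by simp
  qed (use L \<open>K \<ge> 0\<close> in \<open>simp add: add_nonneg_pos\<close>)
qed

lemma continuous_on_hankel_kernel:
  assumes "a > -1/2" "continuous_on A f" "\<And>x. x \<in> A \<Longrightarrow> f x \<ge> 0"
  shows "continuous_on A (\<lambda>x. hankel_kernel a (f x))"
proof -
  have "continuous_on A (\<lambda>x. bessel_j a (2 * pi * f x))"
    using assms by (intro continuous_on_compose2[OF continuous_on_bessel_j[of a UNIV]] continuous_intros) auto
  thus ?thesis unfolding hankel_kernel_def using assms
    by (intro continuous_intros continuous_on_powr') auto
qed

lemma continuous_on_halfline_measurable:
  "continuous_on {0..} f \<Longrightarrow> f \<in> borel_measurable halfline" for f :: "real \<Rightarrow> real"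
  by (rule continuous_imp_measurable_on_sets_lebesgue) auto

lemma AE_halfline_nonneg: "AE x in halfline. x \<ge> 0"
  by (rule AE_I2) simp

lemma hankel_kernel_measurable:
  assumes "a > -1/2" "y \<ge> 0"
  shows "(\<lambda>x. hankel_kernel a (x * y)) \<in> borel_measurable halfline"
  using assms by (intro continuous_on_halfline_measurable continuous_on_hankel_kernel continuous_intros) auto

lemma hankel_integrable:
  assumes "a > -1/2" "y \<ge> 0" "integrable halfline f"
  shows "integrable halfline (\<lambda>x. f x * hankel_kernel a (x * y))"
proof -
  obtain C where C: "\<And>t. t \<ge> 0 \<Longrightarrow> \<bar>hankel_kernel a t\<bar> \<le> C"
    using hankel_kernel_bounded[OF assms(1)] by metis
  show ?thesis
  proof (rule Bochner_Integration.integrable_bound)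
    show "integrable halfline (\<lambda>x. C * f x)" using assms by simp
    show "(\<lambda>x. f x * hankel_kernel a (x * y)) \<in> borel_measurable halfline"
      using assms hankel_kernel_measurable[of a y] by measurable
    show "AE x in halfline. norm (f x * hankel_kernel a (x * y)) \<le> norm (C * f x)"
      using AE_halfline_nonneg
    proof eventually_elim
      fix x :: real assume "x \<ge> 0"
      thus "norm (f x * hankel_kernel a (x * y)) \<le> norm (C * f x)"
        using C[of "x * y"] assms(2) by (auto simp: abs_mult mult.commute[of C] intro!: mult_left_mono)
    qed
  qed
qed

lemma hankel_bound:
  assumes a: "a > -1/2" and C: "\<And>t. t \<ge> 0 \<Longrightarrow> \<bar>hankel_kernel a t\<bar> \<le> C"
    and f: "integrable halfline f" and y: "y \<ge> 0"
  shows "\<bar>hankel a f y\<bar> \<le> C * (\<integral>x. \<bar>f x\<bar> \<partial>halfline)"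
proof -
  have "\<bar>hankel a f y\<bar> \<le> (\<integral>x. C * \<bar>f x\<bar> \<partial>halfline)"
    unfolding hankel_def real_norm_def[symmetric]
  proof (rule Bochner_Integration.integral_norm_bound_integral)
    show "integrable halfline (\<lambda>x. f x * hankel_kernel a (x * y))"
      by (rule hankel_integrable[OF a y f])
    show "integrable halfline (\<lambda>x. C * norm (f x))" using f by simp
    fix x assume "x \<in> space halfline"
    thus "norm (f x * hankel_kernel a (x * y)) \<le> C * norm (f x)"
      using C[of "x * y"] y by (auto simp: abs_mult mult.commute[of C] intro!: mult_left_mono)
  qed
  thus ?thesis by simp
qed

lemma hankel_add:
  assumes "a > -1/2" "y \<ge> 0" "integrable halfline f" "integrable halfline g"
  shows "hankel a (\<lambda>x. f x + g x) y = hankel a f y + hankel a g y"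
  unfolding hankel_def
  using hankel_integrable[OF assms(1,2,3)] hankel_integrable[OF assms(1,2,4)]
  by (simp add: distrib_right)

lemma hankel_scale: "hankel a (\<lambda>x. c * f x) y = c * hankel a f y"
  unfolding hankel_def by (simp add: mult.assoc)

lemma hankel_diff:
  assumes "a > -1/2" "y \<ge> 0" "integrable halfline f" "integrable halfline g"
  shows "hankel a (\<lambda>x. f x - g x) y = hankel a f y - hankel a g y"
  using hankel_add[OF assms(1-3), of "\<lambda>x. (-1) * g x"] hankel_scale[of a "-1" g y] assms(4) by simp

lemma hankel_sum:
  assumes "a > -1/2" "y \<ge> 0" "\<And>i. i \<in> I \<Longrightarrow> integrable halfline (f i)"
  shows "hankel a (\<lambda>x. \<Sum>i\<in>I. f i x) y = (\<Sum>i\<in>I. hankel a (f i) y)"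
  unfolding hankel_def sum_distrib_right
  by (intro Bochner_Integration.integral_sum hankel_integrable assms)

text \<open>Dominated convergence with the bounded kernel. Continuity is wanted mainly because it
  makes transforms measurable.\<close>

lemma continuous_on_hankel:
  assumes a: "a > -1/2" and f: "integrable halfline f"
  shows "continuous_on {0..} (hankel a f)"
  unfolding continuous_on_sequentially
proof (intro ballI allI impI, elim conjE)
  fix y :: real and Y assume y: "y \<in> {0..}" and Y: "\<forall>n. Y n \<in> {0..}" "Y \<longlonglongrightarrow> y"
  obtain C where C: "\<And>t. t \<ge> 0 \<Longrightarrow> \<bar>hankel_kernel a t\<bar> \<le> C"
    using hankel_kernel_bounded[OF a] by metis
  have "(\<lambda>n. \<integral>x. f x * hankel_kernel a (x * Y n) \<partial>halfline) \<longlonglongrightarrow>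
      (\<integral>x. f x * hankel_kernel a (x * y) \<partial>halfline)"
  proof (rule integral_dominated_convergence[where w = "\<lambda>x. C * norm (f x)"])
    show "integrable halfline (\<lambda>x. C * norm (f x))" using f by simp
    show "(\<lambda>x. f x * hankel_kernel a (x * y)) \<in> borel_measurable halfline"
      "(\<lambda>x. f x * hankel_kernel a (x * Y n)) \<in> borel_measurable halfline" for n
      using hankel_integrable[OF a _ f] y Y(1) by (auto intro: borel_measurable_integrable)
    show "AE x in halfline. (\<lambda>n. f x * hankel_kernel a (x * Y n)) \<longlonglongrightarrow> f x * hankel_kernel a (x * y)"
      using AE_halfline_nonneg
    proof eventually_elim
      fix x :: real assume x: "x \<ge> 0"
      have "continuous_on {0..} (\<lambda>y. hankel_kernel a (x * y))"
        using a x by (intro continuous_on_hankel_kernel continuous_intros) auto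
      hence "((\<lambda>y. hankel_kernel a (x * y)) \<circ> Y) \<longlonglongrightarrow> hankel_kernel a (x * y)"
        using y Y unfolding continuous_on_sequentially by blast
      thus "(\<lambda>n. f x * hankel_kernel a (x * Y n)) \<longlonglongrightarrow> f x * hankel_kernel a (x * y)"
        by (intro tendsto_mult_left) (simp add: o_def)
    qed
    show "AE x in halfline. norm (f x * hankel_kernel a (x * Y n)) \<le> C * norm (f x)" for n
      using AE_halfline_nonneg
    proof eventually_elim
      fix x :: real assume "x \<ge> 0"
      thus "norm (f x * hankel_kernel a (x * Y n)) \<le> C * norm (f x)"
        using C[of "x * Y n"] Y(1) by (auto simp: abs_mult mult.commute[of C] intro!: mult_left_mono)
    qed
  qed
  thus "(hankel a f \<circ> Y) \<longlonglongrightarrow> hankel a f y" by (simp add: hankel_def o_def)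
qed

lemma hankel_measurable:
  "a > -1/2 \<Longrightarrow> integrable halfline f \<Longrightarrow> hankel a f \<in> borel_measurable halfline"
  by (intro continuous_on_halfline_measurable continuous_on_hankel)

text \<open>The substitution \<open>z = c * x^2\<close> in the Gamma integral at
  \<open>s = (p + 1) / 2\<close>. It is carried out on the open half-line, and the null set of the
  endpoint is put back afterwards.\<close>

lemma gauss_moment:
  assumes p: "p > -1" and c: "c > 0"
  shows "integrable halfline (\<lambda>x. x powr p * exp (- (c * x\<^sup>2)))" (is "integrable _ ?f")
    and "(\<integral>x. x powr p * exp (- (c * x\<^sup>2)) \<partial>halfline) = Gamma ((p + 1) / 2) / (2 * c powr ((p + 1) / 2))"
proof -
  define s where "s = (p + 1) / 2"
  have s: "s > 0" using p by (simp add: s_def)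
  let ?g = "\<lambda>z::real. z powr (s - 1) / exp z"
  have "(?g has_integral Gamma s) {0<..}"
    by (subst has_integral_spike_set_eq[of _ "{0..}"]) (use Gamma_integral_real[OF s] in \<open>auto intro: negligible_subset[of "{0}"]\<close>)
  hence abs: "?g absolutely_integrable_on {0<..}" "integral {0<..} ?g = Gamma s"
    by (auto simp: has_integral_iff intro!: nonnegative_absolutely_integrable_1)
  have im: "(\<lambda>x::real. c * x\<^sup>2) ` {0<..} = {0<..}"
  proof (intro equalityI subsetI)
    fix z :: real assume "z \<in> {0<..}"
    thus "z \<in> (\<lambda>x. c * x\<^sup>2) ` {0<..}"
      using c by (intro image_eqI[of _ _ "sqrt (z / c)"]) auto
  qed (use c in auto)
  have inj: "inj_on (\<lambda>x::real. c * x\<^sup>2) {0<..}"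
    using c by (auto simp: inj_on_def power2_eq_iff)
  have "(\<lambda>x. \<bar>2 * c * x\<bar> * ?g (c * x\<^sup>2)) absolutely_integrable_on {0<..} \<and>
      integral {0<..} (\<lambda>x. \<bar>2 * c * x\<bar> * ?g (c * x\<^sup>2)) = Gamma s"
    by (rule has_absolute_integral_change_of_variables_1'[THEN iffD2])
      (use abs inj im in \<open>auto intro!: derivative_eq_intros\<close>)
  moreover have e: "\<bar>2 * c * x\<bar> * ?g (c * x\<^sup>2) = (2 * c powr s) * ?f x" if "x \<in> {0<..}" for x
  proof -
    have x: "x > 0" using that by simp
    have "(x\<^sup>2) powr (s - 1) * x = x powr p"
    proof -
      have "(x\<^sup>2) powr (s - 1) * x = x powr (2 * (s - 1)) * x powr 1"
        using x by (simp add: powr_powr flip: powr_numeral)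
      also have "\<dots> = x powr p" unfolding powr_add[symmetric] by (simp add: s_def field_simps)
      finally show ?thesis .
    qed
    moreover have "c powr (s - 1) * c = c powr s" using c by (simp add: powr_diff)
    moreover have "\<bar>2 * c * x\<bar> * ?g (c * x\<^sup>2) =
        2 * (c powr (s - 1) * c) * ((x\<^sup>2) powr (s - 1) * x) * exp (- (c * x\<^sup>2))"
      using c x by (simp add: powr_mult exp_minus field_simps)
    ultimately show ?thesis by simp
  qed
  moreover have "((\<lambda>x. \<bar>2 * c * x\<bar> * ?g (c * x\<^sup>2)) absolutely_integrable_on {0<..}) =
      ((\<lambda>x. (2 * c powr s) * ?f x) absolutely_integrable_on {0<..})"
    by (rule set_integrable_cong[OF refl refl e])
  moreover have "integral {0<..} (\<lambda>x. \<bar>2 * c * x\<bar> * ?g (c * x\<^sup>2)) =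
      integral {0<..} (\<lambda>x. (2 * c powr s) * ?f x)"
    by (rule Henstock_Kurzweil_Integration.integral_cong[OF e])
  ultimately have "(\<lambda>x. (2 * c powr s) * ?f x) absolutely_integrable_on {0<..}"
    "integral {0<..} (\<lambda>x. (2 * c powr s) * ?f x) = Gamma s" by metis+
  moreover define k where "k = 2 * c powr s"
  moreover have k: "k \<noteq> 0" using c by (simp add: k_def)
  ultimately have g: "(\<lambda>x. k * ?f x) absolutely_integrable_on {0<..}" "k * integral {0<..} ?f = Gamma s"
    by (simp_all only: integral_mult_right)
  have f: "?f absolutely_integrable_on {0<..}" "integral {0<..} ?f = Gamma s / k"
    using g(1) set_integrable_mult_right_iff[OF k, of lebesgue "{0<..}" ?f] g(2) k
    by (auto simp: nonzero_eq_divide_eq mult.commute)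
  hence f0: "?f absolutely_integrable_on {0..}"
    by (subst absolutely_integrable_spike_set_eq[of _ "{0<..}"]) (auto intro: negligible_subset[of "{0}"])
  thus i: "integrable halfline ?f"
    by (simp add: set_integrable_def integrable_restrict_space)
  have "integral {0..} ?f = integral {0<..} ?f"
    by (rule integral_spike_set) (auto intro: negligible_subset[of "{0}"])
  thus "(\<integral>x. ?f x \<partial>halfline) = Gamma ((p + 1) / 2) / (2 * c powr ((p + 1) / 2))"
    using lebesgue_integral_eq_integral[OF i] f(2) by (simp add: s_def k_def)
qed

lemma gauss_mult:
  "gauss a s x * gauss a t x = x powr (2 * a + 1) * exp (- (pi * (s + t) * x\<^sup>2))" 
  unfolding gauss_def by (simp add: algebra_simps flip: exp_add powr_add)

lemma gauss_integrable: "a > -1/2 \<Longrightarrow> t > 0 \<Longrightarrow> integrable halfline (gauss a t)"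
  using gauss_moment(1)[of "a + 1/2" "pi * t"] by (simp add: gauss_def[abs_def])

lemma gauss_sq_int:
  assumes "a > -1/2" "t > 0" shows "sq_int (gauss a t)"
  using gauss_moment(1)[of "2 * a + 1" "pi * (t + t)"] assms gauss_integrable[OF assms]
  unfolding sq_int_def power2_eq_square gauss_mult by (auto simp: power2_eq_square)

lemma gauss_inner:
  assumes "a > -1/2" "s > 0" "t > 0"
  shows "inner (abs_l2 (gauss a s)) (abs_l2 (gauss a t)) =
    Gamma (a + 1) / (2 * (pi * (s + t)) powr (a + 1))"
  using gauss_moment(2)[of "2 * a + 1" "pi * (s + t)"] assms
  by (subst inner_abs_l2) (auto simp: gauss_sq_int gauss_mult add_divide_distrib add_ac)

text \<open>The Hankel transform of a Gaussian is computed by integrating the power series termwise.\<close>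

lemma hankel_gauss:
  assumes a: "a > -1/2" and t: "t > 0" and y: "y \<ge> 0"
  shows "hankel a (gauss a t) y = t powr (- a - 1) * gauss a (1 / t) y"
proof -
  define c where "c = bessel_coeff a"
  define A where "A = (2 * pi) powr (a + 1) * y powr (a + 1/2)"
  define z where "z = pi * y\<^sup>2 / t"
  define m where "m = (\<lambda>n x. x powr (2 * a + 1 + 2 * real n) * exp (- (pi * t * x\<^sup>2)))"
  define F where "F = (\<lambda>n x. A * (c n * (4 * pi\<^sup>2 * y\<^sup>2) ^ n * m n x))"
  define K where "K = A * (2 powr (-a) / (2 * (pi * t) powr (a + 1)))"
  have mi: "integrable halfline (m n)" for n
    unfolding m_def using a t by (intro gauss_moment) auto
  have mv: "(\<integral>x. m n x \<partial>halfline) = Gamma (real n + a + 1) / (2 * (pi * t) powr (a + 1) * (pi * t) ^ n)" for n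
  proof -
    have e: "(2 * a + 1 + 2 * real n + 1) / 2 = real n + a + 1" by simp
    have "(pi * t) powr (real n + a + 1) = (pi * t) powr (a + 1) * (pi * t) ^ n"
      using t powr_add[of "pi * t" "a + 1" "real n"] by (simp add: powr_realpow add_ac)
    thus ?thesis unfolding m_def using gauss_moment(2)[of "2 * a + 1 + 2 * real n" "pi * t"] a t
      unfolding e by simp
  qed
  have m0: "m n x = (x powr (a + 1/2) * x powr (a + 1/2)) * exp (- (pi * t * x\<^sup>2)) * x ^ (2 * n)"
    if "x \<ge> 0" for n x
  proof (cases "x = 0")
    case False
    hence x: "x > 0" using that by simp
    have "x powr (2 * a + 1 + real (2 * n)) = x powr (a + 1/2) * x powr (a + 1/2) * x powr (real (2 * n))"
      unfolding powr_add[symmetric] by (simp add: algebra_simps)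
    also have "x powr (real (2 * n)) = x ^ (2 * n)" using x by (rule powr_realpow)
    finally show ?thesis by (simp add: m_def mult_ac)
  qed (simp add: m_def)
  have F: "F n x = (A * (x powr (a + 1/2) * x powr (a + 1/2)) * exp (- (pi * t * x\<^sup>2))) * (c n * ((2 * pi * (x * y))\<^sup>2) ^ n)"
    if "x \<ge> 0" for n x
    unfolding F_def m0[OF that] by (simp add: power_mult_distrib mult_ac flip: power_mult)
  have Fsum: "(\<Sum>n. F n x) = gauss a t x * hankel_kernel a (x * y)" if "x \<ge> 0" for x
  proof -
    have "(\<Sum>n. F n x) = (A * (x powr (a + 1/2) * x powr (a + 1/2)) * exp (- (pi * t * x\<^sup>2))) * bessel_j a (2 * pi * (x * y))"
      using a unfolding F[OF that] c_def
      by (subst bessel_j_series, simp, intro suminf_mult summable_bessel) simp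
    also have "\<dots> = gauss a t x * hankel_kernel a (x * y)"
      using that y by (simp add: A_def gauss_def hankel_kernel_def powr_mult mult_ac)
    finally show ?thesis .
  qed
  \<comment> \<open>The Gamma value of the moment cancels the one in the Bessel coefficient, both
    being taken at \<open>real n + a + 1\<close>. What is left is the exponential series at
    \<open>- z\<close>.\<close>
  have cm: "c n * (4 * pi\<^sup>2 * y\<^sup>2) ^ n * (\<integral>x. m n x \<partial>halfline) =
      2 powr (-a) / (2 * (pi * t) powr (a + 1)) * ((- z) ^ n / fact n)" for n
  proof -
    have G: "Gamma (real n + a + 1) > 0" using a by (intro Gamma_real_pos) auto
    define X Y where "X = (4 * pi\<^sup>2 * y\<^sup>2) ^ n" and "Y = (pi * t) ^ n"
    have XY: "X / (4 ^ n * Y) = z ^ n"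
      using t unfolding X_def Y_def z_def power_mult_distrib[symmetric] power_divide[symmetric]
      by (simp add: power2_eq_square)
    have "Y \<noteq> 0" using t by (simp add: Y_def)
    hence "c n * X * (Gamma (real n + a + 1) / (2 * (pi * t) powr (a + 1) * Y)) =
        2 powr (-a) / (2 * (pi * t) powr (a + 1)) * ((-1) ^ n * (X / (4 ^ n * Y)) / fact n)"
      unfolding c_def bessel_coeff_def using G by (simp add: field_simps)
    thus ?thesis unfolding XY unfolding mv X_def Y_def by (simp add: power_minus[of z])
  qed
  have Fi: "integrable halfline (F n)" for n unfolding F_def using mi by simp
  have Fv: "(\<integral>x. F n x \<partial>halfline) = K * ((- z) ^ n / fact n)" for n
    unfolding F_def K_def using cm[of n] by simp
  have "(\<lambda>n. \<integral>x. F n x \<partial>halfline) sums (\<integral>x. (\<Sum>n. F n x) \<partial>halfline)"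
  proof (rule sums_integral)
    show "AE x in halfline. summable (\<lambda>n. norm (F n x))"
      using AE_halfline_nonneg
    proof eventually_elim
      fix x :: real assume x: "x \<ge> 0"
      show "summable (\<lambda>n. norm (F n x))"
        unfolding F[OF x] norm_mult[of "A * _ * _"] c_def using a
        by (intro summable_mult summable_norm_bessel) simp
    qed
    \<comment> \<open>Each \<open>F n\<close> has constant sign, so the integral of its absolute
      value is the absolute value of the integral already known. The majorant needed for termwise
      integration is thus the exponential series at \<open>z\<close>.\<close>
    have "(\<integral>x. norm (F n x) \<partial>halfline) = \<bar>K\<bar> * (z ^ n / fact n)" for n
    proof -
      have "(\<integral>x. norm (F n x) \<partial>halfline) = (\<integral>x. \<bar>A * (c n * (4 * pi\<^sup>2 * y\<^sup>2) ^ n)\<bar> * m n x \<partial>halfline)"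
        by (intro Bochner_Integration.integral_cong) (auto simp: F_def m_def abs_mult)
      also have "\<dots> = \<bar>A * (c n * (4 * pi\<^sup>2 * y\<^sup>2) ^ n)\<bar> * (\<integral>x. m n x \<partial>halfline)" by simp
      also have "\<dots> = \<bar>A * (c n * (4 * pi\<^sup>2 * y\<^sup>2) ^ n)\<bar> * \<bar>\<integral>x. m n x \<partial>halfline\<bar>"
      proof -
        have "(\<integral>x. m n x \<partial>halfline) \<ge> 0" by (intro Bochner_Integration.integral_nonneg) (simp add: m_def)
        thus ?thesis by simp
      qed
      also have "\<dots> = \<bar>\<integral>x. F n x \<partial>halfline\<bar>" unfolding F_def by (simp add: abs_mult)
      also have "\<dots> = \<bar>K\<bar> * (z ^ n / fact n)"
        using t unfolding Fv by (simp add: abs_mult z_def power_abs)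
      finally show ?thesis .
    qed
    thus "summable (\<lambda>n. \<integral>x. norm (F n x) \<partial>halfline)"
      using summable_exp[of z] by (simp add: divide_inverse mult.commute)
  qed (rule Fi)
  moreover have "(\<integral>x. (\<Sum>n. F n x) \<partial>halfline) = hankel a (gauss a t) y"
    unfolding hankel_def by (intro Bochner_Integration.integral_cong) (auto simp: Fsum)
  ultimately have S1: "(\<lambda>n. K * ((- z) ^ n / fact n)) sums hankel a (gauss a t) y"
    unfolding Fv by simp
  have S2: "(\<lambda>n. K * ((- z) ^ n / fact n)) sums (K * exp (- z))"
    using exp_converges[of "- z"] by (intro sums_mult) (simp add: divide_inverse mult.commute)
  have "hankel a (gauss a t) y = K * exp (- z)"
    by (rule sums_unique2[OF S1 S2])
  \<comment> \<open>Here the normalisations of \<open>mu a\<close> and \<open>bessel_j\<close> meet: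
    the powers of 2 and pi cancel completely, leaving the factor \<open>t powr (- a - 1)\<close>
    that the isometry needs.\<close>
  also have "K = t powr (- a - 1) * y powr (a + 1/2)"
  proof -
    have "(2 * pi) powr (a + 1) = 2 * 2 powr a * pi powr (a + 1)"
      by (simp add: powr_mult powr_add)
    moreover have "(2::real) powr a * 2 powr (-a) = 1" unfolding powr_add[symmetric] by simp
    ultimately have "(2 * pi) powr (a + 1) * 2 powr (-a) = 2 * pi powr (a + 1)"
      by (simp add: mult_ac) 
    moreover have "t powr (- a - 1) = 1 / t powr (a + 1)"
    proof -
      have "- a - 1 = - (a + 1)" by simp
      thus ?thesis by (simp only: powr_minus_divide)
    qed
    moreover have "K = ((2 * pi) powr (a + 1) * 2 powr (-a)) * y powr (a + 1/2) / (2 * (pi powr (a + 1) * t powr (a + 1)))"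
      using t by (simp add: K_def A_def powr_mult)
    ultimately show ?thesis by simp
  qed
  finally show ?thesis by (simp add: mult.assoc gauss_def[of _ "1 / t"] z_def)
qed

section \<open>Plancherel identity\<close>

lemma AE_halfline_iff: "(AE x in halfline. P x) \<longleftrightarrow> (AE x in lebesgue. x \<ge> 0 \<longrightarrow> P x)"
  by (subst AE_restrict_space_iff) auto

definition gauss_combination :: "real \<Rightarrow> (real \<Rightarrow> real) \<Rightarrow> bool" where
  "gauss_combination a f \<longleftrightarrow>
    (\<exists>I c. finite I \<and> I \<subseteq> {0<..} \<and> f = (\<lambda>x. \<Sum>t\<in>I. c t * gauss a t x))"

lemma gauss_combination_diff:
  assumes "gauss_combination a f" "gauss_combination a g"
  shows "gauss_combination a (\<lambda>x. f x - g x)"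
proof -
  obtain I c where I: "finite I" "I \<subseteq> {0<..}" "f = (\<lambda>x. \<Sum>t\<in>I. c t * gauss a t x)"
    using assms by (auto simp: gauss_combination_def)
  obtain J d where J: "finite J" "J \<subseteq> {0<..}" "g = (\<lambda>x. \<Sum>t\<in>J. d t * gauss a t x)"
    using assms by (auto simp: gauss_combination_def)
  define k where "k = (\<lambda>t. (if t \<in> I then c t else 0) - (if t \<in> J then d t else 0))"
  have "f x - g x = (\<Sum>t\<in>I \<union> J. k t * gauss a t x)" for x
  proof -
    have "f x = (\<Sum>t\<in>I \<union> J. (if t \<in> I then c t else 0) * gauss a t x)"
      unfolding I(3) using I(1) J(1) by (intro sum.mono_neutral_cong_left) auto
    moreover have "g x = (\<Sum>t\<in>I \<union> J. (if t \<in> J then d t else 0) * gauss a t x)"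
      unfolding J(3) using I(1) J(1) by (intro sum.mono_neutral_cong_left) auto
    ultimately show ?thesis by (simp add: k_def left_diff_distrib sum_subtractf)
  qed
  thus ?thesis using I(1,2) J(1,2) unfolding gauss_combination_def
    by (intro exI[of _ "I \<union> J"] exI[of _ k]) auto
qed

lemma gauss_combination_L1_L2:
  assumes "a > -1/2" "gauss_combination a f"
  shows "integrable halfline f" "sq_int f"
proof -
  obtain I c where I: "I \<subseteq> {0<..}" "f = (\<lambda>x. \<Sum>t\<in>I. c t * gauss a t x)"
    using assms(2) by (auto simp: gauss_combination_def)
  hence pos: "t > 0" if "t \<in> I" for t using that by auto
  show "integrable halfline f" unfolding I(2)
    by (intro Bochner_Integration.integrable_sum integrable_mult_right gauss_integrable assms(1) pos)
  show "sq_int f" unfolding I(2)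
    by (intro sq_int_sum sq_int_scale gauss_sq_int assms(1) pos)
qed

text \<open>Because \<open>1/s + 1/t = (s + t) / (s * t)\<close>, the prefactors compensate exactly.
  In view of \<open>hankel_gauss\<close>, the left side is the inner product of the transforms of
  the two Gaussians.\<close>

lemma inner_gauss_reciprocal:
  assumes "a > -1/2" "s > 0" "t > 0"
  shows "s powr (- a - 1) * (t powr (- a - 1) * inner (abs_l2 (gauss a (1 / s))) (abs_l2 (gauss a (1 / t)))) =
    inner (abs_l2 (gauss a s)) (abs_l2 (gauss a t))"
proof -
  have "(pi * (1 / s + 1 / t)) powr (a + 1) = (pi * (s + t) / (s * t)) powr (a + 1)"
    using assms by (simp add: field_simps)
  also have "\<dots> = (pi * (s + t)) powr (a + 1) / (s powr (a + 1) * t powr (a + 1))"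
    using assms by (simp add: powr_divide powr_mult)
  finally have e: "(pi * (1 / s + 1 / t)) powr (a + 1) = (pi * (s + t)) powr (a + 1) / (s powr (a + 1) * t powr (a + 1))" .
  have "- a - 1 = - (a + 1)" by simp
  hence m: "s powr (- a - 1) = 1 / s powr (a + 1)" "t powr (- a - 1) = 1 / t powr (a + 1)"
    by (simp_all only: powr_minus_divide)
  show ?thesis
    using assms by (simp add: gauss_inner e m)
qed

lemma hankel_isometry_gauss:
  assumes a: "a > -1/2" and f: "gauss_combination a f"
  shows "sq_int (hankel a f)" "norm (abs_l2 (hankel a f)) = norm (abs_l2 f)"
proof -
  obtain I c where I: "finite I" "I \<subseteq> {0<..}" and fI: "f = (\<lambda>x. \<Sum>t\<in>I. c t * gauss a t x)"
    using f by (auto simp: gauss_combination_def)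
  have pos: "t > 0" if "t \<in> I" for t using I(2) that by auto
  define g where "g = (\<lambda>y. \<Sum>t\<in>I. (c t * t powr (- a - 1)) * gauss a (1 / t) y)"
  have g: "sq_int g" unfolding g_def using a pos
    by (intro sq_int_sum sq_int_scale gauss_sq_int) auto
  have hg: "hankel a f y = g y" if "y \<ge> 0" for y
  proof -
    have "hankel a f y = (\<Sum>t\<in>I. hankel a (\<lambda>x. c t * gauss a t x) y)"
      unfolding fI using a that pos gauss_integrable by (intro hankel_sum) auto
    also have "\<dots> = g y" unfolding g_def hankel_scale
      using a pos that by (intro sum.cong) (auto simp: hankel_gauss)
    finally show ?thesis .
  qed
  have ae: "AE y in halfline. g y = hankel a f y" by (rule AE_I2) (simp add: hg)
  show sq: "sq_int (hankel a f)"
    by (rule sq_int_cong_AE[OF g _ ae]) (intro hankel_measurable a gauss_combination_L1_L2[OF a f])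
  have "abs_l2 (hankel a f) = abs_l2 g" using abs_l2_eq_iff[OF sq g] ae by (auto elim: AE_mp)
  also have "\<dots> = (\<Sum>t\<in>I. (c t * t powr (- a - 1)) *\<^sub>R abs_l2 (gauss a (1 / t)))"
    unfolding g_def using a pos
    by (subst abs_l2_sum[symmetric]) (auto intro!: sum.cong sq_int_scale gauss_sq_int simp: abs_l2_scaleR gauss_sq_int)
  finally have L: "abs_l2 (hankel a f) = (\<Sum>t\<in>I. (c t * t powr (- a - 1)) *\<^sub>R abs_l2 (gauss a (1 / t)))" .
  have R: "abs_l2 f = (\<Sum>t\<in>I. c t *\<^sub>R abs_l2 (gauss a t))"
    unfolding fI using a pos
    by (subst abs_l2_sum[symmetric]) (auto intro!: sum.cong sq_int_scale gauss_sq_int simp: abs_l2_scaleR gauss_sq_int)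
  \<comment> \<open>By bilinearity only pairs of Gaussians are compared; the auxiliary rule regroups
    the coefficients so that \<open>inner_gauss_reciprocal\<close> applies to each pair.\<close>
  have "inner (abs_l2 (hankel a f)) (abs_l2 (hankel a f)) = inner (abs_l2 f) (abs_l2 f)"
  proof -
    have "S * (T * x) = y \<Longrightarrow> (k * S) * ((l * T) * x) = k * (l * y)" for S T x y k l :: real
      by (auto simp: mult_ac)
    thus ?thesis unfolding L R inner_sum_left inner_scaleR_left unfolding inner_sum_right inner_scaleR_right
      unfolding sum_distrib_left by (intro sum.cong refl) (auto intro: inner_gauss_reciprocal a pos)
  qed
  thus "norm (abs_l2 (hankel a f)) = norm (abs_l2 f)" by (simp add: norm_eq_sqrt_inner)
qed

text \<open>Approximations must be controlled in both norms at once: closeness in L1 gives pointwise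
  convergence of the transforms, closeness in L2 convergence of the norms.\<close>

lemma dominated_convergence_L1_L2:
  assumes w: "integrable halfline w" "sq_int w"
    and F: "\<And>n. F n \<in> borel_measurable halfline" "f \<in> borel_measurable halfline"
    and bound: "\<And>n. AE x in halfline. \<bar>F n x\<bar> \<le> w x"
    and lim: "AE x in halfline. (\<lambda>n. F n x) \<longlonglongrightarrow> f x"
  shows "integrable halfline (F n)" "sq_int (F n)" "integrable halfline f" "sq_int f"
    "(\<lambda>n. \<integral>x. \<bar>f x - F n x\<bar> \<partial>halfline) \<longlonglongrightarrow> 0"
    "(\<lambda>n. norm (abs_l2 f - abs_l2 (F n))) \<longlonglongrightarrow> 0"
proof -
  note F [measurable]
  have fw: "AE x in halfline. \<bar>f x\<bar> \<le> w x"
  proof -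
    have "AE x in halfline. \<forall>n. \<bar>F n x\<bar> \<le> w x" using bound by (simp add: AE_all_countable)
    thus ?thesis using lim
    proof eventually_elim
      fix x assume "\<forall>n. \<bar>F n x\<bar> \<le> w x" and "(\<lambda>n. F n x) \<longlonglongrightarrow> f x"
      thus "\<bar>f x\<bar> \<le> w x" by (intro LIMSEQ_le_const2[OF tendsto_rabs]) auto
    qed
  qed
  show Fi: "integrable halfline (F n)" for n
    by (rule Bochner_Integration.integrable_bound[OF w(1) F(1)]) (use bound[of n] in auto)
  show fi: "integrable halfline f"
    by (rule Bochner_Integration.integrable_bound[OF w(1) F(2)]) (use fw in auto)
  show Fs: "sq_int (F n)" for n
    by (rule sq_int_bound[OF w(2) F(1)]) (use bound[of n] in auto)
  show fs: "sq_int f"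
    by (rule sq_int_bound[OF w(2) F(2)]) (use fw in auto)
  have [measurable]: "w \<in> borel_measurable halfline" using w(1) by auto
  have diff: "AE x in halfline. \<bar>f x - F n x\<bar> \<le> 2 * w x" for n
    using bound[of n] fw by eventually_elim linarith
  have "(\<lambda>n. \<integral>x. \<bar>f x - F n x\<bar> \<partial>halfline) \<longlonglongrightarrow> (\<integral>x. 0 \<partial>halfline)"
  proof (rule integral_dominated_convergence[where w = "\<lambda>x. 2 * w x"])
    show "AE x in halfline. (\<lambda>n. \<bar>f x - F n x\<bar>) \<longlonglongrightarrow> 0"
      using lim by eventually_elim (auto intro!: tendsto_eq_intros)
  qed (use w diff in auto)
  thus "(\<lambda>n. \<integral>x. \<bar>f x - F n x\<bar> \<partial>halfline) \<longlonglongrightarrow> 0" by simp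
  have "(\<lambda>n. \<integral>x. (f x - F n x)\<^sup>2 \<partial>halfline) \<longlonglongrightarrow> (\<integral>x. 0 \<partial>halfline)"
  proof (rule integral_dominated_convergence[where w = "\<lambda>x. (2 * w x)\<^sup>2"])
    show "AE x in halfline. (\<lambda>n. (f x - F n x)\<^sup>2) \<longlonglongrightarrow> 0"
      using lim by eventually_elim (auto intro!: tendsto_eq_intros)
    show "integrable halfline (\<lambda>x. (2 * w x)\<^sup>2)"
      using sq_int_scale[OF w(2), of 2] by (simp add: sq_int_def)
    show "AE x in halfline. norm ((f x - F n x)\<^sup>2) \<le> (2 * w x)\<^sup>2" for n
      using diff[of n]
    proof eventually_elim
      fix x assume "\<bar>f x - F n x\<bar> \<le> 2 * w x"
      hence "\<bar>f x - F n x\<bar>\<^sup>2 \<le> (2 * w x)\<^sup>2" by (intro power_mono) auto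
      thus "norm ((f x - F n x)\<^sup>2) \<le> (2 * w x)\<^sup>2" by simp
    qed
  qed auto
  hence "(\<lambda>n. (norm (abs_l2 f - abs_l2 (F n)))\<^sup>2) \<longlonglongrightarrow> 0"
    by (simp add: abs_l2_diff[OF fs Fs] norm_abs_l2_sq[OF sq_int_diff[OF fs Fs]])
  from tendsto_real_sqrt[OF this, unfolded real_sqrt_zero] show "(\<lambda>n. norm (abs_l2 f - abs_l2 (F n))) \<longlonglongrightarrow> 0" by simp
qed

text \<open>With \<open>v = exp (- pi * x^2)\<close> one has
  \<open>gauss a (i + 1) x = gauss a 1 x * v^i\<close>, so combinations of Gaussians with integer
  parameters are polynomials in \<open>v\<close> times \<open>gauss a 1\<close>. Since
  \<open>h\<close> vanishes near 0 and near infinity, \<open>h / gauss a 1\<close> is a continuous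
  function of \<open>v\<close> on \<open>{0..1}\<close>, and Weierstrass applies. The weighted error
  then controls L1 and L2 together.\<close>

lemma weighted_gauss_approximation:
  fixes h :: "real \<Rightarrow> real"
  assumes h: "continuous_on UNIV h" and r: "0 < r" "r < R"
    and supp: "\<And>x. x \<le> r \<Longrightarrow> h x = 0" "\<And>x. x \<ge> R \<Longrightarrow> h x = 0" and e: "e > 0"
  obtains g where "gauss_combination a g" "\<And>x. x \<ge> 0 \<Longrightarrow> \<bar>h x - g x\<bar> \<le> e * gauss a 1 x"
proof -
  \<comment> \<open>The inverse of \<open>x \<mapsto> exp (- pi * x^2)\<close> on the positive
    half-line; it reverses order, so \<open>v1\<close> belongs to \<open>R\<close> and
    \<open>v2\<close> to \<open>r\<close>.\<close>
  define X where "X = (\<lambda>v. sqrt (- ln v / pi))"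
  define q where "q = (\<lambda>v. h (X v) / gauss a 1 (X v))"
  define v1 v2 where "v1 = exp (- (pi * R\<^sup>2))" and "v2 = exp (- (pi * r\<^sup>2))"
  have v: "0 < v1" "v1 < v2" "v2 < 1"
    using r by (auto simp: v1_def v2_def power_strict_mono)
  have z1: "q v = 0" if "v \<in> {0..v1}" for v
  proof (cases "v = 0")
    \<comment> \<open>By convention \<open>ln 0 = 0\<close>, so \<open>X 0 = 0\<close>, a point
      where \<open>h\<close> vanishes too.\<close>
    case True
    thus ?thesis using supp(1)[of 0] r by (simp add: q_def X_def)
  next
    case False
    hence "ln v \<le> - (pi * R\<^sup>2)" using that ln_le_cancel_iff[of v v1] v(1) by (simp add: v1_def)
    hence "R\<^sup>2 \<le> - ln v / pi" by (simp add: field_simps)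
    hence "R \<le> X v" unfolding X_def by (rule real_le_rsqrt)
    thus ?thesis by (simp add: q_def supp)
  qed
  have z2: "q v = 0" if "v \<in> {v2..1}" for v
  proof -
    have "ln v \<ge> - (pi * r\<^sup>2)" using that v v2_def by (simp add: ln_ge_iff)
    hence "- ln v / pi \<le> r\<^sup>2" by (simp add: field_simps)
    hence "X v \<le> r" unfolding X_def using r by (intro real_le_lsqrt) auto
    thus ?thesis by (simp add: q_def supp)
  qed
  have "continuous_on {v1..v2} q"
  proof -
    have X: "continuous_on {v1..v2} X" unfolding X_def using v by (intro continuous_intros) auto
    have Xp: "X x > 0" if "x \<in> {v1..v2}" for x
      using that v unfolding X_def by (auto intro!: divide_neg_pos divide_pos_pos)
    show ?thesis unfolding q_def gauss_def
      by (intro continuous_intros continuous_on_compose2[OF h X] X) (use Xp in force)+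
  qed
  moreover have "continuous_on {0..v1} q" "continuous_on {v2..1} q"
    using z1 z2 by (auto intro: continuous_on_eq[OF continuous_on_const[of _ 0]])
  ultimately have "continuous_on ({0..v1} \<union> {v1..v2} \<union> {v2..1}) q"
    by (intro continuous_on_closed_Un closed_Un) auto
  moreover have "{0..v1} \<union> {v1..v2} \<union> {v2..1} = {0..1}" using v by auto
  ultimately have "continuous_on {0..1} q" by simp
  then obtain p where p: "real_polynomial_function p" "\<And>v. v \<in> {0..1} \<Longrightarrow> \<bar>q v - p v\<bar> < e"
    using Stone_Weierstrass_real_polynomial_function[of "{0..1}" q e] e by auto
  obtain b N where b: "p = (\<lambda>v. \<Sum>i\<le>N. b i * v ^ i)"
    using p(1) by (auto simp: real_polynomial_function_iff_sum)
  define g where "g = (\<lambda>x. \<Sum>i\<le>N. b i * gauss a (real (Suc i)) x)"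
  show ?thesis
  proof
    \<comment> \<open>Combinations are indexed by the Gaussian parameter itself; the floor recovers
      the exponent \<open>i\<close> from \<open>t = Suc i\<close>.\<close>
    have "g = (\<lambda>x. \<Sum>t\<in>(\<lambda>i. real (Suc i)) ` {..N}. b (nat \<lfloor>t - 1\<rfloor>) * gauss a t x)"
      unfolding g_def by (subst sum.reindex) (auto simp: inj_on_def)
    thus "gauss_combination a g" unfolding gauss_combination_def
      by (intro exI[of _ "(\<lambda>i. real (Suc i)) ` {..N}"] exI[of _ "\<lambda>t. b (nat \<lfloor>t - 1\<rfloor>)"]) auto
    fix x :: real assume x: "x \<ge> 0"
    show "\<bar>h x - g x\<bar> \<le> e * gauss a 1 x"
    proof (cases "x = 0")
      case True
      thus ?thesis using supp(1)[of 0] r by (simp add: g_def gauss_def)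
    next
      case False
      hence x0: "x > 0" using x by simp
      define V where "V = exp (- (pi * x\<^sup>2))"
      have V: "V \<in> {0..1}" by (auto simp: V_def)
      have XV: "X V = x" using x by (simp add: X_def V_def)
      have G: "gauss a 1 x > 0" using x0 by (simp add: gauss_def)
      have gi: "gauss a (real (Suc i)) x = gauss a 1 x * V ^ i" for i
        by (simp add: gauss_def V_def algebra_simps flip: exp_of_nat_mult exp_add)
      have "g x = gauss a 1 x * p V"
        unfolding g_def b gi by (simp add: sum_distrib_left mult_ac)
      moreover have "h x = gauss a 1 x * q V" using G by (simp add: q_def XV)
      ultimately have "\<bar>h x - g x\<bar> = gauss a 1 x * \<bar>q V - p V\<bar>"
        using G by (simp add: abs_mult flip: right_diff_distrib)
      also have "\<dots> \<le> gauss a 1 x * e" using G p(2)[OF V] by (intro mult_left_mono) auto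
      finally show ?thesis by (simp add: mult.commute)
    qed
  qed
qed

lemma L1_L2_triangle:
  assumes "integrable halfline f" "sq_int f" "integrable halfline g" "sq_int g" "integrable halfline h" "sq_int h"
    and "(\<integral>x. \<bar>f x - g x\<bar> \<partial>halfline) < d" "norm (abs_l2 f - abs_l2 g) < d"
    and "(\<integral>x. \<bar>g x - h x\<bar> \<partial>halfline) < e" "norm (abs_l2 g - abs_l2 h) < e"
  shows "(\<integral>x. \<bar>f x - h x\<bar> \<partial>halfline) < d + e" "norm (abs_l2 f - abs_l2 h) < d + e"
proof -
  have "(\<integral>x. \<bar>f x - h x\<bar> \<partial>halfline) \<le> (\<integral>x. \<bar>f x - g x\<bar> + \<bar>g x - h x\<bar> \<partial>halfline)"
    using assms by (intro integral_mono) auto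
  thus "(\<integral>x. \<bar>f x - h x\<bar> \<partial>halfline) < d + e" using assms by simp
  show "norm (abs_l2 f - abs_l2 h) < d + e"
    using norm_triangle_ineq[of "abs_l2 f - abs_l2 g" "abs_l2 g - abs_l2 h"] assms by simp
qed

lemma gauss_dense_continuous:
  fixes h :: "real \<Rightarrow> real"
  assumes a: "a > -1/2" and h: "continuous_on UNIV h" and r: "0 < r" "r < R"
    and supp: "\<And>x. x \<le> r \<Longrightarrow> h x = 0" "\<And>x. x \<ge> R \<Longrightarrow> h x = 0"
    and hi: "integrable halfline h" "sq_int h" and e: "e > 0"
  shows "\<exists>g. gauss_combination a g \<and> (\<integral>x. \<bar>h x - g x\<bar> \<partial>halfline) < e \<and> norm (abs_l2 h - abs_l2 g) < e"
proof -
  define A B where "A = (\<integral>x. gauss a 1 x \<partial>halfline)" and "B = norm (abs_l2 (gauss a 1))"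
  have G: "integrable halfline (gauss a 1)" "sq_int (gauss a 1)"
    using a by (auto intro: gauss_integrable gauss_sq_int)
  have "A \<ge> 0" unfolding A_def by (intro Bochner_Integration.integral_nonneg) (simp add: gauss_def)
  moreover have "B \<ge> 0" by (simp add: B_def)
  ultimately have AB: "A + B + 1 > 0" by simp
  \<comment> \<open>\<open>A\<close> and \<open>B\<close> are the L1 and L2 norms of the weight, so
    a single \<open>d\<close> makes both errors smaller than \<open>e\<close>.\<close>
  define d where "d = e / (A + B + 1)"
  have d: "d > 0" "d * A < e" "d * B < e"
    using e AB \<open>A \<ge> 0\<close> \<open>B \<ge> 0\<close> by (auto simp: d_def field_simps intro!: add_nonneg_pos add_pos_nonneg)
  obtain g where g: "gauss_combination a g" "\<And>x. x \<ge> 0 \<Longrightarrow> \<bar>h x - g x\<bar> \<le> d * gauss a 1 x"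
    using weighted_gauss_approximation[OF h r supp d(1)] by metis
  note gi = gauss_combination_L1_L2[OF a g(1)]
  have "(\<integral>x. \<bar>h x - g x\<bar> \<partial>halfline) \<le> (\<integral>x. d * gauss a 1 x \<partial>halfline)"
    using hi gi G g(2) by (intro integral_mono) auto
  also have "\<dots> < e" using d by (simp add: A_def)
  finally have 1: "(\<integral>x. \<bar>h x - g x\<bar> \<partial>halfline) < e" .
  have "(norm (abs_l2 h - abs_l2 g))\<^sup>2 = (\<integral>x. (h x - g x)\<^sup>2 \<partial>halfline)"
    by (simp add: abs_l2_diff[OF hi(2) gi(2)] norm_abs_l2_sq[OF sq_int_diff[OF hi(2) gi(2)]])
  also have "\<dots> \<le> (\<integral>x. (d * gauss a 1 x)\<^sup>2 \<partial>halfline)"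
  proof (intro integral_mono)
    fix x assume "x \<in> space halfline"
    hence "\<bar>h x - g x\<bar>\<^sup>2 \<le> (d * gauss a 1 x)\<^sup>2" using g(2)[of x] by (intro power_mono) auto
    thus "(h x - g x)\<^sup>2 \<le> (d * gauss a 1 x)\<^sup>2" by simp
  qed (use sq_int_diff[OF hi(2) gi(2)] sq_int_scale[OF G(2), of d] in \<open>auto simp: sq_int_def\<close>)
  also have "\<dots> = (norm (abs_l2 (\<lambda>x. d * gauss a 1 x)))\<^sup>2"
    using norm_abs_l2_sq[OF sq_int_scale[OF G(2), of d]] by simp
  also have "norm (abs_l2 (\<lambda>x. d * gauss a 1 x)) = d * B"
    using abs_l2_scaleR[OF G(2), of d, symmetric] d by (simp add: B_def)
  finally have "norm (abs_l2 h - abs_l2 g) \<le> d * B"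
    using d \<open>B \<ge> 0\<close> by (auto intro: power2_le_imp_le)
  hence 2: "norm (abs_l2 h - abs_l2 g) < e" using d by simp
  show ?thesis using g(1) 1 2 by blast
qed

text \<open>A measurable function is an almost everywhere limit of continuous ones. Clipping these
  to height \<open>B\<close> and multiplying by a cutoff does not change the limit, but gives a
  common integrable majorant and a support away from 0 and infinity, as
  \<open>gauss_dense_continuous\<close> requires.\<close>

lemma gauss_dense_bounded:
  assumes a: "a > -1/2" and r: "0 < r" "r < R" and f: "f \<in> borel_measurable halfline"
    and supp: "\<And>x. x \<le> r \<Longrightarrow> f x = 0" "\<And>x. x \<ge> R \<Longrightarrow> f x = 0"
    and B: "\<And>x. \<bar>f x\<bar> \<le> B" and e: "e > 0"
  shows "\<exists>g. gauss_combination a g \<and> (\<integral>x. \<bar>f x - g x\<bar> \<partial>halfline) < e \<and> norm (abs_l2 f - abs_l2 g) < e"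
proof -
  have "(\<lambda>x. if x \<in> {0..} then f x else 0) \<in> borel_measurable lebesgue"
    by (rule borel_measurable_if_I[OF f]) simp
  moreover have "(\<lambda>x. if x \<in> {0..} then f x else 0) = f" using supp(1) r by fastforce
  ultimately have "f measurable_on UNIV"
    by (intro lebesgue_measurable_imp_measurable_on) auto
  then obtain N h where N: "negligible N" and h: "\<And>n. continuous_on UNIV (h n)"
    and lim: "\<And>x. x \<notin> N \<Longrightarrow> (\<lambda>n. h n x) \<longlonglongrightarrow> f x"
    by (auto simp: measurable_on_def)
  \<comment> \<open>Piecewise linear: 1 on \<open>{r..R}\<close> and 0 outside
    \<open>{r/2..R+1}\<close>.\<close>
  define cut where "cut = (\<lambda>x. max 0 (min 1 (min (2 * x / r - 1) (R + 1 - x))))"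
  have cut: "0 \<le> cut x" "cut x \<le> 1" "x \<le> r / 2 \<Longrightarrow> cut x = 0" "x \<ge> R + 1 \<Longrightarrow> cut x = 0"
    "r \<le> x \<Longrightarrow> x \<le> R \<Longrightarrow> cut x = 1" for x
  proof -
    have "x \<le> r / 2 \<Longrightarrow> 2 * x / r - 1 \<le> 0" "r \<le> x \<Longrightarrow> 2 * x / r - 1 \<ge> 1"
      using r by (simp_all add: divide_simps)
    thus "0 \<le> cut x" "cut x \<le> 1" "x \<le> r / 2 \<Longrightarrow> cut x = 0" "x \<ge> R + 1 \<Longrightarrow> cut x = 0"
      "r \<le> x \<Longrightarrow> x \<le> R \<Longrightarrow> cut x = 1"
      by (auto simp: cut_def)
  qed
  define F where "F = (\<lambda>n x. max (- B) (min B (h n x)) * cut x)"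
  have Fc: "continuous_on UNIV (F n)" for n
    unfolding F_def cut_def using r
    by (intro continuous_on_mult continuous_on_max continuous_on_min h continuous_intros) auto
  have B0: "B \<ge> 0" using B[of 0] by simp
  define w where "w = (\<lambda>x. B * indicator {0..R + 1} x :: real)"
  have wi: "integrable halfline w" and ws: "sq_int w"
  proof -
    have "{0..R + 1} \<inter> {0..} = {0..R + 1}" by auto
    hence i: "integrable halfline (indicator {0..R + 1} :: real \<Rightarrow> real)"
      by (subst integrable_restrict_space)
        (use emeasure_lborel_cbox_finite[of 0 "R + 1"] in
          \<open>auto intro!: integrable_real_indicator simp flip: indicator_inter_arith\<close>)
    thus "integrable halfline w" by (simp add: w_def)
    moreover have "(\<lambda>x. (w x)\<^sup>2) = (\<lambda>x. B * w x)" 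
      by (auto simp: w_def indicator_def power2_eq_square)
    ultimately show "sq_int w" by (auto simp: sq_int_def)
  qed
  have conv: "(\<lambda>n. F n x) \<longlonglongrightarrow> f x" if "x \<notin> N" for x
  proof -
    have "(\<lambda>n. F n x) \<longlonglongrightarrow> max (- B) (min B (f x)) * cut x"
      unfolding F_def by (intro tendsto_intros tendsto_max tendsto_min lim that)
    also have "max (- B) (min B (f x)) = f x" using B[of x] by (auto simp: abs_le_iff)
    also have "f x * cut x = f x"
      using cut(5)[of x] supp[of x] by (cases "r \<le> x \<and> x \<le> R") auto
    finally show ?thesis .
  qed
  have "AE x in halfline. (\<lambda>n. F n x) \<longlonglongrightarrow> f x"
    using AE_not_in[of N lebesgue] N conv by (auto simp: AE_halfline_iff negligible_iff_null_sets elim!: AE_mp)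
  moreover have "AE x in halfline. \<bar>F n x\<bar> \<le> w x" for n
  proof (rule AE_I2)
    fix x assume "x \<in> space halfline"
    have "\<bar>max (- B) (min B (h n x))\<bar> \<le> B" using B0 by auto
    hence "\<bar>F n x\<bar> \<le> B * cut x"
      using cut(1)[of x] unfolding F_def abs_mult by (intro mult_mono) auto
    also have "\<dots> \<le> w x" unfolding w_def using cut[of x] B0 \<open>x \<in> space halfline\<close>
      by (intro mult_left_mono) (auto simp: indicator_def)
    finally show "\<bar>F n x\<bar> \<le> w x" .
  qed
  moreover have "F n \<in> borel_measurable halfline" for n
    using Fc by (intro continuous_on_halfline_measurable) (auto intro: continuous_on_subset)
  ultimately have D: "\<And>n. integrable halfline (F n)" "\<And>n. sq_int (F n)" "integrable halfline f" "sq_int f"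
    "(\<lambda>n. \<integral>x. \<bar>f x - F n x\<bar> \<partial>halfline) \<longlonglongrightarrow> 0"
    "(\<lambda>n. norm (abs_l2 f - abs_l2 (F n))) \<longlonglongrightarrow> 0"
    using dominated_convergence_L1_L2[OF wi ws _ f, of F] by blast+
  have "\<forall>\<^sub>F n in sequentially. (\<integral>x. \<bar>f x - F n x\<bar> \<partial>halfline) < e / 2 \<and> norm (abs_l2 f - abs_l2 (F n)) < e / 2"
    using e by (intro eventually_conj order_tendstoD[OF D(5)] order_tendstoD[OF D(6)]) auto
  then obtain n where n: "(\<integral>x. \<bar>f x - F n x\<bar> \<partial>halfline) < e / 2" "norm (abs_l2 f - abs_l2 (F n)) < e / 2"
    by (auto simp: eventually_sequentially)
  have "\<exists>g. gauss_combination a g \<and> (\<integral>x. \<bar>F n x - g x\<bar> \<partial>halfline) < e / 2 \<and> norm (abs_l2 (F n) - abs_l2 g) < e / 2"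
    using r e by (intro gauss_dense_continuous[OF a Fc, of "r / 2" "R + 1"] D) (auto simp: F_def cut)
  then obtain g where g: "gauss_combination a g" "(\<integral>x. \<bar>F n x - g x\<bar> \<partial>halfline) < e / 2"
    "norm (abs_l2 (F n) - abs_l2 g) < e / 2" by blast
  have "(\<integral>x. \<bar>f x - g x\<bar> \<partial>halfline) < e / 2 + e / 2" "norm (abs_l2 f - abs_l2 g) < e / 2 + e / 2"
    by (rule L1_L2_triangle[OF D(3,4) D(1,2)[of n] gauss_combination_L1_L2[OF a g(1)] n g(2,3)])+
  thus ?thesis using g(1) by auto
qed

text \<open>Truncating both the height and the domain reduces to \<open>gauss_dense_bounded\<close>;
  the function itself is the majorant for the convergence of the truncations.\<close>

lemma gauss_dense:
  assumes a: "a > -1/2" and f: "integrable halfline f" "sq_int f" and e: "e > 0"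
  shows "\<exists>g. gauss_combination a g \<and> (\<integral>x. \<bar>f x - g x\<bar> \<partial>halfline) < e \<and> norm (abs_l2 f - abs_l2 g) < e"
proof -
  define F where "F = (\<lambda>n x. indicator {1 / (real n + 2)..real n + 1} x * max (- real n) (min (real n) (f x)))"
  have fm: "f \<in> borel_measurable halfline" using f by auto
  have Fm: "F n \<in> borel_measurable halfline" for n
  proof -
    have "indicator {1 / (real n + 2)..real n + 1} \<in> borel_measurable halfline"
      by (intro measurable_restrict_space1 borel_measurable_indicator) auto
    thus ?thesis unfolding F_def using fm by measurable
  qed
  have "AE x in halfline. (\<lambda>n. F n x) \<longlonglongrightarrow> f x"
  proof -
    have "AE x in halfline. x \<noteq> 0"
      using AE_not_in[of "{0::real}" lebesgue] by (auto simp: AE_halfline_iff elim!: AE_mp simp flip: negligible_iff_null_sets)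
    thus ?thesis using AE_halfline_nonneg
    proof eventually_elim
      fix x :: real assume "x \<noteq> 0" "x \<ge> 0"
      hence x: "x > 0" by simp
      obtain K :: nat where K: "real K \<ge> max (1 / x) (max x \<bar>f x\<bar>)" using real_arch_simple by blast
      have "F n x = f x" if "n \<ge> K" for n
      proof -
        have n: "real n \<ge> 1 / x" "real n \<ge> x" "real n \<ge> \<bar>f x\<bar>" using K that by auto
        hence "1 / (real n + 2) \<le> x" using x by (simp add: field_simps)
        thus ?thesis using n by (auto simp: F_def)
      qed
      thus "(\<lambda>n. F n x) \<longlonglongrightarrow> f x"
        by (intro tendsto_eventually eventually_sequentiallyI[of K])
    qed
  qed
  moreover have "AE x in halfline. \<bar>F n x\<bar> \<le> \<bar>f x\<bar>" for n
    by (rule AE_I2) (auto simp: F_def indicator_def)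
  moreover have "sq_int (\<lambda>x. \<bar>f x\<bar>)" using f(2) fm by (auto simp: sq_int_def)
  ultimately have D: "\<And>n. integrable halfline (F n)" "\<And>n. sq_int (F n)"
    "(\<lambda>n. \<integral>x. \<bar>f x - F n x\<bar> \<partial>halfline) \<longlonglongrightarrow> 0"
    "(\<lambda>n. norm (abs_l2 f - abs_l2 (F n))) \<longlonglongrightarrow> 0"
    using dominated_convergence_L1_L2[of "\<lambda>x. \<bar>f x\<bar>" F f] f Fm fm by auto
  have "\<forall>\<^sub>F n in sequentially. (\<integral>x. \<bar>f x - F n x\<bar> \<partial>halfline) < e / 2 \<and> norm (abs_l2 f - abs_l2 (F n)) < e / 2"
    using e by (intro eventually_conj order_tendstoD[OF D(3)] order_tendstoD[OF D(4)]) auto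
  then obtain n where n: "(\<integral>x. \<bar>f x - F n x\<bar> \<partial>halfline) < e / 2" "norm (abs_l2 f - abs_l2 (F n)) < e / 2"
    by (auto simp: eventually_sequentially)
  have "\<exists>g. gauss_combination a g \<and> (\<integral>x. \<bar>F n x - g x\<bar> \<partial>halfline) < e / 2 \<and> norm (abs_l2 (F n) - abs_l2 g) < e / 2"
  \<comment> \<open>The interval is chosen strictly larger than that of \<open>F n\<close>, because
    the function has to vanish at the endpoints themselves.\<close>
  proof (rule gauss_dense_bounded[OF a _ _ Fm, of "1 / (real n + 3)" "real n + 2" _ "real n"])
    have "1 / (real n + 3) \<le> 1" by simp
    thus "1 / (real n + 3) < real n + 2" by linarith
    have "1 / (real n + 3) < 1 / (real n + 2)" by (intro divide_strict_left_mono) auto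
    thus "F n x = 0" if "x \<le> 1 / (real n + 3)" for x using that by (auto simp: F_def)
  qed (use e in \<open>auto simp: F_def indicator_def\<close>)
  then obtain g where g: "gauss_combination a g" "(\<integral>x. \<bar>F n x - g x\<bar> \<partial>halfline) < e / 2"
    "norm (abs_l2 (F n) - abs_l2 g) < e / 2" by blast
  have "(\<integral>x. \<bar>f x - g x\<bar> \<partial>halfline) < e / 2 + e / 2" "norm (abs_l2 f - abs_l2 g) < e / 2 + e / 2"
    by (rule L1_L2_triangle[OF f D(1,2)[of n] gauss_combination_L1_L2[OF a g(1)] n g(2,3)])+
  thus ?thesis using g(1) by auto
qed

text \<open>Approximate \<open>f\<close> by Gaussian combinations in L1 and L2. The kernel bound
  makes their transforms converge pointwise to that of \<open>f\<close>, and the isometry on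
  combinations makes them Cauchy in L2. Fatou identifies the two limits.\<close>

lemma hankel_isometry:
  assumes a: "a > -1/2" and f: "integrable halfline f" "sq_int f"
  shows "sq_int (hankel a f)" "norm (abs_l2 (hankel a f)) = norm (abs_l2 f)"
proof -
  have "\<forall>n. \<exists>g. gauss_combination a g \<and> (\<integral>x. \<bar>f x - g x\<bar> \<partial>halfline) < 1 / real (Suc n) \<and>
      norm (abs_l2 f - abs_l2 g) < 1 / real (Suc n)"
    using gauss_dense[OF a f] by simp
  then obtain g where g: "\<And>n. gauss_combination a (g n)"
    "\<And>n. (\<integral>x. \<bar>f x - g n x\<bar> \<partial>halfline) < 1 / real (Suc n)"
    "\<And>n. norm (abs_l2 f - abs_l2 (g n)) < 1 / real (Suc n)" by metis
  note gi = gauss_combination_L1_L2[OF a g(1)] and iso = hankel_isometry_gauss[OF a g(1)]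
  obtain C where C: "C > 0" "\<And>t. t \<ge> 0 \<Longrightarrow> \<bar>hankel_kernel a t\<bar> \<le> C"
    using hankel_kernel_bounded[OF a] by metis
  have inv0: "(\<lambda>n. 1 / real (Suc n)) \<longlonglongrightarrow> 0" by (rule LIMSEQ_Suc[OF lim_1_over_n])
  have lim: "(\<lambda>n. hankel a (g n) y) \<longlonglongrightarrow> hankel a f y" if y: "y \<ge> 0" for y
  proof (rule Lim_transform_bound[where g = "\<lambda>n. C * (1 / real (Suc n))", THEN LIM_zero_cancel])
    show "(\<lambda>n. C * (1 / real (Suc n))) \<longlonglongrightarrow> 0" using tendsto_mult_right_zero[OF inv0] .
    show "\<forall>\<^sub>F n in sequentially. norm (hankel a (g n) y - hankel a f y) \<le> norm (C * (1 / real (Suc n)))"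
    proof (rule always_eventually, rule allI)
      fix n
      have "norm (hankel a (g n) y - hankel a f y) = \<bar>hankel a (\<lambda>x. f x - g n x) y\<bar>"
        using hankel_diff[OF a y f(1) gi(1), of n] by simp
      also have "\<dots> \<le> C * (\<integral>x. \<bar>f x - g n x\<bar> \<partial>halfline)"
        using f gi by (intro hankel_bound[OF a C(2)] y) auto
      also have "\<dots> \<le> C * (1 / real (Suc n))" using C g(2)[of n] by (intro mult_left_mono) auto
      finally show "norm (hankel a (g n) y - hankel a f y) \<le> norm (C * (1 / real (Suc n)))"
        using C(1) by simp
    qed
  qed
  have conv: "(\<lambda>n. abs_l2 (g n)) \<longlonglongrightarrow> abs_l2 f"
    by (rule LIM_zero_cancel, rule Lim_null_comparison[OF _ inv0])
      (use g(3) in \<open>auto simp: norm_minus_commute intro!: always_eventually less_imp_le\<close>)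
  have dist: "norm (abs_l2 (hankel a (g n)) - abs_l2 (hankel a (g m))) = norm (abs_l2 (g n) - abs_l2 (g m))" for n m
  proof -
    note gd = gauss_combination_diff[OF g(1)[of n] g(1)[of m]]
    have "AE y in halfline. hankel a (g n) y - hankel a (g m) y = hankel a (\<lambda>x. g n x - g m x) y"
      using gi by (intro AE_I2) (simp add: hankel_diff[OF a])
    hence "abs_l2 (\<lambda>y. hankel a (g n) y - hankel a (g m) y) = abs_l2 (hankel a (\<lambda>x. g n x - g m x))"
      using abs_l2_eq_iff[OF sq_int_diff[OF iso(1) iso(1)] hankel_isometry_gauss(1)[OF a gd]] by blast
    thus ?thesis using hankel_isometry_gauss(2)[OF a gd]
      by (simp add: abs_l2_diff iso gi)
  qed
  \<comment> \<open>A bound on the distances from \<open>g m\<close> to all later \<open>g n\<close>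
    survives the passage to the pointwise limit, which becomes square integrable in the
    process.\<close>
  have fatou: "sq_int (hankel a f) \<and> norm (abs_l2 (hankel a f) - abs_l2 (hankel a (g m))) \<le> e"
    if e: "\<And>n. n \<ge> m \<Longrightarrow> norm (abs_l2 (g n) - abs_l2 (g m)) \<le> e" for m e
  proof -
    have "AE y in halfline. (\<lambda>n. hankel a (g n) y) \<longlonglongrightarrow> hankel a f y"
      by (rule AE_I2) (simp add: lim)
    from l2_fatou[OF iso(1) hankel_measurable[OF a f(1)] this, of m "abs_l2 (hankel a (g m))" e]
    show ?thesis using e dist by simp
  qed
  have close: "\<exists>N. \<forall>m\<ge>N. sq_int (hankel a f) \<and> norm (abs_l2 (hankel a f) - abs_l2 (hankel a (g m))) \<le> e"
    if e: "e > 0" for e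
  proof -
    obtain N where N: "\<forall>m\<ge>N. \<forall>n\<ge>N. norm (abs_l2 (g m) - abs_l2 (g n)) < e"
      using CauchyD[OF LIMSEQ_imp_Cauchy[OF conv] e] by blast
    show ?thesis
    proof (intro exI[of _ N] allI impI)
      fix m assume "m \<ge> N"
      show "sq_int (hankel a f) \<and> norm (abs_l2 (hankel a f) - abs_l2 (hankel a (g m))) \<le> e"
        by (rule fatou) (use N \<open>m \<ge> N\<close> in \<open>auto intro: less_imp_le\<close>)
    qed
  qed
  show "sq_int (hankel a f)" using close[of 1] by auto
  have "(\<lambda>m. abs_l2 (hankel a (g m))) \<longlonglongrightarrow> abs_l2 (hankel a f)"
  proof (rule LIMSEQ_I)
    fix r :: real assume "r > 0"
    then obtain N where "\<forall>m\<ge>N. norm (abs_l2 (hankel a f) - abs_l2 (hankel a (g m))) \<le> r / 2"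
      using close[of "r / 2"] by auto
    thus "\<exists>N. \<forall>m\<ge>N. norm (abs_l2 (hankel a (g m)) - abs_l2 (hankel a f)) < r"
      using \<open>r > 0\<close> by (intro exI[of _ N]) (auto simp: norm_minus_commute intro: le_less_trans)
  qed
  from tendsto_norm[OF this] tendsto_norm[OF conv] show "norm (abs_l2 (hankel a f)) = norm (abs_l2 f)"
    unfolding iso(2) by (rule LIMSEQ_unique)
qed

section \<open>Operators on the Hilbert space\<close>

definition restrict_l2 :: "real set \<Rightarrow> l2 \<Rightarrow> l2" where
  "restrict_l2 A u = abs_l2 (\<lambda>x. indicator A x * rep_l2 u x)"

text \<open>The same truncations as in \<open>FB2\<close>, so that the two can be compared term by
  term. Existence of the limit is part of \<open>hankel_l2_tendsto\<close>.\<close>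

definition hankel_l2 :: "real \<Rightarrow> l2 \<Rightarrow> l2" where
  "hankel_l2 a u = lim (\<lambda>n. abs_l2 (hankel a (\<lambda>x. indicator {0..real n} x * rep_l2 u x)))"

lemma restrict_abs_l2:
  assumes "A \<in> sets lebesgue" "sq_int f"
  shows "restrict_l2 A (abs_l2 f) = abs_l2 (\<lambda>x. indicator A x * f x)"
  unfolding restrict_l2_def using rep_abs_l2[OF assms(2)] assms
  by (subst abs_l2_eq_iff) (auto intro!: sq_int_indicator sq_int_rep elim: AE_mp)

lemma restrict_l2_fixed_iff:
  assumes "A \<in> sets lebesgue"
  shows "restrict_l2 A u = u \<longleftrightarrow> (AE x in halfline. x \<notin> A \<longrightarrow> rep_l2 u x = 0)"
proof -
  have "restrict_l2 A u = u \<longleftrightarrow> restrict_l2 A u = abs_l2 (rep_l2 u)" by simp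
  also have "\<dots> \<longleftrightarrow> (AE x in halfline. indicator A x * rep_l2 u x = rep_l2 u x)"
    unfolding restrict_l2_def by (intro abs_l2_eq_iff sq_int_indicator sq_int_rep assms)
  also have "\<dots> \<longleftrightarrow> (AE x in halfline. x \<notin> A \<longrightarrow> rep_l2 u x = 0)"
    by (intro AE_cong) (auto simp: indicator_def)
  finally show ?thesis .
qed

lemma restrict_l2_fixed_abs_iff:
  assumes "A \<in> sets lebesgue" "sq_int f"
  shows "restrict_l2 A (abs_l2 f) = abs_l2 f \<longleftrightarrow> (AE x in halfline. x \<notin> A \<longrightarrow> f x = 0)"
  unfolding restrict_l2_fixed_iff[OF assms(1)] using rep_abs_l2[OF assms(2)]
  by (auto elim!: AE_mp)

lemma bounded_linear_restrict_l2:
  assumes A: "A \<in> sets lebesgue"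
  shows "bounded_linear (restrict_l2 A)" "norm (restrict_l2 A u) \<le> norm u"
proof -
  have le: "norm (restrict_l2 A u) \<le> norm u" for u
  proof (cases u rule: l2_cases)
    case (1 f)
    have "(norm (restrict_l2 A u))\<^sup>2 = (\<integral>x. (indicator A x * f x)\<^sup>2 \<partial>halfline)"
      using A 1 by (simp add: restrict_abs_l2 norm_abs_l2_sq sq_int_indicator)
    also have "\<dots> \<le> (\<integral>x. (f x)\<^sup>2 \<partial>halfline)"
      using sq_int_indicator[OF 1(1) A] 1(1)
      by (intro integral_mono) (auto simp: sq_int_def indicator_def)
    also have "\<dots> = (norm u)\<^sup>2" using 1 by (simp add: norm_abs_l2_sq)
    finally show ?thesis by (rule power2_le_imp_le) simp
  qed
  show "norm (restrict_l2 A u) \<le> norm u" by (rule le)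
  show "bounded_linear (restrict_l2 A)"
  proof (rule bounded_linear_intro[where K = 1])
    fix u v :: l2 and c :: real
    obtain f where f: "sq_int f" "u = abs_l2 f" by (rule l2_cases)
    obtain g where g: "sq_int g" "v = abs_l2 g" by (rule l2_cases)
    show "restrict_l2 A (u + v) = restrict_l2 A u + restrict_l2 A v"
      using f g A by (simp add: abs_l2_add restrict_abs_l2 sq_int_add sq_int_indicator distrib_left)
    show "restrict_l2 A (c *\<^sub>R u) = c *\<^sub>R restrict_l2 A u"
      using f A by (simp add: abs_l2_scaleR restrict_abs_l2 sq_int_scale sq_int_indicator mult.left_commute)
    show "norm (restrict_l2 A u) \<le> norm u * 1" using le by simp
  qed
qed

lemma restrict_l2_idem:
  assumes "A \<in> sets lebesgue" shows "restrict_l2 A (restrict_l2 A u) = restrict_l2 A u"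
proof -
  obtain f where "sq_int f" "u = abs_l2 f" by (rule l2_cases)
  thus ?thesis using assms
    by (simp add: restrict_abs_l2 sq_int_indicator flip: mult.assoc indicator_inter_arith)
qed

text \<open>The last claim is only an inequality because \<open>A\<close> may contain negative
  numbers.\<close>

lemma indicator_L1_L2:
  assumes "A \<in> lmeasurable"
  shows "integrable halfline (indicator A :: real \<Rightarrow> real)" "sq_int (indicator A)"
    "(\<integral>x. indicator A x \<partial>halfline) \<le> measure lebesgue A"
proof -
  have i: "integrable lebesgue (indicator A :: real \<Rightarrow> real)"
    using assms by (auto intro!: integrable_real_indicator simp: fmeasurable_def)
  have j: "integrable lebesgue (\<lambda>x. indicator {0..} x *\<^sub>R indicator A x :: real)"
    using integrable_mult_indicator[OF _ i, of "{0..}"] by simp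
  show i': "integrable halfline (indicator A :: real \<Rightarrow> real)"
    using j by (simp add: integrable_restrict_space)
  have "(\<lambda>x. (indicator A x :: real)\<^sup>2) = indicator A" by (auto simp: indicator_def)
  thus "sq_int (indicator A)" using i' by (auto simp: sq_int_def)
  have "(\<integral>x. indicator A x \<partial>halfline) = (\<integral>x. indicator {0..} x *\<^sub>R indicator A x \<partial>lebesgue :: real)"
    by (subst integral_restrict_space) auto
  also have "\<dots> \<le> (\<integral>x. indicator A x \<partial>lebesgue)"
    by (intro integral_mono i j) (auto simp: indicator_def)
  also have "\<dots> = measure lebesgue A" by simp
  finally show "(\<integral>x. indicator A x \<partial>halfline) \<le> measure lebesgue A" .
qed

lemma indicator_mult_integrable:
  assumes "A \<in> lmeasurable" "sq_int f"
  shows "integrable halfline (\<lambda>x. indicator A x * f x)"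
  by (rule sq_int_mult_integrable[OF indicator_L1_L2(2)[OF assms(1)] assms(2)])

lemma truncation_tendsto:
  assumes "sq_int f"
  shows "(\<lambda>n. abs_l2 (\<lambda>x. indicator {0..real n} x * f x)) \<longlonglongrightarrow> abs_l2 f"
proof -
  define F where "F = (\<lambda>n x. indicator {0..real n} x * f x)"
  have F: "sq_int (F n)" for n unfolding F_def by (intro sq_int_indicator assms) auto
  have [measurable]: "f \<in> borel_measurable halfline" "\<And>n. F n \<in> borel_measurable halfline"
    using assms F by (auto simp: sq_int_def)
  have "(\<lambda>n. \<integral>x. (F n x - f x)\<^sup>2 \<partial>halfline) \<longlonglongrightarrow> (\<integral>x. 0 \<partial>halfline)"
  proof (rule integral_dominated_convergence[where w = "\<lambda>x. (f x)\<^sup>2"])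
    show "integrable halfline (\<lambda>x. (f x)\<^sup>2)" using assms by (simp add: sq_int_def)
    show "AE x in halfline. (\<lambda>n. (F n x - f x)\<^sup>2) \<longlonglongrightarrow> 0"
    proof (rule AE_I2)
      fix x assume x: "x \<in> space halfline"
      obtain N :: nat where "real N \<ge> x" using real_arch_simple by blast
      hence "(F n x - f x)\<^sup>2 = 0" if "n \<ge> N" for n
        using that x by (auto simp: F_def)
      thus "(\<lambda>n. (F n x - f x)\<^sup>2) \<longlonglongrightarrow> 0"
        by (intro tendsto_eventually eventually_sequentiallyI[of N])
    qed
    show "(\<lambda>x. (F n x - f x)\<^sup>2) \<in> borel_measurable halfline" for n by measurable
    show "AE x in halfline. norm ((F n x - f x)\<^sup>2) \<le> (f x)\<^sup>2" for n
      by (rule AE_I2) (auto simp: F_def indicator_def)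
  qed simp
  hence "(\<lambda>n. (norm (abs_l2 (F n) - abs_l2 f))\<^sup>2) \<longlonglongrightarrow> 0"
    by (simp add: abs_l2_diff[OF F assms] norm_abs_l2_sq[OF sq_int_diff[OF F assms]])
  from tendsto_real_sqrt[OF this, unfolded real_sqrt_zero]
  have "(\<lambda>n. norm (abs_l2 (F n) - abs_l2 f)) \<longlonglongrightarrow> 0" by simp
  thus ?thesis unfolding F_def by (rule LIM_zero_cancel[OF tendsto_norm_zero_cancel])
qed

lemma hankel_cong_AE:
  assumes "AE x in halfline. f x = g x" "f \<in> borel_measurable halfline" "g \<in> borel_measurable halfline"
    "a > -1/2" "y \<ge> 0"
  shows "hankel a f y = hankel a g y"
  unfolding hankel_def using assms hankel_kernel_measurable[of a y]
  by (intro integral_cong_AE) (auto elim: AE_mp)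

lemma hankel_abs_l2_diff:
  assumes a: "a > -1/2" and f: "integrable halfline f" "sq_int f" and g: "integrable halfline g" "sq_int g"
  shows "abs_l2 (hankel a f) - abs_l2 (hankel a g) = abs_l2 (hankel a (\<lambda>x. f x - g x))"
    and "norm (abs_l2 (hankel a f) - abs_l2 (hankel a g)) = norm (abs_l2 f - abs_l2 g)"
proof -
  note iso = hankel_isometry[OF a f] hankel_isometry[OF a g]
  have fg: "integrable halfline (\<lambda>x. f x - g x)" "sq_int (\<lambda>x. f x - g x)"
    using f g by (auto intro: sq_int_diff)
  have "AE y in halfline. hankel a f y - hankel a g y = hankel a (\<lambda>x. f x - g x) y"
    using f g by (intro AE_I2) (simp add: hankel_diff[OF a])
  thus e: "abs_l2 (hankel a f) - abs_l2 (hankel a g) = abs_l2 (hankel a (\<lambda>x. f x - g x))"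
    unfolding abs_l2_diff[OF iso(1,3)]
    by (subst abs_l2_eq_iff[OF sq_int_diff[OF iso(1,3)] hankel_isometry(1)[OF a fg]])
  show "norm (abs_l2 (hankel a f) - abs_l2 (hankel a g)) = norm (abs_l2 f - abs_l2 g)"
    unfolding e hankel_isometry(2)[OF a fg] abs_l2_diff[OF f(2) g(2)] ..
qed

lemma truncation_L1_L2:
  assumes "sq_int f"
  shows "integrable halfline (\<lambda>x. indicator {0..real n} x * f x)"
    "sq_int (\<lambda>x. indicator {0..real n} x * f x)"
  using assms by (auto intro!: indicator_mult_integrable sq_int_indicator)

text \<open>Truncations converge in norm and are transformed isometrically, so their transforms are
  Cauchy, and completeness yields a limit. The definition works with the chosen representative of
  the class; almost everywhere equal functions have the same integrals, hence any representative
  serves.\<close>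

lemma hankel_l2_tendsto:
  assumes a: "a > -1/2" and f: "sq_int f"
  shows "(\<lambda>n. abs_l2 (hankel a (\<lambda>x. indicator {0..real n} x * f x))) \<longlonglongrightarrow> hankel_l2 a (abs_l2 f)"
proof -
  define t where "t = (\<lambda>f n x. indicator {0..real n} x * f x :: real)"
  have conv: "convergent (\<lambda>n. abs_l2 (hankel a (t g n)))" if g: "sq_int g" for g
  proof -
    have tg: "integrable halfline (t g n)" "sq_int (t g n)" for n
      using truncation_L1_L2[OF g] by (auto simp: t_def)
    have C: "Cauchy (\<lambda>n. abs_l2 (t g n))"
      using truncation_tendsto[OF g] by (intro convergent_Cauchy) (auto simp: convergent_def t_def)
    have "Cauchy (\<lambda>n. abs_l2 (hankel a (t g n)))"
      using C by (simp add: Cauchy_def dist_norm hankel_abs_l2_diff(2)[OF a tg tg])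
    thus ?thesis by (rule Cauchy_convergent)
  qed
  have e: "abs_l2 (hankel a (t (rep_l2 (abs_l2 f)) n)) = abs_l2 (hankel a (t f n))" for n
  proof -
    have r: "sq_int (rep_l2 (abs_l2 f))" by (rule sq_int_rep)
    have "AE x in halfline. t (rep_l2 (abs_l2 f)) n x = t f n x"
      using rep_abs_l2[OF f] by eventually_elim (simp add: t_def)
    moreover have "t (rep_l2 (abs_l2 f)) n \<in> borel_measurable halfline" "t f n \<in> borel_measurable halfline"
      using truncation_L1_L2(1)[OF r, of n] truncation_L1_L2(1)[OF f, of n] unfolding t_def
      by (auto intro: borel_measurable_integrable)
    ultimately have "hankel a (t (rep_l2 (abs_l2 f)) n) y = hankel a (t f n) y" if "y \<ge> 0" for y
      using that by (rule hankel_cong_AE[OF _ _ _ a])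
    hence "AE y in halfline. hankel a (t (rep_l2 (abs_l2 f)) n) y = hankel a (t f n) y"
      by (intro AE_I2) auto
    moreover have "sq_int (hankel a (t (rep_l2 (abs_l2 f)) n))" "sq_int (hankel a (t f n))"
      unfolding t_def by (intro hankel_isometry a truncation_L1_L2 r f)+
    ultimately show ?thesis by (subst abs_l2_eq_iff)
  qed
  have "(\<lambda>n. abs_l2 (hankel a (t (rep_l2 (abs_l2 f)) n))) \<longlonglongrightarrow> hankel_l2 a (abs_l2 f)"
    unfolding hankel_l2_def using conv[OF sq_int_rep] by (simp add: t_def convergent_LIMSEQ_iff)
  thus ?thesis unfolding e by (simp add: t_def)
qed

lemma hankel_l2_abs:
  assumes a: "a > -1/2" and f: "integrable halfline f" "sq_int f"
  shows "hankel_l2 a (abs_l2 f) = abs_l2 (hankel a f)"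
proof (rule LIMSEQ_unique[OF hankel_l2_tendsto[OF a f(2)]])
  have "(\<lambda>n. norm (abs_l2 (hankel a (\<lambda>x. indicator {0..real n} x * f x)) - abs_l2 (hankel a f))) \<longlonglongrightarrow> 0"
    unfolding hankel_abs_l2_diff(2)[OF a truncation_L1_L2[OF f(2)] f]
    using tendsto_norm_zero[OF LIM_zero[OF truncation_tendsto[OF f(2)]]] .
  thus "(\<lambda>n. abs_l2 (hankel a (\<lambda>x. indicator {0..real n} x * f x))) \<longlonglongrightarrow> abs_l2 (hankel a f)"
    by (rule LIM_zero_cancel[OF tendsto_norm_zero_cancel])
qed

lemma hankel_l2_isometry:
  assumes a: "a > -1/2"
  shows "bounded_linear (hankel_l2 a)" "norm (hankel_l2 a u) = norm u"
proof -
  have n: "norm (hankel_l2 a u) = norm u" for u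
  proof (cases u rule: l2_cases)
    case (1 f)
    show ?thesis unfolding 1(2)
      by (rule LIMSEQ_unique[OF tendsto_norm[OF hankel_l2_tendsto[OF a 1(1)]]])
        (simp add: hankel_isometry(2)[OF a truncation_L1_L2[OF 1(1)]] tendsto_norm[OF truncation_tendsto[OF 1(1)]])
  qed
  show "norm (hankel_l2 a u) = norm u" by (rule n)
  show "bounded_linear (hankel_l2 a)"
  proof (rule bounded_linear_intro[where K = 1])
    fix u v :: l2 and c :: real
    obtain f where f: "sq_int f" "u = abs_l2 f" by (rule l2_cases)
    obtain g where g: "sq_int g" "v = abs_l2 g" by (rule l2_cases)
    note tf = truncation_L1_L2[OF f(1)] and tg = truncation_L1_L2[OF g(1)]
    note hf = hankel_isometry(1)[OF a tf] and hg = hankel_isometry(1)[OF a tg]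
    show "hankel_l2 a (u + v) = hankel_l2 a u + hankel_l2 a v"
      unfolding f(2) g(2) abs_l2_add[OF f(1) g(1)]
    proof (rule LIMSEQ_unique[OF hankel_l2_tendsto[OF a sq_int_add[OF f(1) g(1)]]])
      have "abs_l2 (hankel a (\<lambda>x. indicator {0..real n} x * (f x + g x))) =
          abs_l2 (hankel a (\<lambda>x. indicator {0..real n} x * f x)) +
          abs_l2 (hankel a (\<lambda>x. indicator {0..real n} x * g x))" for n
        unfolding abs_l2_add[OF hf hg] distrib_left
        using tf tg
        by (subst abs_l2_eq_iff) (auto intro!: hankel_isometry(1)[OF a] sq_int_add hf hg AE_I2 hankel_add[OF a])
      thus "(\<lambda>n. abs_l2 (hankel a (\<lambda>x. indicator {0..real n} x * (f x + g x)))) \<longlonglongrightarrow>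
          hankel_l2 a (abs_l2 f) + hankel_l2 a (abs_l2 g)"
        by (simp add: tendsto_add hankel_l2_tendsto[OF a] f g)
    qed
    show "hankel_l2 a (c *\<^sub>R u) = c *\<^sub>R hankel_l2 a u"
      unfolding f(2) abs_l2_scaleR[OF f(1)]
    proof (rule LIMSEQ_unique[OF hankel_l2_tendsto[OF a sq_int_scale[OF f(1)]]])
      have "hankel a (\<lambda>x. indicator {0..real n} x * (c * f x)) =
          (\<lambda>y. c * hankel a (\<lambda>x. indicator {0..real n} x * f x) y)" for n
        by (simp add: mult.left_commute flip: hankel_scale)
      thus "(\<lambda>n. abs_l2 (hankel a (\<lambda>x. indicator {0..real n} x * (c * f x)))) \<longlonglongrightarrow>
          c *\<^sub>R hankel_l2 a (abs_l2 f)"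
        by (simp add: tendsto_scaleR hankel_l2_tendsto[OF a f(1)] flip: abs_l2_scaleR[OF hf])
    qed
    show "norm (hankel_l2 a u) \<le> norm u * 1" using n by simp
  qed
qed

text \<open>The Hilbert--Schmidt bound: on sets of finite Lebesgue measure the kernel is square
  integrable because it is bounded.\<close>

lemma hankel_l2_hilbert_schmidt:
  assumes a: "a > -1/2" and C: "\<And>t. t \<ge> 0 \<Longrightarrow> \<bar>hankel_kernel a t\<bar> \<le> C"
    and A: "A \<in> lmeasurable" and S: "S \<in> lmeasurable"
    and B: "finite B" "orthonormal B" "\<And>b. b \<in> B \<Longrightarrow> restrict_l2 A b = b"
  shows "(\<Sum>b\<in>B. (norm (restrict_l2 S (hankel_l2 a b)))\<^sup>2) \<le> C\<^sup>2 * measure lebesgue A * measure lebesgue S"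
proof -
  define f where "f = (\<lambda>b x. indicator A x * rep_l2 b x)"
  have Al: "A \<in> sets lebesgue" and Sl: "S \<in> sets lebesgue" using A S by auto
  have f: "integrable halfline (f b)" "sq_int (f b)" for b
    unfolding f_def by (intro indicator_mult_integrable sq_int_indicator sq_int_rep A Al)+
  have absf: "abs_l2 (f b) = b" if "b \<in> B" for b
    using B(3)[OF that] by (simp add: f_def restrict_l2_def)
  have h: "sq_int (hankel a (f b))" for b by (rule hankel_isometry[OF a f])
  have C0: "C \<ge> 0" using C[of 0] by auto
  \<comment> \<open>For fixed \<open>y\<close> the value of the transform is the inner product of
    \<open>b\<close> with the section \<open>k\<close> of the kernel over \<open>A\<close>. Bessel's
    inequality then bounds the sum by the square norm of \<open>k\<close>, uniformly in
    \<open>B\<close> and \<open>y\<close>.\<close>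
  have pw: "(\<Sum>b\<in>B. (hankel a (f b) y)\<^sup>2) \<le> C\<^sup>2 * measure lebesgue A" if y: "y \<ge> 0" for y
  proof -
    define k where "k = (\<lambda>x. indicator A x * hankel_kernel a (x * y))"
    have k: "sq_int k"
    proof (rule sq_int_bound[OF sq_int_scale[OF indicator_L1_L2(2)[OF A], of C]])
      have "(indicator A :: real \<Rightarrow> real) \<in> borel_measurable halfline"
        using indicator_L1_L2(1)[OF A] by (rule borel_measurable_integrable)
      thus "k \<in> borel_measurable halfline"
        unfolding k_def using hankel_kernel_measurable[OF a y] by measurable
      show "AE x in halfline. \<bar>k x\<bar> \<le> \<bar>C * indicator A x\<bar>"
        using C y C0 by (intro AE_I2) (auto simp: k_def indicator_def)
    qed
    have "hankel a (f b) y = inner b (abs_l2 k)" if "b \<in> B" for b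
    proof -
      have "inner b (abs_l2 k) = (\<integral>x. f b x * k x \<partial>halfline)"
        using inner_abs_l2[OF f(2) k, of b] absf[OF that] by simp
      also have "\<dots> = hankel a (f b) y"
        unfolding hankel_def by (intro Bochner_Integration.integral_cong) (auto simp: f_def k_def indicator_def)
      finally show ?thesis by simp
    qed
    hence "(\<Sum>b\<in>B. (hankel a (f b) y)\<^sup>2) = (\<Sum>b\<in>B. (inner b (abs_l2 k))\<^sup>2)" by simp
    also have "\<dots> \<le> (norm (abs_l2 k))\<^sup>2" by (rule bessel_inequality(2)[OF B(1,2)])
    also have "\<dots> = (\<integral>x. (k x)\<^sup>2 \<partial>halfline)" by (rule norm_abs_l2_sq[OF k])
    also have "\<dots> \<le> (\<integral>x. C\<^sup>2 * indicator A x \<partial>halfline)"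
    proof (intro integral_mono)
      fix x assume "x \<in> space halfline"
      hence "\<bar>hankel_kernel a (x * y)\<bar>\<^sup>2 \<le> C\<^sup>2" using C[of "x * y"] y by (intro power_mono) auto
      thus "(k x)\<^sup>2 \<le> C\<^sup>2 * indicator A x" by (simp add: k_def indicator_def)
    qed (use k indicator_L1_L2(1)[OF A] in \<open>auto simp: sq_int_def\<close>)
    also have "\<dots> \<le> C\<^sup>2 * measure lebesgue A"
      using indicator_L1_L2(3)[OF A] by (simp add: mult_left_mono)
    finally show ?thesis .
  qed
  have "(\<Sum>b\<in>B. (norm (restrict_l2 S (hankel_l2 a b)))\<^sup>2) =
      (\<Sum>b\<in>B. \<integral>y. (indicator S y * hankel a (f b) y)\<^sup>2 \<partial>halfline)"
  proof (intro sum.cong refl)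
    fix b assume "b \<in> B"
    have "hankel_l2 a b = abs_l2 (hankel a (f b))"
      using hankel_l2_abs[OF a f, of b] absf[OF \<open>b \<in> B\<close>] by simp
    thus "(norm (restrict_l2 S (hankel_l2 a b)))\<^sup>2 = (\<integral>y. (indicator S y * hankel a (f b) y)\<^sup>2 \<partial>halfline)"
      by (simp add: restrict_abs_l2[OF Sl h] norm_abs_l2_sq sq_int_indicator[OF h Sl])
  qed
  also have "\<dots> = (\<integral>y. (\<Sum>b\<in>B. (indicator S y * hankel a (f b) y)\<^sup>2) \<partial>halfline)"
    using sq_int_indicator[OF h Sl] by (intro Bochner_Integration.integral_sum[symmetric]) (auto simp: sq_int_def)
  also have "\<dots> \<le> (\<integral>y. C\<^sup>2 * measure lebesgue A * indicator S y \<partial>halfline)"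
  proof (intro integral_mono)
    fix y assume "y \<in> space halfline"
    hence "(\<Sum>b\<in>B. (hankel a (f b) y)\<^sup>2) \<le> C\<^sup>2 * measure lebesgue A" by (intro pw) auto
    thus "(\<Sum>b\<in>B. (indicator S y * hankel a (f b) y)\<^sup>2) \<le> C\<^sup>2 * measure lebesgue A * indicator S y"
      by (auto simp: indicator_def)
  next
    show "integrable halfline (\<lambda>y. \<Sum>b\<in>B. (indicator S y * hankel a (f b) y)\<^sup>2)"
      using sq_int_indicator[OF h Sl] by (intro Bochner_Integration.integrable_sum) (auto simp: sq_int_def)
  qed (use indicator_L1_L2(1)[OF S] in auto)
  also have "\<dots> \<le> C\<^sup>2 * measure lebesgue A * measure lebesgue S"
    using indicator_L1_L2(3)[OF S] by (simp add: mult_left_mono)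
  finally show ?thesis .
qed

section \<open>Weak and strong annihilation\<close>

lemma lebesgue_measurable_times: "(\<lambda>x::real. c * x) \<in> lebesgue \<rightarrow>\<^sub>M lebesgue"
proof -
  have e: "(\<lambda>x::real. c * x) = (*\<^sub>R) c" by (simp add: fun_eq_iff)
  show ?thesis unfolding e by (rule lebesgue_measurable_scaling)
qed

lemma scale_vimage_lebesgue:
  assumes A: "A \<in> sets lebesgue" and c: "c > 0"
  shows "(\<lambda>x::real. c * x) -` A \<in> sets lebesgue"
    "emeasure lebesgue A = ennreal c * emeasure lebesgue ((\<lambda>x. c * x) -` A)"
proof -
  show s: "(\<lambda>x::real. c * x) -` A \<in> sets lebesgue"
    using measurable_sets[OF lebesgue_measurable_times A, of c] by simp
  have "emeasure lebesgue A = (\<integral>\<^sup>+x. indicator A x \<partial>lebesgue)" using A by simp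
  also have "\<dots> = ennreal \<bar>c\<bar> * (\<integral>\<^sup>+x. indicator A (0 + c * x) \<partial>lebesgue)"
    using A c by (intro nn_integral_real_affine_lebesgue) auto
  also have "(\<lambda>x. indicator A (0 + c * x) :: ennreal) = indicator ((\<lambda>x. c * x) -` A)"
    by (auto simp: indicator_def)
  finally show "emeasure lebesgue A = ennreal c * emeasure lebesgue ((\<lambda>x. c * x) -` A)"
    using s c by simp
qed

lemma scale_vimage_lmeasurable:
  assumes A: "A \<in> lmeasurable" and c: "c > 0"
  shows "(\<lambda>x::real. c * x) -` A \<in> lmeasurable"
    "measure lebesgue A = c * measure lebesgue ((\<lambda>x. c * x) -` A)"
proof -
  have Al: "A \<in> sets lebesgue" using A by auto
  note s = scale_vimage_lebesgue[OF Al c]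
  have "ennreal c * emeasure lebesgue ((\<lambda>x. c * x) -` A) < \<infinity>"
    using A s(2) by (simp add: fmeasurable_def)
  hence "emeasure lebesgue ((\<lambda>x. c * x) -` A) < \<infinity>"
    using c by (auto simp: ennreal_mult_less_top)
  thus "(\<lambda>x::real. c * x) -` A \<in> lmeasurable" using s(1) by (simp add: fmeasurable_def)
  show "measure lebesgue A = c * measure lebesgue ((\<lambda>x. c * x) -` A)"
    unfolding measure_def s(2) using c by (simp add: enn2real_mult)
qed

lemma AE_halfline_scale:
  assumes P: "AE x in halfline. P x" and c: "c > 0"
  shows "AE x in halfline. P (c * x)"
proof -
  have "AE x in lebesgue. x \<ge> 0 \<longrightarrow> P x" using P by (simp add: AE_halfline_iff)
  then obtain N where N: "{x. \<not> (x \<ge> 0 \<longrightarrow> P x)} \<subseteq> N" "emeasure lebesgue N = 0" "N \<in> sets lebesgue"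
    by (auto elim!: AE_E)
  have "ennreal c * emeasure lebesgue ((\<lambda>x. c * x) -` N) = 0"
    using scale_vimage_lebesgue(2)[OF N(3) c] N(2) by simp
  hence "emeasure lebesgue ((\<lambda>x. c * x) -` N) = 0" using c by simp
  hence "(\<lambda>x. c * x) -` N \<in> null_sets lebesgue"
    using scale_vimage_lebesgue(1)[OF N(3) c] by (simp add: null_sets_def)
  hence "AE x in lebesgue. x \<notin> (\<lambda>x. c * x) -` N" by (rule AE_not_in)
  thus ?thesis unfolding AE_halfline_iff
  proof eventually_elim
    fix x assume x: "x \<notin> (\<lambda>x. c * x) -` N"
    show "0 \<le> x \<longrightarrow> P (c * x)"
    proof
      assume "0 \<le> x"
      hence "0 \<le> c * x" using c by simp
      thus "P (c * x)" using subsetD[OF N(1), of "c * x"] x by auto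
    qed
  qed
qed

lemma measurable_halfline_scale:
  assumes "c > 0" shows "(\<lambda>x. c * x) \<in> halfline \<rightarrow>\<^sub>M halfline"
  using assms by (intro measurable_restrict_space3 lebesgue_measurable_times) auto

lemma halfline_scale:
  fixes f :: "real \<Rightarrow> real"
  assumes c: "c > 0"
  shows "integrable halfline f \<Longrightarrow> integrable halfline (\<lambda>x. f (c * x))"
    "(\<integral>x. f (c * x) \<partial>halfline) = (\<integral>x. f x \<partial>halfline) / c"
proof -
  have e: "indicator {0..} (c * x) = (indicator {0..} x :: real)" for x
    using c by (auto simp: indicator_def zero_le_mult_iff)
  have i: "integrable halfline f \<longleftrightarrow> integrable lebesgue (\<lambda>x. indicator {0..} x *\<^sub>R f x)" for f :: "real \<Rightarrow> real"
    by (subst integrable_restrict_space) auto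
  have I: "(\<integral>x. f x \<partial>halfline) = (\<integral>x. indicator {0..} x *\<^sub>R f x \<partial>lebesgue)" for f :: "real \<Rightarrow> real"
    by (subst integral_restrict_space) auto
  show "integrable halfline (\<lambda>x. f (c * x))" if "integrable halfline f"
    using lebesgue_integrable_real_affine[of "\<lambda>x. indicator {0..} x *\<^sub>R f x" c 0] that c
    unfolding i by (simp add: e)
  show "(\<integral>x. f (c * x) \<partial>halfline) = (\<integral>x. f x \<partial>halfline) / c"
    using lebesgue_integral_real_affine[of c "\<lambda>x. indicator {0..} x *\<^sub>R f x" 0] c
    unfolding I by (simp add: e)
qed

lemma sq_int_scale_arg:
  assumes "sq_int f" "c > 0" shows "sq_int (\<lambda>x. f (c * x))"
  using assms halfline_scale(1)[of c "\<lambda>x. (f x)\<^sup>2"] measurable_compose[OF measurable_halfline_scale[of c], of f borel]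
  by (auto simp: sq_int_def)

text \<open>The kernel sees only the product of the variables, so a factor moved from
  \<open>x\<close> to \<open>y\<close> is inverted; the division by \<open>c\<close> is the
  Jacobian.\<close>

lemma hankel_scale_arg:
  assumes "c > 0"
  shows "hankel a (\<lambda>x. f (c * x)) y = hankel a f (1 / c * y) / c"
  unfolding hankel_def
  using halfline_scale(2)[OF assms, of "\<lambda>x. f x * hankel_kernel a (x * (1 / c * y))"] assms
  by (simp add: mult_ac)

text \<open>Not normalised to preserve norms: only supports and linear independence of dilates are
  of interest.\<close>

definition dilate_l2 :: "real \<Rightarrow> l2 \<Rightarrow> l2" where
  "dilate_l2 c u = abs_l2 (\<lambda>x. rep_l2 u (c * x))"

text \<open>Supports are defined only up to null sets, so they are expressed as fixed points of
  restrictions. The set is a subspace, and weak annihilation says that it is trivial.\<close>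

definition annihilated :: "real \<Rightarrow> real set \<Rightarrow> real set \<Rightarrow> l2 set" where
  "annihilated a A S = {u. restrict_l2 A u = u \<and> restrict_l2 S (hankel_l2 a u) = hankel_l2 a u}"

lemma restrict_l2_fixed_mono:
  assumes "restrict_l2 A u = u" "A \<subseteq> A'" "A \<in> sets lebesgue" "A' \<in> sets lebesgue"
  shows "restrict_l2 A' u = u"
  using assms by (auto simp: restrict_l2_fixed_iff elim!: AE_mp)

lemma annihilated_mono:
  assumes "A \<subseteq> A'" "S \<subseteq> S'" "A \<in> lmeasurable" "S \<in> lmeasurable" "A' \<in> lmeasurable" "S' \<in> lmeasurable"
  shows "annihilated a A S \<subseteq> annihilated a A' S'"
  using assms by (auto simp: annihilated_def intro!: restrict_l2_fixed_mono[of A _ A'] restrict_l2_fixed_mono[of S _ S'])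

lemma subspace_restrict_fixed:
  assumes "A \<in> sets lebesgue"
  shows "subspace {u. restrict_l2 A u = u}"
proof -
  interpret R: bounded_linear "restrict_l2 A" by (rule bounded_linear_restrict_l2[OF assms])
  show ?thesis by (auto simp: subspace_def R.zero R.add R.scaleR)
qed

lemma closed_restrict_fixed:
  assumes "A \<in> sets lebesgue"
  shows "closed {u. restrict_l2 A u = u}"
  by (intro closed_Collect_eq linear_continuous_on bounded_linear_restrict_l2 assms continuous_on_id)

lemma subspace_annihilated:
  assumes a: "a > -1/2" and A: "A \<in> sets lebesgue" and S: "S \<in> sets lebesgue"
  shows "subspace (annihilated a A S)"
proof -
  interpret R: bounded_linear "restrict_l2 A" by (rule bounded_linear_restrict_l2[OF A])
  interpret T: bounded_linear "restrict_l2 S" by (rule bounded_linear_restrict_l2[OF S])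
  interpret H: bounded_linear "hankel_l2 a" by (rule hankel_l2_isometry[OF a])
  show ?thesis unfolding annihilated_def
    by (auto simp: subspace_def R.zero R.add R.scaleR T.zero T.add T.scaleR H.zero H.add H.scaleR)
qed

text \<open>A square integrable function on a set of finite measure is integrable. So its transform
  is given by the integral and \<open>hankel_scale_arg\<close> carries the support over.\<close>

lemma annihilated_dilate:
  assumes a: "a > -1/2" and A: "A \<in> lmeasurable" and S: "S \<in> lmeasurable"
    and u: "u \<in> annihilated a A S" and c: "c > 0"
  shows "dilate_l2 c u \<in> annihilated a ((\<lambda>x. c * x) -` A) ((\<lambda>x. 1 / c * x) -` S)"
proof -
  have Al: "A \<in> sets lebesgue" and Sl: "S \<in> sets lebesgue" using A S by auto
  have c': "1 / c > 0" using c by simp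
  define f where "f = (\<lambda>x. indicator A x * rep_l2 u x)"
  have f: "integrable halfline f" "sq_int f"
    unfolding f_def by (intro indicator_mult_integrable sq_int_indicator sq_int_rep A Al)+
  have uf: "u = abs_l2 f" using u by (simp add: annihilated_def restrict_l2_def f_def)
  have fc: "integrable halfline (\<lambda>x. f (c * x))" "sq_int (\<lambda>x. f (c * x))"
    by (rule halfline_scale(1)[OF c f(1)], rule sq_int_scale_arg[OF f(2) c])
  have "AE x in halfline. rep_l2 u (c * x) = f (c * x)"
    unfolding uf by (rule AE_halfline_scale[OF rep_abs_l2[OF f(2)] c])
  hence d: "dilate_l2 c u = abs_l2 (\<lambda>x. f (c * x))"
    unfolding dilate_l2_def by (subst abs_l2_eq_iff[OF sq_int_scale_arg[OF sq_int_rep c] fc(2)])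
  have "AE y in halfline. y \<notin> S \<longrightarrow> hankel a f y = 0"
    using u hankel_l2_abs[OF a f] unfolding uf annihilated_def
    by (simp add: restrict_l2_fixed_abs_iff[OF Sl hankel_isometry(1)[OF a f]])
  hence "AE y in halfline. 1 / c * y \<notin> S \<longrightarrow> hankel a f (1 / c * y) = 0"
    by (rule AE_halfline_scale[OF _ c'])
  hence "AE y in halfline. y \<notin> (\<lambda>x. 1 / c * x) -` S \<longrightarrow> hankel a (\<lambda>x. f (c * x)) y = 0"
    using c by (simp add: hankel_scale_arg[OF c])
  hence "restrict_l2 ((\<lambda>x. 1 / c * x) -` S) (hankel_l2 a (dilate_l2 c u)) = hankel_l2 a (dilate_l2 c u)"
    unfolding d hankel_l2_abs[OF a fc]
    by (subst restrict_l2_fixed_abs_iff[OF scale_vimage_lebesgue(1)[OF Sl c'] hankel_isometry(1)[OF a fc]])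
  moreover have "restrict_l2 ((\<lambda>x. c * x) -` A) (dilate_l2 c u) = dilate_l2 c u"
    unfolding d by (subst restrict_l2_fixed_abs_iff[OF scale_vimage_lebesgue(1)[OF Al c] fc(2)])
      (simp add: f_def)
  ultimately show ?thesis by (simp add: annihilated_def)
qed

section \<open>Measure of a set and its dilates by factors close to 1\<close>

lemma lmeasurable_inner_compact_approx:
  fixes A :: "real set"
  assumes A: "A \<in> lmeasurable" and e: "e > 0"
  obtains K where "compact K" "K \<subseteq> A" "A - K \<in> lmeasurable" "emeasure lebesgue (A - K) < ennreal e"
proof -
  have Al: "A \<in> sets lebesgue" using A by auto
  obtain T where T: "closed T" "T \<subseteq> A" "A - T \<in> lmeasurable" "emeasure lebesgue (A - T) < ennreal (e / 2)"
    using sets_lebesgue_inner_closed[OF Al, of "e / 2"] e by auto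
  have D: "A - cball 0 (real n) \<in> lmeasurable" for n by (intro fmeasurable.Diff A) auto
  have L: "(\<lambda>n. emeasure lebesgue (A - cball 0 (real n))) \<longlonglongrightarrow> emeasure lebesgue (\<Inter>n. A - cball 0 (real n))"
  proof (rule Lim_emeasure_decseq)
    show "range (\<lambda>n. A - cball 0 (real n)) \<subseteq> sets lebesgue" using D by auto
    show "decseq (\<lambda>n. A - cball 0 (real n))" by (auto simp: decseq_def)
    show "emeasure lebesgue (A - cball 0 (real n)) \<noteq> \<infinity>" for n
      using D[of n] by (auto simp: fmeasurable_def)
  qed
  have empty: "(\<Inter>n. A - cball 0 (real n)) = {}"
    using real_arch_simple by auto
  have "(\<lambda>n. emeasure lebesgue (A - cball 0 (real n))) \<longlonglongrightarrow> 0"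
    using L unfolding empty emeasure_empty .
  hence "\<forall>\<^sub>F n in sequentially. emeasure lebesgue (A - cball 0 (real n)) < ennreal (e / 2)"
    using e by (intro order_tendstoD) auto
  then obtain n where n: "emeasure lebesgue (A - cball 0 (real n)) < ennreal (e / 2)"
    by (auto simp: eventually_sequentially)
  show ?thesis
  proof
    show "compact (T \<inter> cball 0 (real n))" using T(1) by (intro closed_Int_compact) auto
    show "T \<inter> cball 0 (real n) \<subseteq> A" using T(2) by auto
    have eq: "A - T \<inter> cball 0 (real n) = (A - T) \<union> (A - cball 0 (real n))" by auto
    show "A - T \<inter> cball 0 (real n) \<in> lmeasurable"
      unfolding eq by (rule fmeasurable.Un[OF T(3) D])
    have "emeasure lebesgue (A - T \<inter> cball 0 (real n)) \<le>
        emeasure lebesgue (A - T) + emeasure lebesgue (A - cball 0 (real n))"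
      unfolding eq using T(3) D[of n] by (intro emeasure_subadditive) auto
    also have "\<dots> < ennreal (e / 2) + ennreal (e / 2)" by (rule add_strict_mono[OF T(4) n])
    also have "\<dots> = ennreal e" using e by (simp flip: ennreal_plus)
    finally show "emeasure lebesgue (A - T \<inter> cball 0 (real n)) < ennreal e" .
  qed
qed

text \<open>Squeeze \<open>A\<close> between a compact \<open>K\<close> and an open
  \<open>U\<close>. For \<open>c\<close> near 1 the preimage of \<open>K\<close> stays inside
  \<open>U\<close>, so the union exceeds \<open>A\<close> at most by a part of \<open>U - A\<close>
  and by the preimage of \<open>A - K\<close>.\<close>

lemma scale_vimage_continuity:
  fixes A :: "real set"
  assumes A: "A \<in> lmeasurable" and e: "e > 0"
  obtains d where "d > 0" "\<And>c. \<bar>c - 1\<bar> < d \<Longrightarrow> measure lebesgue (A \<union> (\<lambda>x. c * x) -` A) \<le> measure lebesgue A + e"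
proof -
  have Al: "A \<in> sets lebesgue" using A by auto
  \<comment> \<open>For \<open>c > 1/2\<close> a preimage has at most twice the measure, hence
    \<open>e / 4\<close> here against \<open>e / 2\<close> for the outer set.\<close>
  obtain K where K: "compact K" "K \<subseteq> A" "A - K \<in> lmeasurable" "emeasure lebesgue (A - K) < ennreal (e / 4)"
    using lmeasurable_inner_compact_approx[OF A, of "e / 4"] e by auto
  obtain U where U: "open U" "A \<subseteq> U" "U - A \<in> lmeasurable" "emeasure lebesgue (U - A) < ennreal (e / 2)"
    using sets_lebesgue_outer_open[OF Al, of "e / 2"] e by auto
  have mK: "measure lebesgue (A - K) < e / 4" and mU: "measure lebesgue (U - A) < e / 2"
    using K(3,4) U(3,4) e by (auto simp: emeasure_eq_measure2 ennreal_less_iff)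
  obtain t where t: "t > 0" "(\<Union>x\<in>K. ball x t) \<subseteq> U"
    using compact_subset_open_imp_ball_epsilon_subset[OF K(1) U(1)] K(2) U(2) by auto
  obtain R where R: "R > 0" "\<And>x. x \<in> K \<Longrightarrow> \<bar>x\<bar> \<le> R"
    using compact_imp_bounded[OF K(1)] by (auto simp: bounded_pos)
  show ?thesis
  proof
    show "min (1/2) (t / (2 * R)) > 0" using t R by simp
    fix c :: real assume c: "\<bar>c - 1\<bar> < min (1/2) (t / (2 * R))"
    hence "\<bar>c - 1\<bar> < 1/2" by simp
    hence c2: "c > 1/2" by linarith
    hence c0: "c > 0" by simp
    have sub: "A \<union> (\<lambda>x. c * x) -` A \<subseteq> A \<union> ((\<lambda>x. c * x) -` (A - K) \<union> (U - A))"
    proof -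
      \<comment> \<open>The point with a known bound is \<open>c * x\<close>, an element of
        \<open>K\<close>, and not \<open>x\<close>; this is why the estimate is multiplied by
        \<open>c\<close>.\<close>
      have "x \<in> U" if x: "c * x \<in> K" for x
      proof -
        have "c * x - x = (c - 1) * x" by (simp add: algebra_simps)
        hence "c * \<bar>c * x - x\<bar> = \<bar>c * x\<bar> * \<bar>c - 1\<bar>"
          using c0 by (simp add: abs_mult)
        also have "\<dots> \<le> R * \<bar>c - 1\<bar>" using R(2)[OF x] by (intro mult_right_mono) auto
        also have "\<dots> < R * (t / (2 * R))" using c R(1) by (intro mult_strict_left_mono) auto
        also have "\<dots> = t / 2" using R(1) by simp
        also have "\<dots> \<le> c * t" using c2 t(1) by simp
        finally have "\<bar>c * x - x\<bar> < t" using c0 by simp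
        hence "x \<in> ball (c * x) t" by (simp add: dist_real_def)
        thus ?thesis using t(2) x by blast
      qed
      thus ?thesis by auto
    qed
    have V: "(\<lambda>x. c * x) -` (A - K) \<in> lmeasurable"
      "measure lebesgue (A - K) = c * measure lebesgue ((\<lambda>x. c * x) -` (A - K))"
      by (rule scale_vimage_lmeasurable[OF K(3) c0])+
    have "1/2 * measure lebesgue ((\<lambda>x. c * x) -` (A - K)) \<le> e / 4"
      using V(2) mK c2 mult_right_mono[of "1/2" c "measure lebesgue ((\<lambda>x. c * x) -` (A - K))"] by simp
    hence mV: "measure lebesgue ((\<lambda>x. c * x) -` (A - K)) \<le> e / 2" by simp
    have "measure lebesgue (A \<union> (\<lambda>x. c * x) -` A) \<le> measure lebesgue (A \<union> ((\<lambda>x. c * x) -` (A - K) \<union> (U - A)))"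
      using sub A V(1) U(3) scale_vimage_lebesgue(1)[OF Al c0]
      by (intro measure_mono_fmeasurable) auto
    also have "\<dots> \<le> measure lebesgue A + (measure lebesgue ((\<lambda>x. c * x) -` (A - K)) + measure lebesgue (U - A))"
      using A V(1) U(3) by (intro order_trans[OF measure_Un_le] add_left_mono measure_Un_le) auto
    also have "\<dots> \<le> measure lebesgue A + e" using mV mU by simp
    finally show "measure lebesgue (A \<union> (\<lambda>x. c * x) -` A) \<le> measure lebesgue A + e" .
  qed
qed

text \<open>A contraction of the variable enlarges the joint support strictly in measure, so one of the
  dilates leaves the span.\<close>

lemma dilate_not_in_span:
  assumes B: "finite B" "independent B" "B \<noteq> {}" and A: "A \<in> lmeasurable"
    and BA: "\<And>b. b \<in> B \<Longrightarrow> restrict_l2 A b = b" and c: "0 < c" "c < 1"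
  obtains b where "b \<in> B" "dilate_l2 c b \<notin> span B"
proof -
  \<comment> \<open>The joint support of the members of \<open>B\<close>. The intersection with
    \<open>A\<close> changes it by a null set only and makes its measure evidently finite.\<close>
  define Z where "Z = A \<inter> (\<Union>b\<in>B. {x \<in> space halfline. rep_l2 b x \<noteq> 0})"
  have Al: "A \<in> sets lebesgue" using A by auto
  have "{x \<in> space halfline. rep_l2 b x \<noteq> 0} \<in> sets lebesgue" for b
  proof -
    have [measurable]: "rep_l2 b \<in> borel_measurable halfline" by (rule sq_int_measurable[OF sq_int_rep])
    have "{x \<in> space halfline. rep_l2 b x \<noteq> 0} \<in> sets halfline" by measurable
    thus ?thesis by (subst (asm) sets_restrict_space_iff) auto
  qed
  hence Z: "Z \<in> lmeasurable"
    unfolding Z_def using A B(1) by (intro fmeasurable_Int_fmeasurable sets.finite_UN) auto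
  hence Zl: "Z \<in> sets lebesgue" by auto
  have vZ: "(\<lambda>x. 1 / c * x) -` Z \<in> lmeasurable" "measure lebesgue Z = 1 / c * measure lebesgue ((\<lambda>x. 1 / c * x) -` Z)"
    using c by (intro scale_vimage_lmeasurable Z; simp)+
  have off: "AE x in halfline. x \<notin> Z \<longrightarrow> rep_l2 b x = 0" if "b \<in> B" for b
    using BA[OF that] AE_space[of halfline] unfolding restrict_l2_fixed_iff[OF Al]
    by eventually_elim (use that in \<open>auto simp: Z_def\<close>)
  \<comment> \<open>If all dilates vanished off \<open>Z\<close>, rescaling by \<open>1 / c\<close>
    would put \<open>Z\<close>, up to a null set, inside a copy of itself of measure
    \<open>c\<close> times as large. Then \<open>Z\<close> would be null and the members of
    \<open>B\<close> would be 0.\<close>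
  have "\<exists>b\<in>B. \<not> (AE x in halfline. x \<notin> Z \<longrightarrow> rep_l2 b (c * x) = 0)"
  proof (rule ccontr)
    assume "\<not> ?thesis"
    hence "AE x in halfline. 1 / c * x \<notin> Z \<longrightarrow> rep_l2 b (c * (1 / c * x)) = 0" if "b \<in> B" for b
      using that c by (intro AE_halfline_scale[where c = "1 / c"]) auto
    hence "AE x in halfline. \<forall>b\<in>B. 1 / c * x \<notin> Z \<longrightarrow> rep_l2 b x = 0"
      using B(1) c by (intro AE_finite_allI) auto
    hence "AE x in lebesgue. x \<in> Z \<longrightarrow> x \<in> (\<lambda>x. 1 / c * x) -` Z"
      unfolding AE_halfline_iff by eventually_elim (auto simp: Z_def)
    hence "emeasure lebesgue Z \<le> emeasure lebesgue ((\<lambda>x. 1 / c * x) -` Z)"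
      using vZ(1) by (intro emeasure_mono_AE) auto
    hence "measure lebesgue Z \<le> measure lebesgue ((\<lambda>x. 1 / c * x) -` Z)"
      using Z vZ(1) by (simp add: emeasure_eq_measure2)
    also have "\<dots> = c * measure lebesgue Z" using vZ(2) c by simp
    finally have "(1 - c) * measure lebesgue Z \<le> 0" by (simp add: left_diff_distrib)
    hence "measure lebesgue Z = 0" using c by (simp add: mult_le_0_iff measure_le_0_iff)
    hence "emeasure lebesgue Z = 0" using Z by (simp add: emeasure_eq_measure2)
    hence "Z \<in> null_sets lebesgue" using Zl by (simp add: null_sets_def)
    hence nZ: "AE x in halfline. x \<notin> Z"
      unfolding AE_halfline_iff using AE_not_in[of Z lebesgue] by (auto elim!: AE_mp)
    obtain b where b: "b \<in> B" using B(3) by blast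
    have "AE x in halfline. rep_l2 b x = rep_l2 0 x"
      using off[OF b] nZ rep_l2_zero by eventually_elim auto
    hence "b = 0" by (rule l2_eqI)
    thus False using b B(2) dependent_zero by blast
  qed
  then obtain b where b: "b \<in> B" "\<not> (AE x in halfline. x \<notin> Z \<longrightarrow> rep_l2 b (c * x) = 0)" by blast
  have "dilate_l2 c b \<notin> span B"
  proof
    assume "dilate_l2 c b \<in> span B"
    \<comment> \<open>Vanishing off \<open>Z\<close> is preserved by linear combinations, so a
      dilate that does not vanish there cannot lie in the span.\<close>
    moreover have "span B \<subseteq> {u. restrict_l2 Z u = u}"
      using off by (intro span_minimal subspace_restrict_fixed Zl) (auto simp: restrict_l2_fixed_iff[OF Zl])
    ultimately have "restrict_l2 Z (dilate_l2 c b) = dilate_l2 c b" by auto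
    hence "AE x in halfline. x \<notin> Z \<longrightarrow> rep_l2 b (c * x) = 0"
      unfolding dilate_l2_def by (subst (asm) restrict_l2_fixed_abs_iff[OF Zl sq_int_scale_arg[OF sq_int_rep c(1)]])
    thus False using b(2) by simp
  qed
  thus ?thesis using that b(1) by blast
qed

text \<open>Each step adjoins one dilate and enlarges both sets. The quantifier over
  \<open>e\<close> is inside the induction so that a step can spend half of it on the earlier sets
  and half on the new enlargement; the total stays below \<open>e\<close> however large the
  dimension.\<close>

lemma annihilated_large_dimension:
  assumes a: "a > -1/2" and A: "A \<in> lmeasurable" and S: "S \<in> lmeasurable"
    and u: "u \<in> annihilated a A S" "u \<noteq> 0"
  shows "\<forall>e>0. \<exists>B A' S'. finite B \<and> independent B \<and> card B = Suc n \<and> A' \<in> lmeasurable \<and> S' \<in> lmeasurable \<and>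
    measure lebesgue A' \<le> measure lebesgue A + e \<and> measure lebesgue S' \<le> measure lebesgue S + e \<and>
    B \<subseteq> annihilated a A' S'"
proof (induction n)
  case 0
  show ?case
    using A S u by (intro allI impI exI[of _ "{u}"] exI[of _ A] exI[of _ S]) (auto simp: dependent_single)
next
  case (Suc n)
  show ?case
  proof (intro allI impI)
    fix e :: real assume e: "e > 0"
    then obtain B A' S' where B: "finite B" "independent B" "card B = Suc n"
      and A': "A' \<in> lmeasurable" "measure lebesgue A' \<le> measure lebesgue A + e / 2"
      and S': "S' \<in> lmeasurable" "measure lebesgue S' \<le> measure lebesgue S + e / 2"
      and BN: "B \<subseteq> annihilated a A' S'"
      using Suc.IH[rule_format, of "e / 2"] by auto
    obtain d1 where d1: "d1 > 0" "\<And>c. \<bar>c - 1\<bar> < d1 \<Longrightarrow>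
        measure lebesgue (A' \<union> (\<lambda>x. c * x) -` A') \<le> measure lebesgue A' + e / 2"
      using scale_vimage_continuity[OF A'(1), of "e / 2"] e by auto
    obtain d2 where d2: "d2 > 0" "\<And>c. \<bar>c - 1\<bar> < d2 \<Longrightarrow>
        measure lebesgue (S' \<union> (\<lambda>x. c * x) -` S') \<le> measure lebesgue S' + e / 2"
      using scale_vimage_continuity[OF S'(1), of "e / 2"] e by auto
    \<comment> \<open>One factor has to serve both sides: \<open>c\<close> must be close to 1 for
      the functions and \<open>1 / c\<close> for the transforms. With \<open>c = 1 / (1 + h)\<close>
      the deviations are \<open>c * h\<close> and \<open>h\<close>.\<close>
    define h where "h = min d1 d2 / 2"
    have h: "h > 0" "h < d1" "h < d2" using d1(1) d2(1) by (auto simp: h_def)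
    define c where "c = 1 / (1 + h)"
    have c: "0 < c" "c < 1" "1 / c = 1 + h" using h by (auto simp: c_def)
    have "\<bar>c - 1\<bar> = c * h" using h by (simp add: c_def field_simps)
    also have "\<dots> \<le> 1 * h" using c h by (intro mult_right_mono) auto
    also have "\<dots> < d1" using h by simp
    finally have cd1: "\<bar>c - 1\<bar> < d1" .
    have cd2: "\<bar>1 / c - 1\<bar> < d2" using c h by simp
    define A2 S2 where "A2 = A' \<union> (\<lambda>x. c * x) -` A'" and "S2 = S' \<union> (\<lambda>x. 1 / c * x) -` S'"
    have vA: "(\<lambda>x. c * x) -` A' \<in> lmeasurable" by (rule scale_vimage_lmeasurable[OF A'(1) c(1)])
    have vS: "(\<lambda>x. 1 / c * x) -` S' \<in> lmeasurable" using c(1) by (intro scale_vimage_lmeasurable S'(1)) simp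
    have m: "A2 \<in> lmeasurable" "S2 \<in> lmeasurable"
      unfolding A2_def S2_def by (intro fmeasurable.Un A'(1) S'(1) vA vS)+
    have "B \<noteq> {}" using B(3) by auto
    then obtain b where b: "b \<in> B" "dilate_l2 c b \<notin> span B"
      using dilate_not_in_span[OF B(1,2) _ A'(1) _ c(1,2)] BN by (auto simp: annihilated_def)
    have "dilate_l2 c b \<in> annihilated a ((\<lambda>x. c * x) -` A') ((\<lambda>x. 1 / c * x) -` S')"
      using b(1) BN by (intro annihilated_dilate[OF a A'(1) S'(1) _ c(1)]) auto
    also have "\<dots> \<subseteq> annihilated a A2 S2"
      by (rule annihilated_mono) (use vA vS m in \<open>auto simp: A2_def S2_def\<close>)
    finally have 1: "dilate_l2 c b \<in> annihilated a A2 S2" .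
    have "annihilated a A' S' \<subseteq> annihilated a A2 S2"
      by (rule annihilated_mono) (use A'(1) S'(1) m in \<open>auto simp: A2_def S2_def\<close>)
    hence 2: "insert (dilate_l2 c b) B \<subseteq> annihilated a A2 S2" using BN 1 by auto
    have 3: "independent (insert (dilate_l2 c b) B)" using B(2) b(2) by (rule independent_insertI[rotated])
    have "dilate_l2 c b \<notin> B" using b(2) span_base by blast
    hence 4: "card (insert (dilate_l2 c b) B) = Suc (Suc n)" using B by simp
    have 5: "measure lebesgue A2 \<le> measure lebesgue A + e" "measure lebesgue S2 \<le> measure lebesgue S + e"
      using d1(2)[OF cd1] d2(2)[OF cd2] A'(2) S'(2) by (auto simp: A2_def S2_def)
    show "\<exists>B A' S'. finite B \<and> independent B \<and> card B = Suc (Suc n) \<and> A' \<in> lmeasurable \<and> S' \<in> lmeasurable \<and>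
      measure lebesgue A' \<le> measure lebesgue A + e \<and> measure lebesgue S' \<le> measure lebesgue S + e \<and>
      B \<subseteq> annihilated a A' S'"
      by (rule exI[of _ "insert (dilate_l2 c b) B"], rule exI[of _ A2], rule exI[of _ S2])
        (intro conjI 2 3 4 5 m finite.insertI B(1))
  qed
qed

text \<open>On \<open>annihilated a A' S'\<close> the compressed operator preserves norms, so every
  orthonormal family there contributes its cardinality to the Hilbert-Schmidt sum.\<close>

lemma weakly_annihilating:
  assumes a: "a > -1/2" and A: "A \<in> lmeasurable" and S: "S \<in> lmeasurable"
    and u: "u \<in> annihilated a A S"
  shows "u = 0"
proof (rule ccontr)
  assume "u \<noteq> 0"
  obtain C where C: "\<And>t. t \<ge> 0 \<Longrightarrow> \<bar>hankel_kernel a t\<bar> \<le> C"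
    using hankel_kernel_bounded[OF a] by metis
  \<comment> \<open>A bound for all enlarged pairs with \<open>e = 1\<close>, fixed before the
    dimension is chosen.\<close>
  define K where "K = C\<^sup>2 * (measure lebesgue A + 1) * (measure lebesgue S + 1)"
  obtain n :: nat where n: "real n \<ge> K" using real_arch_simple by blast
  obtain B A' S' where B: "finite B" "independent B" "card B = Suc n"
    and A': "A' \<in> lmeasurable" "measure lebesgue A' \<le> measure lebesgue A + 1"
    and S': "S' \<in> lmeasurable" "measure lebesgue S' \<le> measure lebesgue S + 1"
    and BN: "B \<subseteq> annihilated a A' S'"
    using annihilated_large_dimension[OF a A S u \<open>u \<noteq> 0\<close>, of n] zero_less_one by blast
  obtain E where E: "finite E" "orthonormal E" "card B \<le> card E" "E \<subseteq> span B"
    using orthonormal_in_span[OF B(1,2)] by blast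
  have "span B \<subseteq> annihilated a A' S'"
    using A'(1) S'(1) by (intro span_minimal BN subspace_annihilated a) auto
  hence EN: "E \<subseteq> annihilated a A' S'" using E(4) by blast
  have "(\<Sum>b\<in>E. (norm (restrict_l2 S' (hankel_l2 a b)))\<^sup>2) = (\<Sum>b\<in>E. 1)"
    using EN E(2) by (intro sum.cong refl) (auto simp: annihilated_def hankel_l2_isometry(2)[OF a] orthonormal_def)
  hence "real (card E) = (\<Sum>b\<in>E. (norm (restrict_l2 S' (hankel_l2 a b)))\<^sup>2)" by simp
  also have "\<dots> \<le> C\<^sup>2 * measure lebesgue A' * measure lebesgue S'"
    using EN by (intro hankel_l2_hilbert_schmidt[OF a C A'(1) S'(1) E(1,2)]) (auto simp: annihilated_def)
  also have "\<dots> \<le> K" unfolding K_def using A'(2) S'(2) by (intro mult_mono) auto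
  finally show False using n E(3) B(3) by linarith
qed

text \<open>The coercive estimate covers only functions living on \<open>A\<close>. A general
  \<open>u\<close> is replaced by its restriction \<open>v\<close>; the error \<open>u - v\<close>
  is transformed isometrically and can at most double when the part on \<open>S\<close> is
  subtracted. This gives \<open>norm v \<le> 2 * C * (x + y)\<close>, and one more \<open>x\<close>
  for passing back to \<open>u\<close>.\<close>

lemma strongly_annihilating:
  assumes a: "a > -1/2" and A: "A \<in> lmeasurable" and S: "S \<in> lmeasurable"
  obtains C where "C \<ge> 0"
    "\<And>u. norm u \<le> C * (norm (u - restrict_l2 A u) + norm (hankel_l2 a u - restrict_l2 S (hankel_l2 a u)))"
proof -
  have Al: "A \<in> sets lebesgue" and Sl: "S \<in> sets lebesgue" using A S by auto
  interpret RA: bounded_linear "restrict_l2 A" by (rule bounded_linear_restrict_l2[OF Al])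
  interpret RS: bounded_linear "restrict_l2 S" by (rule bounded_linear_restrict_l2[OF Sl])
  interpret H: bounded_linear "hankel_l2 a" by (rule hankel_l2_isometry[OF a])
  obtain M where M: "\<And>t. t \<ge> 0 \<Longrightarrow> \<bar>hankel_kernel a t\<bar> \<le> M"
    using hankel_kernel_bounded[OF a] by metis
  obtain C where C: "C \<ge> 0" "\<And>u. restrict_l2 A u = u \<Longrightarrow> norm u \<le> C * norm (hankel_l2 a u - restrict_l2 S (hankel_l2 a u))"
  proof (rule coercive_of_weakly_annihilating[where F = "hankel_l2 a" and T = "\<lambda>u. restrict_l2 S (hankel_l2 a u)"
        and V = "{u. restrict_l2 A u = u}" and K = "M\<^sup>2 * measure lebesgue A * measure lebesgue S"])
    show "bounded_linear (\<lambda>u. restrict_l2 S (hankel_l2 a u))"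
      by (rule bounded_linear_compose[OF RS.bounded_linear_axioms H.bounded_linear_axioms])
    show "subspace {u. restrict_l2 A u = u}" "closed {u. restrict_l2 A u = u}"
      by (rule subspace_restrict_fixed[OF Al], rule closed_restrict_fixed[OF Al])
    fix B :: "l2 set" assume "finite B" "orthonormal B" "B \<subseteq> {u. restrict_l2 A u = u}"
    thus "(\<Sum>b\<in>B. (norm (restrict_l2 S (hankel_l2 a b)))\<^sup>2) \<le> M\<^sup>2 * measure lebesgue A * measure lebesgue S"
      by (intro hankel_l2_hilbert_schmidt[OF a M A S]) auto
  next
    fix u assume "u \<in> {u. restrict_l2 A u = u}" "hankel_l2 a u = restrict_l2 S (hankel_l2 a u)"
    thus "u = 0" by (intro weakly_annihilating[OF a A S]) (auto simp: annihilated_def)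
  qed (auto simp: hankel_l2_isometry[OF a])
  show ?thesis
  proof (rule that[of "2 * C + 1"])
    fix u
    define v where "v = restrict_l2 A u"
    define x y where "x = norm (u - v)" and "y = norm (hankel_l2 a u - restrict_l2 S (hankel_l2 a u))"
    have zero_le_y: "y \<ge> 0" by (simp add: y_def)
    define w where "w = hankel_l2 a (u - v)"
    have w: "norm w = x" by (simp add: w_def x_def hankel_l2_isometry(2)[OF a])
    have "hankel_l2 a v - restrict_l2 S (hankel_l2 a v) =
        (hankel_l2 a u - restrict_l2 S (hankel_l2 a u)) - (w - restrict_l2 S w)"
      by (simp add: w_def H.diff RS.diff)
    hence "norm (hankel_l2 a v - restrict_l2 S (hankel_l2 a v)) \<le> y + norm (w - restrict_l2 S w)"
      unfolding y_def by (simp only: norm_triangle_ineq4)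
    also have "\<dots> \<le> y + (x + x)"
      using norm_triangle_ineq4[of w "restrict_l2 S w"] bounded_linear_restrict_l2(2)[OF Sl, of w] w by simp
    also have "\<dots> \<le> 2 * (x + y)" by (simp add: y_def[symmetric] zero_le_y)
    finally have "norm (hankel_l2 a v - restrict_l2 S (hankel_l2 a v)) \<le> 2 * (x + y)" .
    hence "C * norm (hankel_l2 a v - restrict_l2 S (hankel_l2 a v)) \<le> C * (2 * (x + y))"
      using C(1) by (rule mult_left_mono)
    hence "norm v \<le> C * (2 * (x + y))"
      using C(2)[of v] restrict_l2_idem[OF Al, of u] by (simp add: v_def)
    moreover have "norm u \<le> norm v + x" using norm_triangle_sub[of u v] by (simp add: x_def)
    moreover note zero_le_y
    ultimately have "norm u \<le> (2 * C + 1) * (x + y)" by (simp add: algebra_simps)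
    thus "norm u \<le> (2 * C + 1) * (norm (u - restrict_l2 A u) + norm (hankel_l2 a u - restrict_l2 S (hankel_l2 a u)))"
      by (simp add: x_def y_def v_def)
  qed (use C(1) in simp)
qed

section \<open>Transfer to the weighted space\<close>

definition bessel_weight :: "real \<Rightarrow> real \<Rightarrow> real" where
  "bessel_weight a x = (2 * pi) powr ((a + 1) / 2) * x powr (a + 1/2)"

definition unweighted_l2 :: "real \<Rightarrow> (real \<Rightarrow> real) \<Rightarrow> l2" where
  "unweighted_l2 a f = abs_l2 (\<lambda>x. bessel_weight a x * f x)"

lemma bessel_weight_mult:
  assumes "x \<ge> 0" "y \<ge> 0"
  shows "bessel_weight a x * bessel_weight a y = (2 * pi) powr (a + 1) * (x * y) powr (a + 1/2)"
proof -
  have "(2 * pi) powr ((a + 1) / 2) * (2 * pi) powr ((a + 1) / 2) = (2 * pi) powr (a + 1)"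
    unfolding powr_add[symmetric] by simp
  thus ?thesis using assms by (simp add: bessel_weight_def powr_mult mult_ac)
qed

lemma bessel_weight_square:
  assumes "x \<ge> 0"
  shows "(bessel_weight a x)\<^sup>2 = (2 * pi) powr (a + 1) * x powr (2 * a + 1)"
proof -
  have "x powr (a + 1/2) * x powr (a + 1/2) = x powr (2 * a + 1)"
    unfolding powr_add[symmetric] by (simp add: algebra_simps)
  thus ?thesis using bessel_weight_mult[OF assms assms, of a] assms
    by (simp add: power2_eq_square powr_mult)
qed

lemma bessel_weight_measurable:
  "a > -1/2 \<Longrightarrow> bessel_weight a \<in> borel_measurable halfline"
  unfolding bessel_weight_def[abs_def]
  by (intro continuous_on_halfline_measurable continuous_intros continuous_on_powr') auto

lemma mu_density:
  "mu a = density halfline (\<lambda>x. ennreal ((bessel_weight a x)\<^sup>2))" if "a > -1/2"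
proof -
  have e: "ennreal ((2 * pi) powr (a + 1) * x powr (2 * a + 1)) = ennreal ((bessel_weight a x)\<^sup>2)"
    if "x \<in> space halfline" for x
    using that by (simp add: bessel_weight_square)
  have m: "(\<lambda>x. ennreal ((bessel_weight a x)\<^sup>2)) \<in> borel_measurable halfline"
    using bessel_weight_measurable[OF that] by measurable
  show ?thesis unfolding mu_def
  proof (rule density_cong[OF _ m])
    show "(\<lambda>x. ennreal ((2 * pi) powr (a + 1) * x powr (2 * a + 1))) \<in> borel_measurable halfline"
      by (rule measurable_cong[THEN iffD2, OF e m])
  qed (rule AE_I2[OF e])
qed

lemma measurable_mu: "borel_measurable (mu a) = borel_measurable halfline"
  unfolding mu_def by (rule measurable_cong_sets) simp_all

lemma nn_integral_mu:
  assumes a: "a > -1/2" and f: "f \<in> borel_measurable halfline"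
  shows "(\<integral>\<^sup>+x. ennreal ((f x)\<^sup>2) \<partial>mu a) = (\<integral>\<^sup>+x. ennreal ((bessel_weight a x * f x)\<^sup>2) \<partial>halfline)"
proof -
  have [measurable]: "bessel_weight a \<in> borel_measurable halfline" "f \<in> borel_measurable halfline"
    using bessel_weight_measurable[OF a] f by auto
  have "(\<integral>\<^sup>+x. ennreal ((f x)\<^sup>2) \<partial>mu a) = (\<integral>\<^sup>+x. ennreal ((bessel_weight a x)\<^sup>2) * ennreal ((f x)\<^sup>2) \<partial>halfline)"
    unfolding mu_density[OF a] by (subst nn_integral_density) measurable
  also have "\<dots> = (\<integral>\<^sup>+x. ennreal ((bessel_weight a x * f x)\<^sup>2) \<partial>halfline)"
    by (simp add: power_mult_distrib ennreal_mult)
  finally show ?thesis .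
qed

lemma unweighted_sq_int:
  assumes a: "a > -1/2" and f: "f \<in> borel_measurable halfline"
    and fin: "(\<integral>\<^sup>+x. ennreal ((f x)\<^sup>2) \<partial>mu a) < \<infinity>"
  shows "sq_int (\<lambda>x. bessel_weight a x * f x)"
  using bessel_weight_measurable[OF a] f fin unfolding sq_int_iff_nn nn_integral_mu[OF a f] by auto

lemma memL2_Re_Im:
  assumes a: "a > -1/2" and f: "memL2 (mu a) f"
  shows "(\<lambda>x. Re (f x)) \<in> borel_measurable halfline" "(\<lambda>x. Im (f x)) \<in> borel_measurable halfline"
    "sq_int (\<lambda>x. bessel_weight a x * Re (f x))" "sq_int (\<lambda>x. bessel_weight a x * Im (f x))"
proof -
  have [measurable]: "f \<in> borel_measurable halfline" using f by (simp add: memL2_def measurable_mu)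
  show m: "(\<lambda>x. Re (f x)) \<in> borel_measurable halfline" "(\<lambda>x. Im (f x)) \<in> borel_measurable halfline"
    by measurable
  have "(\<integral>\<^sup>+x. ennreal ((Re (f x))\<^sup>2) \<partial>mu a) \<le> (\<integral>\<^sup>+x. ennreal ((norm (f x))\<^sup>2) \<partial>mu a)"
    "(\<integral>\<^sup>+x. ennreal ((Im (f x))\<^sup>2) \<partial>mu a) \<le> (\<integral>\<^sup>+x. ennreal ((norm (f x))\<^sup>2) \<partial>mu a)"
    by (intro nn_integral_mono ennreal_leI; simp add: cmod_power2)+
  thus "sq_int (\<lambda>x. bessel_weight a x * Re (f x))" "sq_int (\<lambda>x. bessel_weight a x * Im (f x))"
    using f m unfolding memL2_def by (auto intro!: unweighted_sq_int[OF a] intro: le_less_trans)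
qed

lemma L2norm_on_unweighted:
  assumes a: "a > -1/2" and f: "memL2 (mu a) f" and A: "A \<in> sets lebesgue"
  shows "L2norm_on (mu a) A f = sqrt ((norm (restrict_l2 A (unweighted_l2 a (\<lambda>x. Re (f x)))))\<^sup>2 +
    (norm (restrict_l2 A (unweighted_l2 a (\<lambda>x. Im (f x)))))\<^sup>2)"
proof -
  note fs = memL2_Re_Im[OF a f]
  have iA [measurable]: "(indicator A :: real \<Rightarrow> real) \<in> borel_measurable halfline"
    using A by (intro measurable_restrict_space1 borel_measurable_indicator)
  note fs(1,2) [measurable]
  have part: "(\<integral>\<^sup>+x. ennreal ((indicator A x * h x)\<^sup>2) \<partial>mu a) = ennreal ((norm (restrict_l2 A (unweighted_l2 a h)))\<^sup>2)"
    if h: "h \<in> borel_measurable halfline" "sq_int (\<lambda>x. bessel_weight a x * h x)" for h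
  proof -
    note h(1) [measurable]
    have m: "(\<lambda>x. indicator A x * h x) \<in> borel_measurable halfline" by measurable
    have s: "sq_int (\<lambda>x. indicator A x * (bessel_weight a x * h x))" by (rule sq_int_indicator[OF h(2) A])
    have "(\<integral>\<^sup>+x. ennreal ((indicator A x * h x)\<^sup>2) \<partial>mu a) =
        (\<integral>\<^sup>+x. ennreal ((indicator A x * (bessel_weight a x * h x))\<^sup>2) \<partial>halfline)"
      unfolding nn_integral_mu[OF a m] by (simp add: mult.left_commute)
    thus ?thesis unfolding nn_norm_abs_l2[OF s] unweighted_l2_def restrict_abs_l2[OF A h(2)] .
  qed
  have "(\<integral>\<^sup>+x\<in>A. ennreal ((norm (f x))^2) \<partial>mu a) =
      (\<integral>\<^sup>+x. ennreal ((indicator A x * Re (f x))\<^sup>2) + ennreal ((indicator A x * Im (f x))\<^sup>2) \<partial>mu a)"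
    by (intro nn_integral_cong) (auto simp: indicator_def cmod_power2 ennreal_plus)
  also have "\<dots> = (\<integral>\<^sup>+x. ennreal ((indicator A x * Re (f x))\<^sup>2) \<partial>mu a) +
      (\<integral>\<^sup>+x. ennreal ((indicator A x * Im (f x))\<^sup>2) \<partial>mu a)"
    by (intro nn_integral_add; unfold measurable_mu; measurable)
  also have "\<dots> = ennreal ((norm (restrict_l2 A (unweighted_l2 a (\<lambda>x. Re (f x)))))\<^sup>2 +
    (norm (restrict_l2 A (unweighted_l2 a (\<lambda>x. Im (f x)))))\<^sup>2)"
    by (simp add: part fs ennreal_plus)
  finally show ?thesis unfolding L2norm_on_def by (simp del: ennreal_plus)
qed

text \<open>The density contributes two factors of the weight at \<open>x\<close>: one stays with
  \<open>f\<close>, the other combines with the weight at \<open>y\<close> and the Bessel function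
  to form \<open>hankel_kernel\<close>. The kernel being real, the two parts of \<open>f\<close> do
  not mix.\<close>

lemma FB1_unweighted:
  assumes a: "a > -1/2" and f: "f \<in> borel_measurable halfline"
    and re: "integrable halfline (\<lambda>x. bessel_weight a x * Re (f x))"
    and im: "integrable halfline (\<lambda>x. bessel_weight a x * Im (f x))" and y: "y \<ge> 0"
  shows "bessel_weight a y * Re (FB1 a f y) = hankel a (\<lambda>x. bessel_weight a x * Re (f x)) y"
    "bessel_weight a y * Im (FB1 a f y) = hankel a (\<lambda>x. bessel_weight a x * Im (f x)) y"
proof -
  define p q where "p = (\<lambda>x. bessel_weight a x * Re (f x) * hankel_kernel a (x * y))"
    and "q = (\<lambda>x. bessel_weight a x * Im (f x) * hankel_kernel a (x * y))"
  have pq: "integrable halfline p" "integrable halfline q"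
    unfolding p_def q_def by (intro hankel_integrable a y re im)+
  have wm [measurable]: "bessel_weight a \<in> borel_measurable halfline" by (rule bessel_weight_measurable[OF a])
  have jm [measurable]: "(\<lambda>x. bessel_j a (2 * pi * x * y)) \<in> borel_measurable halfline"
    using a by (intro continuous_on_halfline_measurable continuous_on_compose2[OF continuous_on_bessel_j[of a UNIV]] continuous_intros) auto
  note f [measurable]
  have "complex_of_real (bessel_weight a y) * FB1 a f y =
      complex_of_real (bessel_weight a y) * (\<integral>x. (bessel_weight a x)\<^sup>2 *\<^sub>R (f x * complex_of_real (bessel_j a (2 * pi * x * y))) \<partial>halfline)"
    unfolding FB1_def mu_density[OF a] by (subst integral_density) auto
  also have "\<dots> = (\<integral>x. complex_of_real (bessel_weight a y) * ((bessel_weight a x)\<^sup>2 *\<^sub>R (f x * complex_of_real (bessel_j a (2 * pi * x * y)))) \<partial>halfline)"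
    by (rule integral_mult_right_zero[symmetric])
  also have "\<dots> = (\<integral>x. complex_of_real (p x) + \<i> * complex_of_real (q x) \<partial>halfline)"
  proof (rule Bochner_Integration.integral_cong[OF refl])
    fix x assume "x \<in> space halfline"
    hence k: "hankel_kernel a (x * y) = bessel_weight a x * bessel_weight a y * bessel_j a (2 * pi * x * y)"
      using y by (simp add: hankel_kernel_def bessel_weight_mult mult.assoc)
    show "complex_of_real (bessel_weight a y) * ((bessel_weight a x)\<^sup>2 *\<^sub>R (f x * complex_of_real (bessel_j a (2 * pi * x * y)))) =
        complex_of_real (p x) + \<i> * complex_of_real (q x)"
      by (rule complex_eqI) (simp_all add: p_def q_def k power2_eq_square)
  qed
  also have "\<dots> = complex_of_real (\<integral>x. p x \<partial>halfline) + \<i> * complex_of_real (\<integral>x. q x \<partial>halfline)"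
    using pq by simp
  also have "\<dots> = complex_of_real (hankel a (\<lambda>x. bessel_weight a x * Re (f x)) y) +
      \<i> * complex_of_real (hankel a (\<lambda>x. bessel_weight a x * Im (f x)) y)"
    by (simp only: hankel_def p_def q_def)
  finally have e: "complex_of_real (bessel_weight a y) * FB1 a f y =
      complex_of_real (hankel a (\<lambda>x. bessel_weight a x * Re (f x)) y) +
      \<i> * complex_of_real (hankel a (\<lambda>x. bessel_weight a x * Im (f x)) y)" .
  show "bessel_weight a y * Re (FB1 a f y) = hankel a (\<lambda>x. bessel_weight a x * Re (f x)) y"
    using arg_cong[OF e, of Re] by simp
  show "bessel_weight a y * Im (FB1 a f y) = hankel a (\<lambda>x. bessel_weight a x * Im (f x)) y"
    using arg_cong[OF e, of Im] by simp
qed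

lemma FB1_measurable:
  assumes a: "a > -1/2" and f: "f \<in> borel_measurable halfline"
    and re: "integrable halfline (\<lambda>x. bessel_weight a x * Re (f x))"
    and im: "integrable halfline (\<lambda>x. bessel_weight a x * Im (f x))"
  shows "FB1 a f \<in> borel_measurable halfline"
proof -
  define h k where "h = hankel a (\<lambda>x. bessel_weight a x * Re (f x))"
    and "k = hankel a (\<lambda>x. bessel_weight a x * Im (f x))"
  have [measurable]: "h \<in> borel_measurable halfline" "k \<in> borel_measurable halfline"
    unfolding h_def k_def by (rule hankel_measurable[OF a re], rule hankel_measurable[OF a im])
  have [measurable]: "bessel_weight a \<in> borel_measurable halfline" by (rule bessel_weight_measurable[OF a])
  have [measurable]: "(indicator {0} :: real \<Rightarrow> complex) \<in> borel_measurable halfline"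
    by (intro measurable_restrict_space1 borel_measurable_indicator) auto
  \<comment> \<open>Dividing by the weight recovers the transform except at \<open>y = 0\<close>,
    where the weight is 0 and the quotients are 0 by convention. The indicator term restores the
    value at that point.\<close>
  have e: "FB1 a f y = complex_of_real (h y / bessel_weight a y) + \<i> * complex_of_real (k y / bessel_weight a y) +
      indicator {0} y * FB1 a f 0" if "y \<in> space halfline" for y
  proof (cases "y = 0")
    case True
    thus ?thesis using a by (simp add: bessel_weight_def)
  next
    case False
    hence y: "y \<ge> 0" "bessel_weight a y \<noteq> 0" using that by (auto simp: bessel_weight_def)
    show ?thesis using FB1_unweighted[OF a f re im y(1)] y(2) False
      by (intro complex_eqI) (auto simp: h_def k_def field_simps)
  qed
  have m: "(\<lambda>y. complex_of_real (h y / bessel_weight a y) + \<i> * complex_of_real (k y / bessel_weight a y) +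
      indicator {0} y * FB1 a f 0) \<in> borel_measurable halfline"
    by measurable
  show ?thesis by (rule measurable_cong[THEN iffD2, OF e m])
qed

text \<open>The unweighted transforms of the truncations converge in \<open>l2\<close> to the part
  of \<open>g\<close>, by the definition of \<open>FB2\<close>, and to \<open>hankel_l2\<close>, by
  \<open>hankel_l2_tendsto\<close>. \<open>P\<close> stands for \<open>Re\<close> or
  \<open>Im\<close>.\<close>

lemma FB2_unweighted:
  assumes a: "a > -1/2" and f: "memL2 (mu a) f" and fg: "FB2 a f g"
  shows "unweighted_l2 a (\<lambda>x. Re (g x)) = hankel_l2 a (unweighted_l2 a (\<lambda>x. Re (f x)))"
    "unweighted_l2 a (\<lambda>x. Im (g x)) = hankel_l2 a (unweighted_l2 a (\<lambda>x. Im (f x)))"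
proof -
  define t where "t = (\<lambda>n x. indicator {0..real n} x * f x)"
  define X where "X = (\<lambda>n. \<integral>\<^sup>+y. ennreal ((norm (FB1 a (t n) y - g y))^2) \<partial>mu a)"
  have g: "memL2 (mu a) g" and X: "X \<longlonglongrightarrow> 0"
    using fg by (auto simp: FB2_def X_def t_def)
  note fs = memL2_Re_Im[OF a f] and gs = memL2_Re_Im[OF a g]
  have fm [measurable]: "f \<in> borel_measurable halfline" using f by (simp add: memL2_def measurable_mu)
  have gm [measurable]: "g \<in> borel_measurable halfline" using g by (simp add: memL2_def measurable_mu)
  have im [measurable]: "(indicator {0..real n} :: real \<Rightarrow> complex) \<in> borel_measurable halfline" for n
    by (intro measurable_restrict_space1 borel_measurable_indicator) auto
  have tm: "t n \<in> borel_measurable halfline" for n unfolding t_def by measurable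
  have wm [measurable]: "bessel_weight a \<in> borel_measurable halfline" by (rule bessel_weight_measurable[OF a])
  have tr: "Re (t n x) = indicator {0..real n} x * Re (f x)" "Im (t n x) = indicator {0..real n} x * Im (f x)" for n x
    by (auto simp: t_def indicator_def)
  have ti: "integrable halfline (\<lambda>x. bessel_weight a x * Re (t n x))" "integrable halfline (\<lambda>x. bessel_weight a x * Im (t n x))" for n
    using truncation_L1_L2(1)[OF fs(3), of n] truncation_L1_L2(1)[OF fs(4), of n]
    by (simp_all add: tr mult.left_commute)
  have main: "unweighted_l2 a (\<lambda>x. P (g x)) = hankel_l2 a (unweighted_l2 a (\<lambda>x. P (f x)))"
    if P: "\<And>z. \<bar>P z\<bar> \<le> norm z" "P \<in> borel_measurable borel" "\<And>y z. P (y - z) = P y - P z"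
        "\<And>n x. P (t n x) = indicator {0..real n} x * P (f x)"
      and sf: "sq_int (\<lambda>x. bessel_weight a x * P (f x))" and sg: "sq_int (\<lambda>x. bessel_weight a x * P (g x))"
      and FB: "\<And>n y. y \<ge> 0 \<Longrightarrow> bessel_weight a y * P (FB1 a (t n) y) = hankel a (\<lambda>x. bessel_weight a x * P (t n x)) y"
    for P :: "complex \<Rightarrow> real"
  proof -
    define h where "h = (\<lambda>n. hankel a (\<lambda>x. indicator {0..real n} x * (bessel_weight a x * P (f x))))"
    have h: "sq_int (h n)" for n unfolding h_def by (rule hankel_isometry(1)[OF a truncation_L1_L2[OF sf]])
    have FBh: "bessel_weight a y * P (FB1 a (t n) y) = h n y" if "y \<ge> 0" for n y
      using FB[OF that] by (simp add: P(4) h_def mult.left_commute)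
    have le: "ennreal ((norm (abs_l2 (h n) - unweighted_l2 a (\<lambda>x. P (g x))))\<^sup>2) \<le> X n" for n
    proof -
      have "ennreal ((norm (abs_l2 (h n) - unweighted_l2 a (\<lambda>x. P (g x))))\<^sup>2) =
          (\<integral>\<^sup>+y. ennreal ((h n y - bessel_weight a y * P (g y))\<^sup>2) \<partial>halfline)"
        unfolding unweighted_l2_def abs_l2_diff[OF h sg] by (rule nn_norm_abs_l2[OF sq_int_diff[OF h sg], symmetric])
      also have "\<dots> = (\<integral>\<^sup>+y. ennreal ((bessel_weight a y)\<^sup>2) * ennreal ((P (FB1 a (t n) y - g y))\<^sup>2) \<partial>halfline)"
      proof (rule nn_integral_cong)
        fix y assume "y \<in> space halfline"
        hence "h n y - bessel_weight a y * P (g y) = bessel_weight a y * P (FB1 a (t n) y - g y)"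
          by (simp add: FBh[symmetric] P(3) right_diff_distrib)
        thus "ennreal ((h n y - bessel_weight a y * P (g y))\<^sup>2) =
            ennreal ((bessel_weight a y)\<^sup>2) * ennreal ((P (FB1 a (t n) y - g y))\<^sup>2)"
          by (simp add: power_mult_distrib ennreal_mult)
      qed
      also have "\<dots> \<le> (\<integral>\<^sup>+y. ennreal ((bessel_weight a y)\<^sup>2) * ennreal ((norm (FB1 a (t n) y - g y))\<^sup>2) \<partial>halfline)"
      proof (intro nn_integral_mono mult_left_mono ennreal_leI)
        fix y
        have "\<bar>P (FB1 a (t n) y - g y)\<bar>\<^sup>2 \<le> (norm (FB1 a (t n) y - g y))\<^sup>2"
          by (intro power_mono P) auto
        thus "(P (FB1 a (t n) y - g y))\<^sup>2 \<le> (norm (FB1 a (t n) y - g y))\<^sup>2" by simp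
      qed simp
      also have "\<dots> = X n"
      proof -
        have [measurable]: "FB1 a (t n) \<in> borel_measurable halfline"
          by (rule FB1_measurable[OF a tm ti])
        thus ?thesis unfolding X_def mu_density[OF a] by (subst nn_integral_density) auto
      qed
      finally show ?thesis .
    qed
    have "(\<lambda>n. ennreal ((norm (abs_l2 (h n) - unweighted_l2 a (\<lambda>x. P (g x))))\<^sup>2)) \<longlonglongrightarrow> 0"
      by (rule tendsto_sandwich[OF _ _ tendsto_const X]) (auto simp: le)
    hence "(\<lambda>n. (norm (abs_l2 (h n) - unweighted_l2 a (\<lambda>x. P (g x))))\<^sup>2) \<longlonglongrightarrow> 0"
      by (subst (asm) ennreal_0[symmetric], subst (asm) tendsto_ennreal_iff) auto
    from tendsto_real_sqrt[OF this, unfolded real_sqrt_zero]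
    have "(\<lambda>n. norm (abs_l2 (h n) - unweighted_l2 a (\<lambda>x. P (g x)))) \<longlonglongrightarrow> 0" by simp
    hence "(\<lambda>n. abs_l2 (h n)) \<longlonglongrightarrow> unweighted_l2 a (\<lambda>x. P (g x))"
      by (rule LIM_zero_cancel[OF tendsto_norm_zero_cancel])
    moreover have "(\<lambda>n. abs_l2 (h n)) \<longlonglongrightarrow> hankel_l2 a (unweighted_l2 a (\<lambda>x. P (f x)))"
      unfolding h_def unweighted_l2_def by (rule hankel_l2_tendsto[OF a sf])
    ultimately show ?thesis by (rule LIMSEQ_unique)
  qed
  show "unweighted_l2 a (\<lambda>x. Re (g x)) = hankel_l2 a (unweighted_l2 a (\<lambda>x. Re (f x)))"
    by (rule main[OF abs_Re_le_cmod _ _ tr(1) fs(3) gs(3) FB1_unweighted(1)[OF a tm ti]]) simp_all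
  show "unweighted_l2 a (\<lambda>x. Im (g x)) = hankel_l2 a (unweighted_l2 a (\<lambda>x. Im (f x)))"
    by (rule main[OF abs_Im_le_cmod _ _ tr(2) fs(4) gs(4) FB1_unweighted(2)[OF a tm ti]]) simp_all
qed

theorem theorem4p4:
  fixes a :: real and S \<Sigma> :: "real set"
  assumes "a > -1/2"
    and "S \<in> sets lebesgue" "S \<subseteq> {0..}" "0 < emeasure lebesgue S" "emeasure lebesgue S < \<infinity>"
    and "\<Sigma> \<in> sets lebesgue" "\<Sigma> \<subseteq> {0..}" "0 < emeasure lebesgue \<Sigma>" "emeasure lebesgue \<Sigma> < \<infinity>"
  shows "\<exists>C::real. \<forall>f g. memL2 (mu a) f \<longrightarrow> FB2 a f g \<longrightarrow>
           L2norm_on (mu a) {0..} f \<le>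
             C * (L2norm_on (mu a) ({0..} - S) f + L2norm_on (mu a) ({0..} - \<Sigma>) g)"
proof -
  note a = assms(1)
  have S: "S \<in> lmeasurable" "\<Sigma> \<in> lmeasurable" using assms by (auto simp: fmeasurable_def)
  obtain C where C: "C \<ge> 0" "\<And>u. norm u \<le> C * (norm (u - restrict_l2 S u) +
      norm (hankel_l2 a u - restrict_l2 \<Sigma> (hankel_l2 a u)))"
    using strongly_annihilating[OF a S] by metis
  have full: "restrict_l2 {0..} u = u" for u
    by (subst restrict_l2_fixed_iff) (auto intro!: AE_I2)
  \<comment> \<open>This translates norms over complements into the differences occurring in
    \<open>strongly_annihilating\<close>.\<close>
  have compl: "restrict_l2 ({0..} - A) u = u - restrict_l2 A u" if "A \<in> sets lebesgue" for A u
  proof -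
    obtain f where f: "sq_int f" "u = abs_l2 f" by (rule l2_cases)
    have "restrict_l2 ({0..} - A) u = abs_l2 (\<lambda>x. indicator ({0..} - A) x * f x)"
      unfolding f(2) using that f(1) by (intro restrict_abs_l2) auto
    also have "\<dots> = abs_l2 (\<lambda>x. f x - indicator A x * f x)"
    proof (rule abs_l2_eq_iff[THEN iffD2])
      show "sq_int (\<lambda>x. indicator ({0..} - A) x * f x)"
        using that by (intro sq_int_indicator[OF f(1)] sets.Diff) auto
      show "sq_int (\<lambda>x. f x - indicator A x * f x)"
        by (rule sq_int_diff[OF f(1) sq_int_indicator[OF f(1) that]])
    qed (rule AE_I2, auto simp: indicator_def)
    also have "\<dots> = u - restrict_l2 A u"
      using that f by (simp add: restrict_abs_l2 abs_l2_diff sq_int_indicator)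
    finally show ?thesis .
  qed
  show ?thesis
  \<comment> \<open>The estimate is applied to the real and imaginary parts separately. The factor 2
    comes from recombining them through \<open>p + q \<le> 2 * sqrt (p^2 + q^2)\<close>.\<close>
  proof (intro exI[of _ "2 * C"] allI impI)
    fix f g assume f: "memL2 (mu a) f" and fg: "FB2 a f g"
    hence g: "memL2 (mu a) g" by (simp add: FB2_def)
    define u v where "u = unweighted_l2 a (\<lambda>x. Re (f x))" and "v = unweighted_l2 a (\<lambda>x. Im (f x))"
    define p q where "p = norm (u - restrict_l2 S u)" and "q = norm (v - restrict_l2 S v)"
    define r s where "r = norm (hankel_l2 a u - restrict_l2 \<Sigma> (hankel_l2 a u))"
      and "s = norm (hankel_l2 a v - restrict_l2 \<Sigma> (hankel_l2 a v))"
    have 1: "L2norm_on (mu a) {0..} f = sqrt ((norm u)\<^sup>2 + (norm v)\<^sup>2)"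
      using L2norm_on_unweighted[OF a f, of "{0..}"] by (simp add: full u_def v_def)
    have cS: "{0..} - S \<in> sets lebesgue" "{0..} - \<Sigma> \<in> sets lebesgue"
      using assms by (intro sets.Diff; simp)+
    have 2: "L2norm_on (mu a) ({0..} - S) f = sqrt (p\<^sup>2 + q\<^sup>2)"
      using L2norm_on_unweighted[OF a f cS(1)] assms
      by (simp add: compl u_def v_def p_def q_def)
    have 3: "L2norm_on (mu a) ({0..} - \<Sigma>) g = sqrt (r\<^sup>2 + s\<^sup>2)"
      using L2norm_on_unweighted[OF a g cS(2)] assms
      by (simp add: compl u_def v_def r_def s_def FB2_unweighted[OF a f fg])
    have "sqrt ((norm u)\<^sup>2 + (norm v)\<^sup>2) \<le> norm u + norm v"
      by (rule sqrt_sum_squares_le_sum) auto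
    also have "\<dots> \<le> C * (p + r) + C * (q + s)"
      using C(2)[of u] C(2)[of v] by (simp add: p_def q_def r_def s_def)
    also have "\<dots> = C * (p + q + r + s)" by (simp add: algebra_simps)
    also have "\<dots> \<le> C * (2 * (sqrt (p\<^sup>2 + q\<^sup>2) + sqrt (r\<^sup>2 + s\<^sup>2)))"
    proof (rule mult_left_mono[OF _ C(1)])
      have le: "x + y \<le> 2 * sqrt (x\<^sup>2 + y\<^sup>2)" for x y :: real
        using add_mono[of x "sqrt (x\<^sup>2 + y\<^sup>2)" y "sqrt (x\<^sup>2 + y\<^sup>2)"] by simp
      show "p + q + r + s \<le> 2 * (sqrt (p\<^sup>2 + q\<^sup>2) + sqrt (r\<^sup>2 + s\<^sup>2))"
        using le[of p q] le[of r s] by (simp add: algebra_simps)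
    qed
    finally show "L2norm_on (mu a) {0..} f \<le>
        2 * C * (L2norm_on (mu a) ({0..} - S) f + L2norm_on (mu a) ({0..} - \<Sigma>) g)"
      unfolding 1 2 3 by (simp add: algebra_simps)
  qed
qed

end
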